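(* Let $n\ge 2$. There is a map from $\mathcal{DA}_n$ to the augmented dual bar complex $\mathcal{D}_n$ of $\mathcal{D}end$, which identifies $\mathcal{DA}_n$ with a direct summand of $\mathcal{D}_n$. Each basis element of $\tilde{\mathcal{D}}_n$ appears with non-zero coefficient in the image of exactly one basis element of $\mathcal{DA}_n$, where the coefficient is $1$.
   Context: Conventions. $k$ is an algebraically closed field of characteristic zero; all operads are over $k$ and come from non-symmetric operads, so symmetric group actions are suppressed. Maps between complexes are maps of complexes. "Tree" means a planar rooted tree in which each vertex $v$ has $|v|\ge2$ incoming edges; an internal edge is an edge between two vertices. For a finite-dimensional vector space $\Omega$ and $\Lambda\subset\Omega^{\otimes 2}\oplus\Omega^{\otimes 2}$, $\mathcal{P}(\Omega,\Lambda)$ is the operad generated by binary operations $\Omega$ with relations $u=v$ for $(u,v)\in\Lambda$, where $\circ_1\otimes\circ_2$ in the first summand stands for $(x\circ_1 y)\circ_2 z$ and $\circ_3\otimes\circ_4$ in the second stands for $x\circ_3(y\circ_4 z)$. Its quadratic dual is $\mathcal{P}(\Omega,\Lambda)^!=\mathcal{P}(\Omega^\vee,\Lambda^\perp)$, $\Lambda^\perp=\{(f,g): f(u)=g(v)\ \forall (u,v)\in\Lambda\}$. The operad $\mathcal{D}end$ is generated by $\prec,\succ$ with relations (numbered 1, 2, 3), where $*=\prec+\succ$: $(x\prec y)\prec z=x\prec(y*z)$; $(x\succ y)\prec z=x\succ(y\prec z)$; $(x*y)\succ z=x\succ(y\succ z)$. Put $\mathcal{D}ias=\mathcal{D}end^!$;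 it is known that $\dim\mathcal{D}ias(l)=l$ and that $\mathcal{D}end$ is Koszul. Associahedron. $\mathcal{CA}_n$ is the augmented cellular chain complex of the $(n-2)$-dimensional associahedron, graded by minus the dimension of cells: $\mathcal{CA}_n^j$ ($-n+2\le j\le0$) has as basis the trees with $n$ leaves and $n+j-1$ vertices, and $\mathcal{CA}_n^1=k$ (generated by the empty cell). The differential raises degree by one; the coefficient $\varepsilon(T,T')$ of $T'$ in the differential of $T$ is $\pm1$ if $T$ is obtained from $T'$ by contracting an internal edge and $0$ otherwise, the signs being determined by a fixed choice of orientations of the cells in which each $1$-cell is oriented from the tree containing the local shape $(xy)z$ to the one containing $x(yz)$; each binary tree is sent to $1\in\mathcal{CA}_n^1$. Labelled copies. For a tree $T$ with $n$ leaves and $1\le i\le n$, the $i$-th labelling of $T$ assigns to each vertex on the path from the $i$-th leaf (from the left) to the root the number $r$ such that this path enters the vertex through its $r$-th incoming edge from the left, and assigns $*$ to every other vertex. $\mathcal{DA}_n$ is the direct sum of $n$ copies of $\mathcal{CA}_n$; in degrees $\le0$ the basis of the $i$-th copy consists of the trees with their $i$-th labelling, with the same differential coefficients $\varepsilon(T,T')$ as in $\mathcal{CA}_n$. Dual bar complex. $\tilde{\mathcal{D}}_n$ is the arity $n$ part of the bar complex of $\mathcal{D}ias$: $\tilde{\mathcal{D}}_n^j=\mathcal{D}_n^j=\bigoplus_T\bigotimes_v\mathcal{D}ias(|v|)^\vee$ ($-n+2\le j\le0$), over trees $T$ with $n$ leaves and $n+j-1$ vertices. The differential raises degree by one; its component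 from $T$ to $T'$ is zero unless $T$ is obtained from $T'$ by contracting an internal edge, in which case it is $\varepsilon(T,T')$ times the dual of the corresponding partial composition of $\mathcal{D}ias$. Its homology in degree $0$ is $\mathcal{D}end(n)$ and its other homology vanishes. The augmented complex $\mathcal{D}_n$ equals $\tilde{\mathcal{D}}_n$ in degrees $\le0$ and has $\mathcal{D}_n^1=\mathcal{D}end(n)$, with the canonical quotient map $\mathcal{D}_n^0\to\mathcal{D}end(n)$; it is exact. Basis of $\tilde{\mathcal{D}}_n$. It consists of the trees with $n$ leaves in which each vertex $v$ carries a label from $\{1,\dots,|v|\}$. Here the labels $1,\dots,l$ stand for the following basis of $\mathcal{D}_l^{-l+2}=\mathcal{D}ias(l)^\vee$: for $l=2$, $1=\prec$ and $2=\succ$; for $l\ge3$, inductively, the label $i$ on the tree $T$ with $l$ leaves and one vertex is the element whose differential is $\sum_{T'}\varepsilon(T,T')\,T'$, over trees $T'$ with $l$ leaves and two vertices, each $T'$ carrying its $i$-th labelling, where a label $*$ at a vertex $w$ stands for the sum of the labels $1,\dots,|w|$. (For $l=3$ these are the three relations of $\mathcal{D}end$ in the order above.) *)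

theory Defs
  imports
    "HOL-Library.Poly_Mapping"
    "HOL-Library.Function_Algebras"
    "HOL-Library.Product_Plus"
    "HOL-Computational_Algebra.Polynomial"
begin

section \<open>Binary quadratic non-symmetric operads\<close>

text \<open>
  The monomials in binary operations \<^typ>\<open>'x\<close> are the planar binary trees with vertices decorated by
  \<^typ>\<open>'x\<close>; \<^term>\<open>Op s a t\<close> is \<open>s a t\<close> in infix notation.  The free operad is the vector space
  \<open>'x bmon \<Rightarrow>\<^sub>0 'k\<close>, the direct sum of its components of all arities.  A finite-dimensional space
  \<open>\<Omega>\<close> with basis indexed by \<^typ>\<open>'x\<close> is the function space \<open>'x \<Rightarrow> 'k\<close>; its dual is again
  \<open>'x \<Rightarrow> 'k\<close>, in coordinates with respect to the dual basis.
\<close>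

datatype 'x bmon = Lf | Op "'x bmon" 'x "'x bmon"

primrec arity :: "'x bmon \<Rightarrow> nat" where
  "arity Lf = 1"
| "arity (Op s a t) = arity s + arity t"

primrec graft :: "nat \<Rightarrow> 'x bmon \<Rightarrow> 'x bmon \<Rightarrow> 'x bmon" where
  "graft i Lf u = u"
| "graft i (Op s a t) u =
     (if i \<le> arity s then Op (graft i s u) a t else Op s a (graft (i - arity s) t u))"

definition pscale :: "'k::field \<Rightarrow> ('x \<Rightarrow>\<^sub>0 'k) \<Rightarrow> ('x \<Rightarrow>\<^sub>0 'k)" where
  "pscale c = Poly_Mapping.map ((*) c)"

text \<open>
  The partial composition \<open>p \<circ>\<^sub>i q\<close>, extended bilinearly to all of the direct sum: components of
  \<open>p\<close> of arity less than \<open>i\<close> contribute zero.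
\<close>

definition free_comp ::
    "nat \<Rightarrow> ('x bmon \<Rightarrow>\<^sub>0 'k::field) \<Rightarrow> ('x bmon \<Rightarrow>\<^sub>0 'k) \<Rightarrow> ('x bmon \<Rightarrow>\<^sub>0 'k)" where
  "free_comp i p q =
     (\<Sum>s\<in>Poly_Mapping.keys p. \<Sum>t\<in>Poly_Mapping.keys q.
        if 1 \<le> i \<and> i \<le> arity s
        then Poly_Mapping.single (graft i s t) (Poly_Mapping.lookup p s * Poly_Mapping.lookup q t)
        else 0)"

definition free_arity :: "nat \<Rightarrow> ('x bmon \<Rightarrow>\<^sub>0 'k::field) set" where
  "free_arity n = {p. \<forall>m\<in>Poly_Mapping.keys p. arity m = n}"

text \<open>
  An element of \<open>\<Omega>\<^sup>\<otimes>\<^sup>2\<close> is a function on pairs.  The pair \<open>(u, v)\<close> gives the relation \<open>u = v\<close>, with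
  \<open>(a, b)\<close> standing for \<open>(x a y) b z\<close> in \<open>u\<close> and for \<open>x a (y b z)\<close> in \<open>v\<close>.
\<close>

type_synonym ('x, 'k) quad_data = "(('x \<times> 'x \<Rightarrow> 'k) \<times> ('x \<times> 'x \<Rightarrow> 'k)) set"

definition quad_relator ::
    "('x::finite \<times> 'x \<Rightarrow> 'k::field) \<Rightarrow> ('x \<times> 'x \<Rightarrow> 'k) \<Rightarrow> ('x bmon \<Rightarrow>\<^sub>0 'k)" where
  "quad_relator u v =
     (\<Sum>(a, b)\<in>UNIV. Poly_Mapping.single (Op (Op Lf a Lf) b Lf) (u (a, b)))
   - (\<Sum>(a, b)\<in>UNIV. Poly_Mapping.single (Op Lf a (Op Lf b Lf)) (v (a, b)))"

inductive_set quad_ideal :: "('x::finite, 'k::field) quad_data \<Rightarrow> ('x bmon \<Rightarrow>\<^sub>0 'k) set"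
  for \<Lambda> :: "('x, 'k) quad_data" where
  relator: "(u, v) \<in> \<Lambda> \<Longrightarrow> quad_relator u v \<in> quad_ideal \<Lambda>"
| zero: "0 \<in> quad_ideal \<Lambda>"
| add: "p \<in> quad_ideal \<Lambda> \<Longrightarrow> q \<in> quad_ideal \<Lambda> \<Longrightarrow> p + q \<in> quad_ideal \<Lambda>"
| scale: "p \<in> quad_ideal \<Lambda> \<Longrightarrow> pscale c p \<in> quad_ideal \<Lambda>"
| comp_left: "p \<in> quad_ideal \<Lambda> \<Longrightarrow> free_comp i p q \<in> quad_ideal \<Lambda>"
| comp_right: "q \<in> quad_ideal \<Lambda> \<Longrightarrow> free_comp i p q \<in> quad_ideal \<Lambda>"

definition quad_perp :: "('x::finite, 'k::field) quad_data \<Rightarrow> ('x, 'k) quad_data" where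
  "quad_perp \<Lambda> = {(f, g). \<forall>(u, v)\<in>\<Lambda>. (\<Sum>x\<in>UNIV. f x * u x) = (\<Sum>x\<in>UNIV. g x * v x)}"

definition quad_eq ::
    "('x::finite, 'k::field) quad_data \<Rightarrow> ('x bmon \<Rightarrow>\<^sub>0 'k) \<Rightarrow> ('x bmon \<Rightarrow>\<^sub>0 'k) \<Rightarrow> bool" where
  "quad_eq \<Lambda> p q \<longleftrightarrow> p - q \<in> quad_ideal \<Lambda>"

lemma lookup_pscale [simp]: "Poly_Mapping.lookup (pscale c p) x = c * Poly_Mapping.lookup p x"
  by (simp add: pscale_def Poly_Mapping.map.rep_eq when_def)

lemma pscale_simps:
  "pscale c (p + q) = pscale c p + pscale c q"
  "pscale (c + d) p = pscale c p + pscale d p"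
  "pscale c (pscale d p) = pscale (c * d) p"
  "pscale 1 p = p"
  "pscale (- 1) p = - p"
  "pscale c (p - q) = pscale c p - pscale c q"
  by (rule poly_mapping_eqI; simp add: lookup_add lookup_minus algebra_simps)+

lemma free_comp_superset:
  assumes "finite A" "Poly_Mapping.keys p \<subseteq> A" "finite B" "Poly_Mapping.keys q \<subseteq> B"
  shows "free_comp i p q =
     (\<Sum>s\<in>A. \<Sum>t\<in>B.
        if 1 \<le> i \<and> i \<le> arity s
        then Poly_Mapping.single (graft i s t) (Poly_Mapping.lookup p s * Poly_Mapping.lookup q t)
        else 0)"
proof -
  have "free_comp i p q =
     (\<Sum>s\<in>Poly_Mapping.keys p. \<Sum>t\<in>B.
        if 1 \<le> i \<and> i \<le> arity s
        then Poly_Mapping.single (graft i s t) (Poly_Mapping.lookup p s * Poly_Mapping.lookup q t)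
        else 0)"
    unfolding free_comp_def using assms
    by (intro sum.cong refl sum.mono_neutral_left) (auto simp: in_keys_iff)
  also have "\<dots> = (\<Sum>s\<in>A. \<Sum>t\<in>B.
        if 1 \<le> i \<and> i \<le> arity s
        then Poly_Mapping.single (graft i s t) (Poly_Mapping.lookup p s * Poly_Mapping.lookup q t)
        else 0)"
    using assms by (intro sum.mono_neutral_left) (auto simp: in_keys_iff intro!: sum.neutral)
  finally show ?thesis .
qed

lemma free_comp_diff_left: "free_comp i (p - p') q = free_comp i p q - free_comp i p' q"
proof -
  let ?A = "Poly_Mapping.keys p \<union> Poly_Mapping.keys p'"
  let ?B = "Poly_Mapping.keys q"
  have k: "Poly_Mapping.keys (p - p') \<subseteq> ?A"
    by (auto simp: in_keys_iff lookup_minus)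
  show ?thesis
    by (subst (1 2 3) free_comp_superset[of ?A _ ?B])
       (use k in \<open>auto simp: sum_subtractf[symmetric] lookup_minus algebra_simps single_diff
          intro!: sum.cong\<close>)
qed

lemma free_comp_diff_right: "free_comp i p (q - q') = free_comp i p q - free_comp i p q'"
proof -
  let ?A = "Poly_Mapping.keys p"
  let ?B = "Poly_Mapping.keys q \<union> Poly_Mapping.keys q'"
  have k: "Poly_Mapping.keys (q - q') \<subseteq> ?B"
    by (auto simp: in_keys_iff lookup_minus)
  show ?thesis
    by (subst (1 2 3) free_comp_superset[of ?A _ ?B])
       (use k in \<open>auto simp: sum_subtractf[symmetric] lookup_minus algebra_simps single_diff
          intro!: sum.cong\<close>)
qed

lemma quad_ideal_uminus: "p \<in> quad_ideal \<Lambda> \<Longrightarrow> - p \<in> quad_ideal \<Lambda>"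
  using quad_ideal.scale[of p \<Lambda> "- 1"] by (simp add: pscale_simps)

lemma quad_ideal_diff: "p \<in> quad_ideal \<Lambda> \<Longrightarrow> q \<in> quad_ideal \<Lambda> \<Longrightarrow> p - q \<in> quad_ideal \<Lambda>"
  using quad_ideal.add[of p \<Lambda> "- q"] quad_ideal_uminus by auto

lemma quad_eq_equivp: "equivp (quad_eq \<Lambda>)"
proof (intro equivpI reflpI sympI transpI)
  show "quad_eq \<Lambda> p p" for p by (simp add: quad_eq_def quad_ideal.zero)
  show "quad_eq \<Lambda> q p" if "quad_eq \<Lambda> p q" for p q
    using that quad_ideal_uminus[of "p - q" \<Lambda>] by (simp add: quad_eq_def)
  show "quad_eq \<Lambda> p r" if "quad_eq \<Lambda> p q" "quad_eq \<Lambda> q r" for p q r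
    using that quad_ideal.add[of "p - q" \<Lambda> "q - r"] by (simp add: quad_eq_def)
qed

lemma quad_eq_add: "quad_eq \<Lambda> p p' \<Longrightarrow> quad_eq \<Lambda> q q' \<Longrightarrow> quad_eq \<Lambda> (p + q) (p' + q')"
  using quad_ideal.add[of "p - p'" \<Lambda> "q - q'"] by (simp add: quad_eq_def algebra_simps)

lemma quad_eq_diff: "quad_eq \<Lambda> p p' \<Longrightarrow> quad_eq \<Lambda> q q' \<Longrightarrow> quad_eq \<Lambda> (p - q) (p' - q')"
  using quad_ideal_diff[of "p - p'" \<Lambda> "q - q'"] by (simp add: quad_eq_def algebra_simps)

lemma quad_eq_uminus: "quad_eq \<Lambda> p p' \<Longrightarrow> quad_eq \<Lambda> (- p) (- p')"
  using quad_ideal_uminus[of "p - p'" \<Lambda>] by (simp add: quad_eq_def algebra_simps)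

lemma quad_eq_scale: "quad_eq \<Lambda> p p' \<Longrightarrow> quad_eq \<Lambda> (pscale c p) (pscale c p')"
  using quad_ideal.scale[of "p - p'" \<Lambda> c] by (simp add: quad_eq_def pscale_simps)

lemma quad_eq_comp:
  assumes "quad_eq \<Lambda> p p'" "quad_eq \<Lambda> q q'"
  shows "quad_eq \<Lambda> (free_comp i p q) (free_comp i p' q')"
proof -
  have "free_comp i p q - free_comp i p' q'
      = free_comp i (p - p') q + free_comp i p' (q - q')"
    by (simp add: free_comp_diff_left free_comp_diff_right)
  then show ?thesis
    using assms by (simp add: quad_eq_def quad_ideal.add quad_ideal.comp_left quad_ideal.comp_right)
qed


section \<open>The operads Dend and Dias\<close>

datatype dop = Prec | Succ

lemma UNIV_dop: "UNIV = {Prec, Succ}"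
  using dop.exhaust by blast

instance dop :: finite
  by standard (simp add: UNIV_dop)

definition tensor2 :: "('x \<Rightarrow> 'k::field) \<Rightarrow> ('y \<Rightarrow> 'k) \<Rightarrow> ('x \<times> 'y \<Rightarrow> 'k)" where
  "tensor2 f g = (\<lambda>(a, b). f a * g b)"

definition dend_rel :: "(dop, 'k::field) quad_data" where
  "dend_rel =
     (let prec = (\<lambda>a. of_bool (a = Prec)); succ = (\<lambda>a. of_bool (a = Succ)); star = prec + succ
      in {(tensor2 prec prec, tensor2 prec star),
          (tensor2 succ prec, tensor2 succ prec),
          (tensor2 star succ, tensor2 succ succ)})"

text \<open>
  The following two types are the direct sums of the components of all arities of Dend and of its
  quadratic dual Dias.  In Dias the generators \<^const>\<open>Prec\<close>, \<^const>\<open>Succ\<close> stand for the dual basis of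
  the generators of Dend.
\<close>

quotient_type (overloaded) 'k dend = "dop bmon \<Rightarrow>\<^sub>0 'k::field" / "quad_eq dend_rel"
  by (rule quad_eq_equivp)

quotient_type (overloaded) 'k dias = "dop bmon \<Rightarrow>\<^sub>0 'k::field" / "quad_eq (quad_perp dend_rel)"
  by (rule quad_eq_equivp)

instantiation dend :: (field) ab_group_add
begin
lift_definition zero_dend :: "'a dend" is 0 .
lift_definition plus_dend :: "'a dend \<Rightarrow> 'a dend \<Rightarrow> 'a dend" is "(+)" by (rule quad_eq_add)
lift_definition minus_dend :: "'a dend \<Rightarrow> 'a dend \<Rightarrow> 'a dend" is "(-)" by (rule quad_eq_diff)
lift_definition uminus_dend :: "'a dend \<Rightarrow> 'a dend" is uminus by (rule quad_eq_uminus)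
instance
  by standard (transfer; simp add: quad_eq_def algebra_simps quad_ideal.zero)+
end

instantiation dias :: (field) ab_group_add
begin
lift_definition zero_dias :: "'a dias" is 0 .
lift_definition plus_dias :: "'a dias \<Rightarrow> 'a dias \<Rightarrow> 'a dias" is "(+)" by (rule quad_eq_add)
lift_definition minus_dias :: "'a dias \<Rightarrow> 'a dias \<Rightarrow> 'a dias" is "(-)" by (rule quad_eq_diff)
lift_definition uminus_dias :: "'a dias \<Rightarrow> 'a dias" is uminus by (rule quad_eq_uminus)
instance
  by standard (transfer; simp add: quad_eq_def algebra_simps quad_ideal.zero)+
end

lift_definition dend_scale :: "'k::field \<Rightarrow> 'k dend \<Rightarrow> 'k dend" is pscale by (rule quad_eq_scale)
lift_definition dias_scale :: "'k::field \<Rightarrow> 'k dias \<Rightarrow> 'k dias" is pscale by (rule quad_eq_scale)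

lift_definition dias_comp :: "nat \<Rightarrow> 'k::field dias \<Rightarrow> 'k dias \<Rightarrow> 'k dias" is free_comp
  by (rule quad_eq_comp)

definition Dend :: "nat \<Rightarrow> 'k::field dend set" where
  "Dend n = abs_dend ` free_arity n"

definition Dias :: "nat \<Rightarrow> 'k::field dias set" where
  "Dias n = abs_dias ` free_arity n"

definition dias_gen :: "dop \<Rightarrow> 'k::field dias" where
  "dias_gen a = abs_dias (Poly_Mapping.single (Op Lf a Lf) 1)"

text \<open>Linear forms on \<open>Dias l\<close>, as functions that are zero outside \<open>Dias l\<close>.\<close>

definition dias_dual :: "nat \<Rightarrow> ('k::field dias \<Rightarrow> 'k) set" where
  "dias_dual l =
     {f. (\<forall>x\<in>Dias l. \<forall>y\<in>Dias l. f (x + y) = f x + f y) \<and>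
         (\<forall>c. \<forall>x\<in>Dias l. f (dias_scale c x) = c * f x) \<and>
         (\<forall>x. x \<notin> Dias l \<longrightarrow> f x = 0)}"


section \<open>Planar rooted trees with decorated vertices\<close>

datatype 'a ptree = Leaf | Node 'a "'a ptree list"

primrec leaves :: "'a ptree \<Rightarrow> nat" where
  "leaves Leaf = 1"
| "leaves (Node a ts) = sum_list (map leaves ts)"

primrec vertices :: "'a ptree \<Rightarrow> nat" where
  "vertices Leaf = 0"
| "vertices (Node a ts) = Suc (sum_list (map vertices ts))"

text \<open>
  \<open>decorated A t\<close>: each vertex \<open>v\<close> has \<open>|v| \<ge> 2\<close> incoming edges and a decoration in \<open>A |v|\<close>.
\<close>

fun decorated :: "(nat \<Rightarrow> 'a set) \<Rightarrow> 'a ptree \<Rightarrow> bool" where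
  "decorated A Leaf \<longleftrightarrow> True"
| "decorated A (Node a ts) \<longleftrightarrow> 2 \<le> length ts \<and> a \<in> A (length ts) \<and> (\<forall>t\<in>set ts. decorated A t)"

type_synonym shape = "unit ptree"

abbreviation shape_of :: "'a ptree \<Rightarrow> shape" where
  "shape_of \<equiv> map_ptree (\<lambda>_. ())"

definition shapes :: "nat \<Rightarrow> shape set" where
  "shapes n = {T. decorated (\<lambda>_. UNIV) T \<and> leaves T = n}"

abbreviation corolla :: "nat \<Rightarrow> 'a \<Rightarrow> 'a ptree" where
  "corolla l a \<equiv> Node a (replicate l Leaf)"

primrec redecorate :: "(nat \<Rightarrow> 'a \<Rightarrow> 'b) \<Rightarrow> 'a ptree \<Rightarrow> 'b ptree" where
  "redecorate g Leaf = Leaf"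
| "redecorate g (Node a ts) = Node (g (length ts) a) (map (redecorate g) ts)"

lemma size_nth_ptree: "j < length ts \<Longrightarrow> size (ts ! j) < Suc (size_list size ts)"
  by (simp add: less_Suc_eq_le size_list_estimation'[OF nth_mem])

text \<open>
  \<open>contractions c t\<close> lists the results of contracting the internal edges of \<open>t\<close>, one entry for each
  internal edge.  If the edge is the \<open>i\<close>-th incoming edge of a vertex decorated by \<open>a\<close>, and its upper
  vertex is decorated by \<open>b\<close>, then the new vertex is decorated by \<open>c i a b\<close>.
\<close>

function contractions :: "(nat \<Rightarrow> 'a \<Rightarrow> 'a \<Rightarrow> 'a) \<Rightarrow> 'a ptree \<Rightarrow> 'a ptree list" where
  "contractions c Leaf = []"
| "contractions c (Node a ts) =
     concat (map (\<lambda>j.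
       (case ts ! j of
          Leaf \<Rightarrow> []
        | Node b us \<Rightarrow> [Node (c (Suc j) a b) (take j ts @ us @ drop (Suc j) ts)])
       @ map (\<lambda>s. Node a (ts[j := s])) (contractions c (ts ! j))) [0..<length ts])"
  by pat_completeness auto
termination
  by (relation "measure (size \<circ> snd)") (auto simp: size_nth_ptree)

abbreviation edge_contractions :: "shape \<Rightarrow> shape list" where
  "edge_contractions \<equiv> contractions (\<lambda>_ _ _. ())"

text \<open>
  The \<open>i\<close>-th labelling, with \<^const>\<open>None\<close> for \<open>*\<close>.  The first \<open>r\<close> children of a vertex contain the \<open>i\<close>-th
  leaf above this vertex for the first time when the path from the leaf enters through the \<open>r\<close>-th edge.
\<close>

function labelling :: "nat \<Rightarrow> shape \<Rightarrow> nat option ptree" where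
  "labelling i Leaf = Leaf"
| "labelling i (Node a ts) =
     (let r = (LEAST r. i \<le> sum_list (map leaves (take r ts)))
      in Node (Some r)
           (map (\<lambda>j. if Suc j = r then labelling (i - sum_list (map leaves (take j ts))) (ts ! j)
                      else map_ptree (\<lambda>_. None) (ts ! j)) [0..<length ts]))"
  by pat_completeness auto
termination
  by (relation "measure (size \<circ> snd)") (auto simp: size_nth_ptree)


section \<open>Complexes of vector spaces\<close>

text \<open>
  The components of a complex are subspaces of a vector space with scalar multiplication \<open>scl\<close>.
\<close>

record ('k, 'v) cochain =
  scl :: "'k \<Rightarrow> 'v \<Rightarrow> 'v"
  cmp :: "int \<Rightarrow> 'v set"
  dif :: "int \<Rightarrow> 'v \<Rightarrow> 'v"

definition cochain_map ::
    "('k, 'v::ab_group_add) cochain \<Rightarrow> ('k, 'w::ab_group_add) cochain \<Rightarrow> (int \<Rightarrow> 'v \<Rightarrow> 'w) \<Rightarrow> bool" where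
  "cochain_map C D \<phi> \<longleftrightarrow>
     (\<forall>j. \<forall>x\<in>cmp C j.
        \<phi> j x \<in> cmp D j \<and>
        (\<forall>y\<in>cmp C j. \<phi> j (x + y) = \<phi> j x + \<phi> j y) \<and>
        (\<forall>c. \<phi> j (scl C c x) = scl D c (\<phi> j x)) \<and>
        \<phi> (j + 1) (dif C j x) = dif D j (\<phi> j x))"

text \<open>The map is an isomorphism onto its image, which has a complementary subcomplex \<open>K\<close>.\<close>

definition onto_direct_summand ::
    "('k::field, 'v::ab_group_add) cochain \<Rightarrow> ('k, 'w::ab_group_add) cochain \<Rightarrow> (int \<Rightarrow> 'v \<Rightarrow> 'w) \<Rightarrow> bool" where
  "onto_direct_summand C D \<phi> \<longleftrightarrow>
     (\<forall>j. inj_on (\<phi> j) (cmp C j)) \<and>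
     (\<exists>K. (\<forall>j. module.subspace (scl D) (K j) \<and> K j \<subseteq> cmp D j \<and> dif D j ` K j \<subseteq> K (j + 1)) \<and>
          (\<forall>j. cmp D j = {x + y | x y. x \<in> \<phi> j ` cmp C j \<and> y \<in> K j}) \<and>
          (\<forall>j. \<phi> j ` cmp C j \<inter> K j = {0}))"

definition fscale :: "'k::field \<Rightarrow> ('b \<Rightarrow> 'k) \<Rightarrow> ('b \<Rightarrow> 'k)" where
  "fscale c f = (\<lambda>x. c * f x)"

global_interpretation fvs: vector_space "fscale :: 'k::field \<Rightarrow> ('b \<Rightarrow> 'k) \<Rightarrow> ('b \<Rightarrow> 'k)"
  by standard (auto simp: fscale_def fun_eq_iff algebra_simps)

definition unit_fun :: "'b \<Rightarrow> 'b \<Rightarrow> 'k::field" where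
  "unit_fun b = (\<lambda>x. of_bool (x = b))"


section \<open>Cellular chains of the associahedra\<close>

text \<open>
  \<open>oriented_edge T T\<^sub>0 T\<^sub>1\<close>: the tree \<open>T\<close> is obtained by contraction both from \<open>T\<^sub>0\<close>, containing the
  local shape \<open>(x y) z\<close>, and from \<open>T\<^sub>1\<close>, containing instead \<open>x (y z)\<close>.
\<close>

inductive oriented_edge :: "shape \<Rightarrow> shape \<Rightarrow> shape \<Rightarrow> bool" where
  "oriented_edge (Node () [x, y, z])
     (Node () [Node () [x, y], z]) (Node () [x, Node () [y, z]])"
| "oriented_edge t t\<^sub>0 t\<^sub>1 \<Longrightarrow>
   oriented_edge (Node () (us @ t # vs)) (Node () (us @ t\<^sub>0 # vs)) (Node () (us @ t\<^sub>1 # vs))"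

definition binary_shapes :: "nat \<Rightarrow> shape set" where
  "binary_shapes n = {T \<in> shapes n. vertices T = n - 1}"

text \<open>
  The incidence numbers of the cells of the associahedra of all dimensions, for any choice of
  orientations as required: incident cells of consecutive dimensions have incidence number \<open>\<plusminus>1\<close>, the
  boundary of a boundary is zero, and the boundary of a \<open>1\<close>-cell is its end minus its start.  (On
  \<open>1\<close>-cells, the last condition implies that the augmentation of a boundary is zero.)
\<close>

definition incidence_numbers :: "(shape \<Rightarrow> shape \<Rightarrow> int) \<Rightarrow> bool" where
  "incidence_numbers \<epsilon> \<longleftrightarrow>
     (\<forall>n. \<forall>T\<in>shapes n. \<forall>T'\<in>shapes n.
        (if T \<in> set (edge_contractions T') then \<epsilon> T T' \<in> {1, -1} else \<epsilon> T T' = 0)) \<and>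
     (\<forall>n. \<forall>T\<in>shapes n. \<forall>T''\<in>shapes n. (\<Sum>T'\<in>shapes n. \<epsilon> T T' * \<epsilon> T' T'') = 0) \<and>
     (\<forall>n. \<forall>T\<in>shapes n. \<forall>T\<^sub>0\<in>binary_shapes n. \<forall>T\<^sub>1\<in>binary_shapes n.
        oriented_edge T T\<^sub>0 T\<^sub>1 \<longrightarrow> \<epsilon> T T\<^sub>0 = -1 \<and> \<epsilon> T T\<^sub>1 = 1)"

datatype cell = Cell shape | Empty_Cell

definition CA_basis :: "nat \<Rightarrow> int \<Rightarrow> cell set" where
  "CA_basis n j =
     {Cell T | T. T \<in> shapes n \<and> int (vertices T) = int n + j - 1} \<union> (if j = 1 then {Empty_Cell} else {})"

text \<open>Chains are given by their coefficients.\<close>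

definition CA_cmp :: "nat \<Rightarrow> int \<Rightarrow> (cell \<Rightarrow> 'k::field) set" where
  "CA_cmp n j = {F. \<forall>b. b \<notin> CA_basis n j \<longrightarrow> F b = 0}"

definition CA_dif :: "(shape \<Rightarrow> shape \<Rightarrow> int) \<Rightarrow> nat \<Rightarrow> (cell \<Rightarrow> 'k::field) \<Rightarrow> (cell \<Rightarrow> 'k)" where
  "CA_dif \<epsilon> n F b =
     (case b of
        Cell T' \<Rightarrow> if T' \<in> shapes n then (\<Sum>T\<in>shapes n. of_int (\<epsilon> T T') * F (Cell T)) else 0
      | Empty_Cell \<Rightarrow> (\<Sum>T\<in>binary_shapes n. F (Cell T)))"

text \<open>
  The direct sum of \<open>n\<close> copies.  The pair \<open>(i, Cell T)\<close> is the tree \<open>T\<close> with its \<open>i\<close>-th labelling, which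
  \<open>i\<close> and \<open>T\<close> determine.
\<close>

definition DA_cmp :: "nat \<Rightarrow> int \<Rightarrow> (nat \<times> cell \<Rightarrow> 'k::field) set" where
  "DA_cmp n j = {F. (\<forall>i\<in>{1..n}. (\<lambda>b. F (i, b)) \<in> CA_cmp n j) \<and> (\<forall>i b. i \<notin> {1..n} \<longrightarrow> F (i, b) = 0)}"

definition DA :: "(shape \<Rightarrow> shape \<Rightarrow> int) \<Rightarrow> nat \<Rightarrow> ('k::field, nat \<times> cell \<Rightarrow> 'k) cochain" where
  "DA \<epsilon> n = \<lparr>scl = fscale, cmp = DA_cmp n,
              dif = (\<lambda>j F (i, b). CA_dif \<epsilon> n (\<lambda>b'. F (i, b')) b)\<rparr>"

definition DA_basis :: "nat \<Rightarrow> int \<Rightarrow> (nat \<times> cell) set" where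
  "DA_basis n j = {1..n} \<times> CA_basis n j"


section \<open>The dual bar complex\<close>

text \<open>
  An element of \<open>\<Oplus>\<^sub>T \<Otimes>\<^sub>v Dias(|v|)\<^sup>\<or>\<close> is regarded as a function on trees decorated by elements of Dias:
  its component at \<open>T\<close> is a multilinear form on \<open>\<Prod>\<^sub>v Dias(|v|)\<close>.  A tree decorated by linear forms
  gives a pure tensor.
\<close>

function pure_tensor :: "('d \<Rightarrow> 'k::field) ptree \<Rightarrow> 'd ptree \<Rightarrow> 'k" where
  "pure_tensor Leaf X = of_bool (X = Leaf)"
| "pure_tensor (Node f ts) X =
     (case X of
        Leaf \<Rightarrow> 0
      | Node x xs \<Rightarrow>
          if length xs = length ts then f x * (\<Prod>j<length ts. pure_tensor (ts ! j) (xs ! j)) else 0)"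
  by pat_completeness auto
termination
  by (relation "measure (size \<circ> fst)") (auto simp: size_nth_ptree)

type_synonym 'k bar = "'k dias ptree \<Rightarrow> 'k"

definition bar_cmp :: "nat \<Rightarrow> int \<Rightarrow> 'k::field bar set" where
  "bar_cmp n j = fvs.span {pure_tensor P | P.
     decorated dias_dual P \<and> leaves P = n \<and> int (vertices P) = int n + j - 1}"

text \<open>
  Distinct internal edges of a tree have distinct contractions, so that for each pair of trees there
  is at most one summand.
\<close>

definition bar_dif :: "(shape \<Rightarrow> shape \<Rightarrow> int) \<Rightarrow> 'k::field bar \<Rightarrow> 'k bar" where
  "bar_dif \<epsilon> F X =
     (if decorated Dias X
      then \<Sum>Y\<leftarrow>contractions dias_comp X. of_int (\<epsilon> (shape_of Y) (shape_of X)) * F Y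
      else 0)"

text \<open>
  In degree zero, \<open>\<Oplus>\<^sub>T \<Otimes>\<^sub>v Dias(2)\<^sup>\<or>\<close> is the arity \<open>n\<close> component of the free operad on \<open>Dias(2)\<^sup>\<or> = \<Omega>\<close>:
  the coefficient of a monomial is the value at the same tree decorated by dual generators.
\<close>

primrec gen_tree :: "dop bmon \<Rightarrow> 'k::field dias ptree" where
  "gen_tree Lf = Leaf"
| "gen_tree (Op s a t) = Node (dias_gen a) [gen_tree s, gen_tree t]"

definition bar_to_dend :: "nat \<Rightarrow> 'k::field bar \<Rightarrow> 'k dend" where
  "bar_to_dend n F =
     abs_dend (\<Sum>m | arity m = n. Poly_Mapping.single m (F (gen_tree m)))"

definition aug_bar :: "(shape \<Rightarrow> shape \<Rightarrow> int) \<Rightarrow> nat \<Rightarrow> ('k::field, 'k bar \<times> 'k dend) cochain" where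
  "aug_bar \<epsilon> n =
     \<lparr>scl = (\<lambda>c (F, x). (fscale c F, dend_scale c x)),
      cmp = (\<lambda>j. if j \<le> 0 then bar_cmp n j \<times> {0} else if j = 1 then {0} \<times> Dend n else {0}),
      dif = (\<lambda>j (F, x). if j < 0 then (bar_dif \<epsilon> F, 0) else if j = 0 then (0, bar_to_dend n F) else 0)\<rparr>"

text \<open>\<open>g l r\<close> is the linear form denoted by the label \<open>r\<close> at a vertex with \<open>l\<close> incoming edges.\<close>

definition interpret_label :: "(nat \<Rightarrow> nat \<Rightarrow> 'k::field dias \<Rightarrow> 'k) \<Rightarrow> nat \<Rightarrow> nat option \<Rightarrow> 'k dias \<Rightarrow> 'k" where
  "interpret_label g l s = (case s of None \<Rightarrow> \<Sum>r=1..l. g l r | Some r \<Rightarrow> g l r)"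

text \<open>
  The vertices of a tree with \<open>l\<close> leaves and two vertices have fewer than \<open>l\<close> incoming edges, so the
  test \<open>w < l\<close> only serves to make the recursion well-founded.
\<close>

function label :: "(shape \<Rightarrow> shape \<Rightarrow> int) \<Rightarrow> nat \<Rightarrow> nat \<Rightarrow> 'k::field dias \<Rightarrow> 'k" where
  "label \<epsilon> l i =
     (if l = 2
      then THE f. f \<in> dias_dual 2 \<and>
             (\<forall>a. f (dias_gen a) = of_bool (a = (if i = 1 then Prec else Succ)))
      else THE f. f \<in> dias_dual l \<and>
             bar_dif \<epsilon> (pure_tensor (corolla l f)) =
             (\<Sum>T' \<in> {T' \<in> shapes l. vertices T' = 2}.
                fscale (of_int (\<epsilon> (corolla l ()) T'))
                  (pure_tensor (redecorate
                     (interpret_label (\<lambda>w r. if w < l then label \<epsilon> w r else 0)) (labelling i T')))))"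
  by pat_completeness auto
termination
  by (relation "measure (\<lambda>(\<epsilon>, l, i). l)") auto

declare label.simps [simp del]

definition labelled_trees :: "nat \<Rightarrow> nat ptree set" where
  "labelled_trees n = {L. decorated (\<lambda>l. {1..l}) L \<and> leaves L = n}"

definition bar_basis_elem :: "(shape \<Rightarrow> shape \<Rightarrow> int) \<Rightarrow> nat ptree \<Rightarrow> 'k::field bar" where
  "bar_basis_elem \<epsilon> L = pure_tensor (redecorate (label \<epsilon>) L)"

text \<open>
  The coefficient of the labelled tree \<open>L\<close> in an element of the augmented complex; it is zero on the
  component Dend in degree one.
\<close>

definition bar_coeff ::
    "(shape \<Rightarrow> shape \<Rightarrow> int) \<Rightarrow> nat \<Rightarrow> nat ptree \<Rightarrow> 'k::field bar \<times> 'k dend \<Rightarrow> 'k" where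
  "bar_coeff \<epsilon> n L y =
     fvs.representation (bar_basis_elem \<epsilon> ` labelled_trees n) (fst y) (bar_basis_elem \<epsilon> L)"

end

theory Submission
  imports Defs
begin

text \<open>
  The space \<open>Dias(l)\<close> has a basis \<open>e\<^sub>1, \<dots>, e\<^sub>l\<close>: every product has one distinguished factor, and \<open>e\<^sub>i\<close> is
  the class of each monomial of arity \<open>l\<close> in which following the distinguished factors leads to the
  \<open>i\<close>-th argument.  Partial compositions of basis elements are basis elements, given on indices by
  \<open>pcomp\<close>.  The label \<open>i\<close> at a vertex is the dual basis element \<open>e\<^sub>i\<^sup>*\<close>
  (\<open>label_eq_dias_form\<close>).  Hence the coefficient of a labelled tree \<open>B\<close> in an element \<open>F\<close> of the bar
  complex is the value of the multilinear form \<open>F\<close> at the tree whose vertices are decorated by the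
  corresponding \<open>e\<^sub>i\<close>.  In these coordinates the coefficient of \<open>B\<close> in the differential of \<open>F\<close> is the
  sum of \<open>\<plusminus>F(B')\<close> over the contractions \<open>B'\<close> of \<open>B\<close>, in which the labels compose by \<open>pcomp\<close>
  (\<open>bar_dif_tree_basis\<close>).

  From the root of a labelled tree one can walk up along the edges chosen by the labels; let the tip be
  the leaf where this walk ends.  It is the index of the composite in Dias of all labels, so contractions
  preserve it.  The map \<open>\<phi>\<close> sends the \<open>i\<close>-th copy of the cell \<open>T\<close> to the sum of all labelled trees with
  shape \<open>T\<close> and tip \<open>i\<close>.  This sum is the \<open>i\<close>-th labelling of \<open>T\<close> with \<open>*\<close> read as the sum of all
  labels (\<open>labelling_tree_basis\<close>).  A labelled tree has one shape and one tip, so it occurs in exactly one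
  of these sums, and invariance of the tip gives compatibility with the differentials (\<open>da_map_cochain\<close>).
  In degree one, the dendriform relations show that the sum of the labellings with tip \<open>i\<close> of a binary
  tree has the same class in Dend for all binary trees with \<open>n\<close> leaves (\<open>path_labellings_eq\<close>); this
  class is the image of the empty cell of the \<open>i\<close>-th copy.

  For the complement, call a labelled tree special if every vertex off the path to its tip has the label
  \<open>1\<close>.  For each shape and each tip there is exactly one special tree (\<open>special_exists\<close>,
  \<open>special_unique\<close>), and contractions of special trees are special (\<open>tip_special_contraction\<close>).  So the
  elements in which all special trees have coefficient zero form a subcomplex complementary to the image
  in degrees at most zero.  Behind this is the morphism from the associative operad to Dias whose image
  is \<open>e\<^sub>1\<close> in each arity; its dual splits, at the vertices off the path, the inclusion of the sum of
  all labels.  The splitting extends to degree one because the functional adding up the coefficients of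
  the special monomials with tip \<open>i\<close> vanishes on the dendriform ideal (\<open>dend_class_ideal\<close>).
\<close>

section \<open>Trees and contractions\<close>

lemma leaves_map_ptree [simp]: "leaves (map_ptree g t) = leaves t"
  by (induction t) (auto simp: o_def intro!: arg_cong[of _ _ sum_list])

lemma vertices_map_ptree [simp]: "vertices (map_ptree g t) = vertices t"
  by (induction t) (auto simp: o_def intro!: arg_cong[of _ _ sum_list])

lemma map_ptree_eq_Leaf [simp]: "map_ptree g t = Leaf \<longleftrightarrow> t = Leaf"
  by (cases t) auto

lemma decorated_map_ptree:
  assumes "decorated A t" "\<And>l a. 2 \<le> l \<Longrightarrow> a \<in> A l \<Longrightarrow> g a \<in> A' l"
  shows "decorated A' (map_ptree g t)"
  using assms(1) by (induction t) (auto simp: assms(2))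

lemma decorated_shape:
  "decorated A t \<Longrightarrow> decorated (\<lambda>_. UNIV) (shape_of t)"
  by (rule decorated_map_ptree) auto

lemma sum_vertices_add_length:
  "(\<And>t. t \<in> set ts \<Longrightarrow> Suc (vertices t) \<le> leaves t) \<Longrightarrow>
   (\<Sum>t\<leftarrow>ts. vertices t) + length ts \<le> (\<Sum>t\<leftarrow>ts. leaves t)"
  by (induction ts) fastforce+

lemma vertices_less_leaves:
  "decorated A t \<Longrightarrow> Suc (vertices t) \<le> leaves t"
proof (induction t)
  case (Node a ts)
  then show ?case using sum_vertices_add_length[of ts] by auto
qed auto

lemma leaves_pos: "decorated A t \<Longrightarrow> 1 \<le> leaves t"
  using vertices_less_leaves by fastforce

lemma sum_list_ge_length:
  "(\<And>x. x \<in> set xs \<Longrightarrow> 1 \<le> f x) \<Longrightarrow> length xs \<le> (\<Sum>x\<leftarrow>xs. f x :: nat)"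
  by (induction xs) fastforce+

lemma member_less_sum_list:
  assumes "\<And>x. x \<in> set xs \<Longrightarrow> 1 \<le> f x" "2 \<le> length xs" "x \<in> set xs"
  shows "f x < (\<Sum>x\<leftarrow>xs. f x :: nat)"
proof -
  obtain ys zs where xs: "xs = ys @ x # zs" using assms(3) by (auto dest: split_list)
  have "length ys \<le> (\<Sum>x\<leftarrow>ys. f x)" "length zs \<le> (\<Sum>x\<leftarrow>zs. f x)"
    using assms(1) xs by (auto intro!: sum_list_ge_length)
  then show ?thesis using assms(2) xs by auto
qed

lemma child_leaves_less:
  assumes "decorated A (Node a ts)" "t \<in> set ts"
  shows "leaves t < leaves (Node a ts)"
  using assms member_less_sum_list[of ts leaves t] leaves_pos by auto

lemma finite_decorated:
  assumes "\<And>l. finite (A l)"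
  shows "finite {t. decorated A t \<and> leaves t = n}"
proof (induction n rule: less_induct)
  case (less n)
  let ?C = "\<Union>m<n. {t. decorated A t \<and> leaves t = m}"
  let ?R = "\<lambda>l. (\<lambda>(a, ts). Node a ts) ` (A l \<times> {ts. set ts \<subseteq> ?C \<and> length ts = l})"
  have fin: "finite ?C" using less by auto
  have "{t. decorated A t \<and> leaves t = n} \<subseteq> insert Leaf (\<Union>l\<le>n. ?R l)"
  proof
    fix t assume t: "t \<in> {t. decorated A t \<and> leaves t = n}"
    show "t \<in> insert Leaf (\<Union>l\<le>n. ?R l)"
    proof (cases t)
      case (Node a ts)
      have "length ts \<le> n"
        using t Node sum_list_ge_length[of ts leaves] leaves_pos[of A] by auto
      moreover have "set ts \<subseteq> ?C"
        using t Node child_leaves_less[of A a ts] by auto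
      ultimately have "t \<in> ?R (length ts)" using t Node by auto
      then show ?thesis using \<open>length ts \<le> n\<close> by blast
    qed simp
  qed
  moreover have "finite (insert Leaf (\<Union>l\<le>n. ?R l))"
    using fin assms by (auto intro!: finite_lists_length_eq)
  ultimately show ?case by (rule finite_subset)
qed

lemma finite_shapes [simp]: "finite (shapes n)"
  unfolding shapes_def by (rule finite_decorated) simp

text \<open>
  Positions in the list of children are replaced by decompositions of this list, which are easier to
  compare when two edges, or an edge and a path, meet at the same vertex.
\<close>

lemma in_contractions_Node:
  "Y \<in> set (contractions c (Node a ts)) \<longleftrightarrow>
     (\<exists>us b vs ws. ts = us @ Node b vs # ws \<and> Y = Node (c (Suc (length us)) a b) (us @ vs @ ws)) \<or>
     (\<exists>us t ws s. ts = us @ t # ws \<and> s \<in> set (contractions c t) \<and> Y = Node a (us @ s # ws))"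
  (is "?L \<longleftrightarrow> ?R1 \<or> ?R2")
proof
  assume ?L
  then obtain j where j: "j < length ts" and
    *: "Y \<in> set ((case ts ! j of
          Leaf \<Rightarrow> []
        | Node b us \<Rightarrow> [Node (c (Suc j) a b) (take j ts @ us @ drop (Suc j) ts)])
       @ map (\<lambda>s. Node a (ts[j := s])) (contractions c (ts ! j)))"
    by (simp only: contractions.simps set_concat set_map set_upt image_image UN_iff Bex_def
        atLeastLessThan_iff) blast
  have ts: "ts = take j ts @ ts ! j # drop (Suc j) ts" and len: "length (take j ts) = j"
    using j by (auto simp: id_take_nth_drop)
  from * consider b vs where "ts ! j = Node b vs"
        "Y = Node (c (Suc j) a b) (take j ts @ vs @ drop (Suc j) ts)"
    | s where "s \<in> set (contractions c (ts ! j))" "Y = Node a (ts[j := s])"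
    by (cases "ts ! j"; simp del: contractions.simps) blast+
  then show "?R1 \<or> ?R2"
  proof cases
    case 1 then show ?thesis using ts len by metis
  next
    case 2 then show ?thesis using ts upd_conv_take_nth_drop[OF j] by metis
  qed
next
  assume "?R1 \<or> ?R2"
  then show ?L
  proof
    assume ?R1
    then obtain us b vs ws where "ts = us @ Node b vs # ws"
      "Y = Node (c (Suc (length us)) a b) (us @ vs @ ws)" by blast
    then show ?L by (auto intro!: bexI[of _ "length us"])
  next
    assume ?R2
    then obtain us t ws s where "ts = us @ t # ws" "s \<in> set (contractions c t)" "Y = Node a (us @ s # ws)"
      by blast
    then show ?L by (auto intro!: bexI[of _ "length us"])
  qed
qed

declare contractions.simps(2) [simp del]

lemma contractions_leaves: "Y \<in> set (contractions c X) \<Longrightarrow> leaves Y = leaves X"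
proof (induction X arbitrary: Y)
  case (Node a ts)
  then show ?case by (fastforce simp: in_contractions_Node)
qed auto

lemma contractions_vertices: "Y \<in> set (contractions c X) \<Longrightarrow> Suc (vertices Y) = vertices X"
proof (induction X arbitrary: Y)
  case (Node a ts)
  then show ?case by (fastforce simp: in_contractions_Node)
qed auto

lemma length_contractions: "length (contractions c X) = vertices X - 1"
proof (induction X)
  case (Node a ts)
  have "length (contractions c (Node a ts)) = (\<Sum>j<length ts. vertices (ts ! j))"
    unfolding contractions.simps length_concat map_map interv_sum_list_conv_sum_set_nat set_upt
      lessThan_atLeast0
    using Node by (intro sum.cong) (auto split: ptree.splits)
  also have "\<dots> = sum_list (map vertices ts)"
    by (simp add: sum_list_sum_nth lessThan_atLeast0)
  finally show ?case by simp
qed auto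

text \<open>
  The family \<open>A\<close> stands for the components of an operad, with \<open>c\<close> as partial composition.  The next
  lemma applies in the same way to a morphism \<open>g\<close> of such families.
\<close>

lemma contractions_decorated:
  assumes "decorated A X" "Y \<in> set (contractions c X)"
    and "\<And>i m q a b. \<lbrakk>2 \<le> m; 2 \<le> q; a \<in> A m; b \<in> A q; 1 \<le> i; i \<le> m\<rbrakk> \<Longrightarrow> c i a b \<in> A (m + q - 1)"
  shows "decorated A Y"
  using assms(1,2)
proof (induction X arbitrary: Y)
  case (Node a ts)
  from Node.prems(2) consider us b vs ws where "ts = us @ Node b vs # ws"
      "Y = Node (c (Suc (length us)) a b) (us @ vs @ ws)"
    | us t ws s where "ts = us @ t # ws" "s \<in> set (contractions c t)" "Y = Node a (us @ s # ws)"
    unfolding in_contractions_Node by blast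
  then show ?case
  proof cases
    case 1
    then show ?thesis
      using Node.prems(1) assms(3)[of "length ts" "length vs" a b "Suc (length us)"] 
      by (auto simp: add_ac)
  next
    case 2
    then show ?thesis using Node.IH[of t s] Node.prems(1) by auto
  qed
qed auto

lemma contractions_map_ptree:
  assumes "decorated A X"
    and "\<And>i m q a b. \<lbrakk>2 \<le> m; 2 \<le> q; a \<in> A m; b \<in> A q; 1 \<le> i; i \<le> m\<rbrakk> \<Longrightarrow> g (c i a b) = c' i (g a) (g b)"
  shows "contractions c' (map_ptree g X) = map (map_ptree g) (contractions c X)"
  using assms(1)
proof (induction X)
  case (Node a ts)
  have eq: "(case map (map_ptree g) ts ! j of
          Leaf \<Rightarrow> []
        | Node b us \<Rightarrow> [Node (c' (Suc j) (g a) b) (take j (map (map_ptree g) ts) @ us @ drop (Suc j) (map (map_ptree g) ts))])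
       @ map (\<lambda>s. Node (g a) ((map (map_ptree g) ts)[j := s])) (contractions c' (map (map_ptree g) ts ! j))
     = map (map_ptree g) ((case ts ! j of
          Leaf \<Rightarrow> []
        | Node b us \<Rightarrow> [Node (c (Suc j) a b) (take j ts @ us @ drop (Suc j) ts)])
       @ map (\<lambda>s. Node a (ts[j := s])) (contractions c (ts ! j)))" if j: "j < length ts" for j
  proof -
    have d: "decorated A (ts ! j)" using Node.prems j by auto
    have "contractions c' (map_ptree g (ts ! j)) = map (map_ptree g) (contractions c (ts ! j))"
      using Node.IH[of "ts ! j"] d j by auto
    moreover have "g (c (Suc j) a b) = c' (Suc j) (g a) (g b)" if "ts ! j = Node b us" for b us
      using assms(2)[of "length ts" "length us" a b "Suc j"] Node.prems d that j by auto
    ultimately show ?thesis using j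
      by (auto simp: take_map drop_map map_update split: ptree.splits)
  qed
  show ?case
    unfolding ptree.map contractions.simps length_map map_concat map_map
    by (rule arg_cong[of _ _ concat], rule map_cong) (use eq in auto)
qed auto

lemma contractions_shape:
  "decorated A X \<Longrightarrow> map shape_of (contractions c X) = edge_contractions (shape_of X)"
  by (rule contractions_map_ptree[symmetric]) auto

lemma edge_contractions_in_shapes:
  "T \<in> shapes n \<Longrightarrow> T' \<in> set (edge_contractions T) \<Longrightarrow> T' \<in> shapes n"
  unfolding shapes_def using contractions_decorated[of "\<lambda>_. UNIV" T T'] contractions_leaves[of T' _ T] 
  by auto

lemma distinct_concat_upt:
  assumes "\<And>i. i < n \<Longrightarrow> distinct (f i)"
    and "\<And>i j. i < j \<Longrightarrow> j < n \<Longrightarrow> set (f i) \<inter> set (f j) = {}"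
  shows "distinct (concat (map f [0..<n]))"
  using assms by (induction n) (auto, blast)

text \<open>
  Contracting an edge at the root increases the arity of the root, which distinguishes it from the
  other contractions.  For two root edges, at the smaller position one contraction shows the first
  grandchild and the other one the whole child, which has more leaves.  Two inner edges above different
  children change different children, because a contraction loses a vertex.
\<close>

lemma distinct_edge_contractions:
  "decorated (\<lambda>_. UNIV) T \<Longrightarrow> distinct (edge_contractions T)"
proof (induction T)
  case (Node a ts)
  have dec: "decorated (\<lambda>_. UNIV) (ts ! j)" if "j < length ts" for j using Node.prems that by auto
  define r where "r j = (case ts ! j of Leaf \<Rightarrow> []
        | Node b us \<Rightarrow> [Node () (take j ts @ us @ drop (Suc j) ts)])" for j
  define q where "q j = map (\<lambda>s. Node () (ts[j := s])) (edge_contractions (ts ! j))" for j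
  have neq: "s \<noteq> ts ! j" if "s \<in> set (edge_contractions (ts ! j))" for s j
    using contractions_vertices[OF that] by auto
  have rq: "set (r i) \<inter> set (q j) = {}" if "i < length ts" "j < length ts" for i j
    using dec[OF that(1)] that
    by (cases "ts ! i") (auto simp: r_def q_def dest!: arg_cong[of "_ @ _" _ length])
  have rr: "set (r i) \<inter> set (r j) = {}" if "i < j" "j < length ts" for i j
  proof (rule ccontr)
    assume "set (r i) \<inter> set (r j) \<noteq> {}"
    then obtain us vs where u: "ts ! i = Node () us" "ts ! j = Node () vs"
      and eq: "take i ts @ us @ drop (Suc i) ts = take j ts @ vs @ drop (Suc j) ts"
      by (cases "ts ! i"; cases "ts ! j") (auto simp: r_def)
    have "us \<noteq> []" using dec[of i] u that by auto
    have "(take i ts @ us @ drop (Suc i) ts) ! i = us ! 0"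
      using that \<open>us \<noteq> []\<close> by (auto simp: nth_append)
    moreover have "(take j ts @ vs @ drop (Suc j) ts) ! i = Node () us"
      using that u by (auto simp: nth_append)
    ultimately have "Node () us \<in> set us" using eq \<open>us \<noteq> []\<close> by (metis length_greater_0_conv nth_mem)
    then have "leaves (Node () us) < leaves (Node () us)"
      using child_leaves_less[of "\<lambda>_. UNIV" "()" us "Node () us"] dec[of i] u that by auto
    then show False by simp
  qed
  have qq: "set (q i) \<inter> set (q j) = {}" if "i < j" "j < length ts" for i j
  proof (rule ccontr)
    assume "set (q i) \<inter> set (q j) \<noteq> {}"
    then obtain s s' where "s \<in> set (edge_contractions (ts ! i))" and "ts[i := s] = ts[j := s']"
      by (auto simp: q_def)
    then have "s = ts ! i"
      using that by (metis less_irrefl less_trans nth_list_update_eq nth_list_update_neq)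
    then show False using neq \<open>s \<in> set (edge_contractions (ts ! i))\<close> by auto
  qed
  have "distinct (concat (map (\<lambda>j. r j @ q j) [0..<length ts]))"
  proof (rule distinct_concat_upt)
    fix j assume j: "j < length ts"
    have "distinct (edge_contractions (ts ! j))" using Node.IH[of "ts ! j"] dec j by auto
    moreover have "inj_on (\<lambda>s. Node () (ts[j := s])) X" for X
      using j by (auto intro!: inj_onI dest: arg_cong[of "list_update _ _ _" _ "\<lambda>xs. xs ! j"])
    ultimately have "distinct (q j)" by (auto simp: q_def distinct_map)
    moreover have "distinct (r j)" by (auto simp: r_def split: ptree.splits)
    ultimately show "distinct (r j @ q j)" using rq[OF j j] by auto
  next
    fix i j assume "i < j" "j < length ts"
    then show "set (r i @ q i) \<inter> set (r j @ q j) = {}"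
      using rq[of i j] rq[of j i] rr[of i j] qq[of i j] by auto
  qed
  then show ?case by (simp add: contractions.simps(2) r_def q_def)
qed auto

text \<open>
  The differential of the associahedron sums over all trees, that of the bar complex over the list of
  contractions; absence of repetitions in this list makes the two agree.
\<close>

lemma incidence_sum:
  fixes g :: "shape \<Rightarrow> 'k::field"
  assumes "incidence_numbers \<epsilon>" "T' \<in> shapes n"
  shows "(\<Sum>T\<in>shapes n. of_int (\<epsilon> T T') * g T) = (\<Sum>T\<leftarrow>edge_contractions T'. of_int (\<epsilon> T T') * g T)"
proof -
  have "(\<Sum>T\<leftarrow>edge_contractions T'. of_int (\<epsilon> T T') * g T)
      = (\<Sum>T\<in>set (edge_contractions T'). of_int (\<epsilon> T T') * g T)"
    using assms by (intro sum_list_distinct_conv_sum_set distinct_edge_contractions) (auto simp: shapes_def)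
  also have "\<dots> = (\<Sum>T\<in>shapes n. of_int (\<epsilon> T T') * g T)"
    using assms edge_contractions_in_shapes[OF assms(2)]
    by (intro sum.mono_neutral_left) (auto simp: incidence_numbers_def)
  finally show ?thesis by simp
qed

lemma incidence_contraction:
  assumes "incidence_numbers \<epsilon>" "T' \<in> shapes n" "T \<in> set (edge_contractions T')"
  shows "\<epsilon> T T' \<in> {1, -1}"
proof -
  have "T \<in> shapes n" using edge_contractions_in_shapes[OF assms(2,3)] .
  moreover have "\<forall>n. \<forall>T\<in>shapes n. \<forall>T'\<in>shapes n.
        (if T \<in> set (edge_contractions T') then \<epsilon> T T' \<in> {1, -1} else \<epsilon> T T' = 0)"
    using assms(1) unfolding incidence_numbers_def by (rule conjunct1)
  ultimately show ?thesis using assms(2,3) by fastforce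
qed

section \<open>Pointed trees\<close>

text \<open>
  A label is stored together with the arity of its vertex, as the pair \<open>(l, i)\<close> naming the basis element
  \<open>e\<^sub>i\<close> of \<open>Dias(l)\<close>: the composition of two labels depends on both arities, whereas
  \<^const>\<open>contractions\<close> passes only the decorations to its first argument.
\<close>

definition positions :: "nat \<Rightarrow> (nat \<times> nat) set" where
  "positions l = {l} \<times> {1..l}"

definition pointed_trees :: "nat \<Rightarrow> (nat \<times> nat) ptree set" where
  "pointed_trees n = {B. decorated positions B \<and> leaves B = n}"

text \<open>
  The composition of basis elements of Dias.  Inserting into the distinguished argument \<open>a\<close> moves the
  mark inside the inserted element; inserting before it shifts the mark.
\<close>

fun pcomp :: "nat \<Rightarrow> nat \<times> nat \<Rightarrow> nat \<times> nat \<Rightarrow> nat \<times> nat" where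
  "pcomp i (m, a) (q, b) = (m + q - 1, if i = a then a + b - 1 else if i < a then a + q - 1 else a)"

text \<open>
  The number of the leaf at the end of the walk from the root along the labels.  Labels count from \<open>1\<close>,
  list positions from \<open>0\<close>.
\<close>

primrec tip :: "(nat \<times> nat) ptree \<Rightarrow> nat" where
  "tip Leaf = 1"
| "tip (Node d ts) = sum_list (map leaves (take (snd d - 1) ts)) + map tip ts ! (snd d - 1)"

definition first_pointed :: "(nat \<times> nat) ptree \<Rightarrow> bool" where
  "first_pointed t \<longleftrightarrow> (\<forall>d\<in>set_ptree t. snd d = 1)"

primrec special :: "(nat \<times> nat) ptree \<Rightarrow> bool" where
  "special Leaf = True"
| "special (Node d ts) \<longleftrightarrow> map special ts ! (snd d - 1) \<and>
     (\<forall>k<length ts. k \<noteq> snd d - 1 \<longrightarrow> first_pointed (ts ! k))"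

lemma first_pointed_simps [simp]:
  "first_pointed Leaf" "first_pointed (Node d ts) \<longleftrightarrow> snd d = 1 \<and> (\<forall>t\<in>set ts. first_pointed t)"
  by (auto simp: first_pointed_def)

lemma finite_pointed_trees [simp]: "finite (pointed_trees n)"
  unfolding pointed_trees_def by (rule finite_decorated) (simp add: positions_def)

lemma shape_pointed_trees: "B \<in> pointed_trees n \<Longrightarrow> shape_of B \<in> shapes n"
  unfolding pointed_trees_def shapes_def using decorated_shape by auto

lemma positions_pcomp:
  "\<lbrakk>2 \<le> m; 2 \<le> q; a \<in> positions m; b \<in> positions q; 1 \<le> i; i \<le> m\<rbrakk> \<Longrightarrow> pcomp i a b \<in> positions (m + q - 1)"
  by (cases a; cases b) (auto simp: positions_def)

lemma contractions_pointed:
  "B \<in> pointed_trees n \<Longrightarrow> B' \<in> set (contractions pcomp B) \<Longrightarrow> B' \<in> pointed_trees n"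
  unfolding pointed_trees_def
  using contractions_decorated[of positions B B' pcomp] positions_pcomp contractions_leaves[of B' pcomp B]
  by auto

text \<open>
  The list of children is split at the child chosen by the label of the root.
\<close>

lemma pointed_NodeE:
  assumes "decorated positions (Node d ts)"
  obtains us t ws where "ts = us @ t # ws" "d = (Suc (length us + length ws), Suc (length us))"
    "decorated positions t" "\<forall>u\<in>set us \<union> set ws. decorated positions u" "us @ ws \<noteq> []"
proof -
  obtain r where d: "d = (length ts, Suc r)" "r < length ts"
    using assms by (cases d; cases "snd d") (auto simp: positions_def)
  define us t ws where "us = take r ts" "t = ts ! r" "ws = drop (Suc r) ts"
  then have ts: "ts = us @ t # ws" "length us = r" using d by (auto simp: id_take_nth_drop)
  show thesis
  proof (rule that[OF ts(1)])
    show "us @ ws \<noteq> []" using assms ts by auto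
  qed (use assms ts d in auto)
qed

lemma tip_Node_split [simp]:
  "tip (Node (l, Suc (length us)) (us @ t # ws)) = sum_list (map leaves us) + tip t"
  by (simp add: nth_append)

lemma special_Node_split [simp]:
  "special (Node (l, Suc (length us)) (us @ t # ws)) \<longleftrightarrow>
     special t \<and> (\<forall>u\<in>set us \<union> set ws. first_pointed u)"
proof -
  have "(\<forall>k<length (us @ t # ws). k \<noteq> length us \<longrightarrow> first_pointed ((us @ t # ws) ! k)) \<longleftrightarrow>
        (\<forall>u\<in>set us \<union> set ws. first_pointed u)" (is "?L \<longleftrightarrow> ?R")
  proof
    assume ?L
    show ?R
    proof
      fix u assume "u \<in> set us \<union> set ws"
      then consider k where "k < length us" "u = us ! k" | k where "k < length ws" "u = ws ! k"
        by (auto simp: in_set_conv_nth)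
      then show "first_pointed u"
      proof cases
        case 1
        then show ?thesis using \<open>?L\<close>[rule_format, of k] by (auto simp: nth_append)
      next
        case 2
        then show ?thesis using \<open>?L\<close>[rule_format, of "Suc (length us + k)"] by (auto simp: nth_append)
      qed
    qed
  next
    assume ?R
    then show ?L by (auto simp: nth_append nth_Cons split: nat.splits)
  qed
  then show ?thesis by (simp add: nth_append)
qed

declare tip.simps(2) [simp del] special.simps(2) [simp del]

lemmas tip_Node_first [simp] = tip_Node_split[of _ "[]", simplified]
lemmas special_Node_first [simp] = special_Node_split[of _ "[]", simplified]

lemma tip_bounds: "decorated positions B \<Longrightarrow> 1 \<le> tip B \<and> tip B \<le> leaves B"
proof (induction B)
  case (Node d ts)
  from Node.prems(1) show ?case
  proof (cases rule: pointed_NodeE)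
    case (1 us t ws)
    then show ?thesis using Node.IH[of t] by auto
  qed
qed auto

text \<open>
  Two distinguished entries of one list coincide or are ordered.  Below, one entry is the child on the
  path to the tip and the other one the child at which a contraction takes place.
\<close>

lemma append_eq_append_Cons:
  assumes "us @ t # ws = us' @ t' # ws'"
  obtains (same) "us = us'" "t = t'" "ws = ws'"
  | (left) xs where "us = us' @ t' # xs" "ws' = xs @ t # ws"
  | (right) xs where "us' = us @ t # xs" "ws = xs @ t' # ws'"
proof -
  consider "length us = length us'" | "length us' < length us" | "length us < length us'" by linarith
  then show thesis
  proof cases
    case 1 then show thesis using assms same by auto
  next
    case 2
    obtain xs where *: "us = us' @ xs" "xs @ t # ws = t' # ws'"
      using assms 2 by (auto simp: append_eq_append_conv2)
    then obtain y ys where "xs = y # ys" using 2 by (cases xs) auto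
    then show thesis using * left[of ys] by auto
  next
    case 3
    obtain xs where *: "us' = us @ xs" "xs @ t' # ws' = t # ws"
      using assms 3 by (auto simp: append_eq_append_conv2)
    then obtain y ys where "xs = y # ys" using 3 by (cases xs) auto
    then show thesis using * right[of ys] by auto
  qed
qed

text \<open>
  A leaf lies above exactly one child of the root.
\<close>

lemma locate_unique:
  assumes "map leaves (us @ t # ws) = map leaves (us' @ t' # ws')"
    "sum_list (map leaves us) + i = sum_list (map leaves us') + i'"
    "1 \<le> i" "i \<le> leaves t" "1 \<le> i'" "i' \<le> leaves t'"
  shows "length us = length us'"
proof -
  have "map leaves us @ leaves t # map leaves ws = map leaves us' @ leaves t' # map leaves ws'"
    using assms(1) by simp
  then show ?thesis
  proof (cases rule: append_eq_append_Cons)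
    case same then show ?thesis by (blast dest: map_eq_imp_length_eq)
  next
    case (left xs) then show ?thesis using assms(2-6) by simp
  next
    case (right xs) then show ?thesis using assms(2-6) by simp
  qed
qed

lemma first_pointed_contraction:
  "decorated positions B \<Longrightarrow> first_pointed B \<Longrightarrow> B' \<in> set (contractions pcomp B) \<Longrightarrow> first_pointed B'"
proof (induction B arbitrary: B')
  case (Node d ts)
  from Node.prems(3) consider us' b vs ws' where "ts = us' @ Node b vs # ws'"
        "B' = Node (pcomp (Suc (length us')) d b) (us' @ vs @ ws')"
      | us' t' ws' s where "ts = us' @ t' # ws'" "s \<in> set (contractions pcomp t')"
        "B' = Node d (us' @ s # ws')"
      unfolding in_contractions_Node by blast
  then show ?case
  proof cases
    case 1
    then show ?thesis using Node.prems by (cases d; cases b) auto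
  next
    case 2
    then show ?thesis using Node.IH[of t' s] Node.prems by auto
  qed
qed auto

text \<open>
  If the contracted edge lies on the path to the tip, its two labels compose to the label that leads
  to the same child.  If it joins a vertex of the path to one off the path, the mark of the lower vertex is
  only shifted; in the special case the children of the upper vertex are decorated by first labels
  throughout, so that nothing else appears off the path.
\<close>

lemma tip_special_contraction:
  "decorated positions B \<Longrightarrow> B' \<in> set (contractions pcomp B) \<Longrightarrow>
   tip B' = tip B \<and> (special B \<longrightarrow> special B')"
proof (induction B arbitrary: B')
  case (Node d ts)
  from Node.prems(1) show ?case
  proof (cases rule: pointed_NodeE)
    case (1 us t ws)
    note d = 1
    let ?l = "length us + length ws"
    from Node.prems(2) consider us' b vs ws' where "ts = us' @ Node b vs # ws'"
        "B' = Node (pcomp (Suc (length us')) d b) (us' @ vs @ ws')"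
      | us' t' ws' s where "ts = us' @ t' # ws'" "s \<in> set (contractions pcomp t')"
        "B' = Node d (us' @ s # ws')"
      unfolding in_contractions_Node by blast
    then show ?thesis
    proof cases
      case 1
      from d(1) 1(1) have eq: "us @ t # ws = us' @ Node b vs # ws'" by simp
      then show ?thesis
      proof (cases rule: append_eq_append_Cons)
        case same
        from d(3)[unfolded same] show ?thesis
        proof (cases rule: pointed_NodeE)
          case (1 us2 t2 ws2)
          have "B' = Node (?l + length vs, Suc (length (us @ us2))) ((us @ us2) @ t2 # ws2 @ ws)"
            using \<open>B' = _\<close> d 1 same by auto
          then show ?thesis unfolding d 1 same by (simp only: tip_Node_split special_Node_split) (auto simp: 1)
        qed
      next
        case (left xs)
        have len: "fst b = length vs" using left d by (cases b) (auto simp: positions_def)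
        have "B' = Node (?l + length vs, Suc (length (us' @ vs @ xs))) ((us' @ vs @ xs) @ t # ws)"
          using \<open>B' = _\<close> d left len by (cases b) auto
        then show ?thesis unfolding d left by (simp only: tip_Node_split special_Node_split) (auto simp: left)
      next
        case (right xs)
        have len: "fst b = length vs" using right d by (cases b) (auto simp: positions_def)
        have "B' = Node (?l + length vs, Suc (length us)) (us @ t # xs @ vs @ ws')"
          using \<open>B' = _\<close> d right len by (cases b) auto
        then show ?thesis unfolding d right by (simp only: tip_Node_split special_Node_split) auto
      qed
    next
      case 2
      note lv = contractions_leaves[OF 2(2)]
      have fp: "decorated positions t' \<Longrightarrow> first_pointed t' \<Longrightarrow> first_pointed s"
        using first_pointed_contraction 2(2) by blast
      from d(1) 2(1) have "us @ t # ws = us' @ t' # ws'" by simp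
      then show ?thesis
      proof (cases rule: append_eq_append_Cons)
        case same
        then have "tip s = tip t \<and> (special t \<longrightarrow> special s)" using Node.IH[of t' s] 2 d by auto
        then show ?thesis using same 2 d by simp
      next
        case (left xs)
        have "B' = Node (Suc ?l, Suc (length (us' @ s # xs))) ((us' @ s # xs) @ t # ws)"
          using 2 d left by auto
        then show ?thesis
          using fp d(4) unfolding d left by (simp only: tip_Node_split special_Node_split) (auto simp: left lv)
      next
        case (right xs)
        then show ?thesis using fp 2 d by simp
      qed
    qed
  qed
qed auto

lemmas tip_contraction = tip_special_contraction[THEN conjunct1]

lemma locate_leaf:
  assumes "1 \<le> i" "i \<le> sum_list (map leaves ts)"
  obtains us t ws i' where "ts = us @ t # ws" "i = sum_list (map leaves us) + i'" "1 \<le> i'" "i' \<le> leaves t"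
  using assms
proof (induction ts arbitrary: i thesis)
  case (Cons x xs)
  show ?case
  proof (cases "i \<le> leaves x")
    case True
    then show ?thesis using Cons.prems(1)[of "[]" x xs i] Cons.prems by auto
  next
    case False
    then have "1 \<le> i - leaves x" "i - leaves x \<le> sum_list (map leaves xs)" using Cons.prems by auto
    then obtain us t ws i' where "xs = us @ t # ws" "i - leaves x = sum_list (map leaves us) + i'"
        "1 \<le> i'" "i' \<le> leaves t"
      using Cons.IH[of "i - leaves x"] by blast
    then show ?thesis using Cons.prems(1)[of "x # us" t ws i'] False by auto
  qed
qed auto

text \<open>
  The labels on the path are determined by the leaf, and all other labels are \<open>1\<close>.
\<close>

lemma special_exists:
  assumes "decorated (\<lambda>_. UNIV) (T :: shape)" "1 \<le> i" "i \<le> leaves T"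
  shows "\<exists>B. decorated positions B \<and> shape_of B = T \<and> special B \<and> tip B = i"
  using assms
proof (induction T arbitrary: i)
  case (Node a ts)
  obtain us t ws i' where ts: "ts = us @ t # ws" and i': "i = sum_list (map leaves us) + i'" "1 \<le> i'" "i' \<le> leaves t"
    using locate_leaf[of i ts] Node.prems(2,3) by (metis leaves.simps(2))
  then obtain B where B: "decorated positions B" "shape_of B = t" "special B" "tip B = i'"
    using Node.IH[of t i'] Node.prems by auto
  define f where "f = redecorate (\<lambda>l (_::unit). (l, 1::nat))"
  have f: "decorated positions (f u)" "shape_of (f u) = u" "first_pointed (f u)"
    if "decorated (\<lambda>_. UNIV) u" for u
    using that by (induction u) (auto simp: f_def positions_def o_def intro!: map_idI)
  have dec: "\<forall>u\<in>set us \<union> set ws. decorated (\<lambda>_. UNIV) u" using Node.prems ts by auto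
  have lf: "map leaves (map f us) = map leaves us"
  proof -
    have "leaves (f u) = leaves u" if "u \<in> set us" for u
      using arg_cong[OF f(2)[of u], of leaves] dec that by simp
    then show ?thesis by simp
  qed
  let ?B = "Node (length ts, Suc (length (map f us))) (map f us @ B # map f ws)"
  have "decorated positions ?B"
    using Node.prems dec f(1) B ts by (auto simp: positions_def)
  moreover have "shape_of ?B = Node a ts"
    using dec f(2) B ts by (auto simp: o_def intro!: map_idI)
  moreover have "special ?B" unfolding special_Node_split using dec f(3) B by auto
  moreover have "tip ?B = i" unfolding tip_Node_split lf using B i' by simp
  ultimately show ?case by blast
next
  case Leaf
  then show ?case by (intro exI[of _ Leaf]) auto
qed

lemma first_pointed_unique:
  "\<lbrakk>decorated positions B; decorated positions B'; first_pointed B; first_pointed B'; shape_of B = shape_of B'\<rbrakk>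
   \<Longrightarrow> B = B'"
proof (induction B arbitrary: B')
  case (Node d ts)
  then obtain d' ts' where B': "B' = Node d' ts'" "map shape_of ts = map shape_of ts'" by (cases B') auto
  then have len: "length ts = length ts'" by (metis length_map)
  have "ts = ts'"
  proof (rule nth_equalityI[OF len])
    fix j assume j: "j < length ts"
    then have "shape_of (ts ! j) = shape_of (ts' ! j)" using B' len by (metis nth_map)
    then show "ts ! j = ts' ! j" using Node j len B' by auto
  qed
  moreover have "d = d'" using Node.prems B' len by (cases d; cases d') (auto simp: positions_def)
  ultimately show ?case using B' by simp
next
  case Leaf
  then show ?case by (cases B') auto
qed

lemma special_unique:
  "\<lbrakk>decorated positions B; decorated positions B'; special B; special B'; shape_of B = shape_of B'; tip B = tip B'\<rbrakk>
   \<Longrightarrow> B = B'"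
proof (induction B arbitrary: B')
  case (Node d ts)
  from Node.prems(5) obtain d' ts' where B': "B' = Node d' ts'" "map shape_of ts = map shape_of ts'"
    by (cases B') auto
  from B'(2) have len: "length ts = length ts'" by (rule map_eq_imp_length_eq)
  have lv: "map leaves ts = map leaves ts'"
    using arg_cong[OF B'(2), of "map leaves"] by (simp add: o_def del: map_eq_conv)
  from Node.prems(1) obtain us t ws where d: "ts = us @ t # ws" "d = (Suc (length us + length ws), Suc (length us))"
    "decorated positions t" "\<forall>u\<in>set us \<union> set ws. decorated positions u"
    by (rule pointed_NodeE)
  from Node.prems(2)[unfolded B'] obtain us' t' ws' where d': "ts' = us' @ t' # ws'"
    "d' = (Suc (length us' + length ws'), Suc (length us'))"
    "decorated positions t'" "\<forall>u\<in>set us' \<union> set ws'. decorated positions u"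
    by (rule pointed_NodeE)
  have eq: "sum_list (map leaves us) + tip t = sum_list (map leaves us') + tip t'"
    using Node.prems(6) unfolding B' d d' by simp
  have b: "1 \<le> tip t" "tip t \<le> leaves t" "1 \<le> tip t'" "tip t' \<le> leaves t'" using tip_bounds d d' by auto
  have "length us = length us'" using locate_unique[OF _ eq b] lv d d' by simp
  then have sh: "map shape_of us = map shape_of us'" "shape_of t = shape_of t'" "map shape_of ws = map shape_of ws'"
    using B'(2) d d' by auto
  have "map leaves us = map leaves us'" using arg_cong[OF sh(1), of "map leaves"] by (simp add: o_def del: map_eq_conv)
  then have tip: "tip t = tip t'" using eq by simp
  have sp: "special t" "special t'" "\<forall>u\<in>set us \<union> set ws. first_pointed u" "\<forall>u\<in>set us' \<union> set ws'. first_pointed u"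
    using Node.prems(3,4) unfolding B' d d' by simp_all
  have "t = t'" using Node.IH[of t t'] d d' sp sh tip by auto
  have *: "xs = ys" if "map shape_of xs = map shape_of ys" "\<forall>u\<in>set xs \<union> set ys. decorated positions u \<and> first_pointed u"
    for xs ys
    using that
  proof (induction xs arbitrary: ys)
    case (Cons x xs)
    then show ?case by (cases ys) (auto intro: first_pointed_unique)
  qed auto
  have "us = us'" using * sh(1) sp d d' by blast
  moreover have "ws = ws'" using * sh(3) sp d d' by blast
  ultimately have "us = us'" "ws = ws'" .
  then show ?case using \<open>t = t'\<close> B' d d' by simp
next
  case Leaf
  then show ?case by (cases B') auto
qed

section \<open>Functionals on binary quadratic operads\<close>

lemma sum_fun_apply: "(\<Sum>a\<in>A. f a) x = (\<Sum>a\<in>A. f a x)"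
  by (induction A rule: infinite_finite_induct) auto

lemma keys_sum_single: "p = (\<Sum>m\<in>Poly_Mapping.keys p. Poly_Mapping.single m (Poly_Mapping.lookup p m))"
  by (rule poly_mapping_eqI) (simp add: lookup_sum lookup_single when_def in_keys_iff)

lemma free_comp_single:
  "free_comp i (Poly_Mapping.single s c) (Poly_Mapping.single t d) =
     (if 1 \<le> i \<and> i \<le> arity s then Poly_Mapping.single (graft i s t) (c * d) else 0)"
  by (subst free_comp_superset[of "{s}" _ "{t}"]) auto

lemma free_comp_zero [simp]: "free_comp i 0 q = 0" "free_comp i p 0 = 0"
  by (auto simp: free_comp_def)

lemma free_comp_add_left: "free_comp i (p + p') q = free_comp i p q + free_comp i p' q"
  using free_comp_diff_left[of i "p + p'" p' q] by (simp add: algebra_simps)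

lemma free_comp_add_right: "free_comp i p (q + q') = free_comp i p q + free_comp i p q'"
  using free_comp_diff_right[of i p "q + q'" q'] by (simp add: algebra_simps)

lemma pscale_single: "pscale c (Poly_Mapping.single m d) = Poly_Mapping.single m (c * d)"
  by (rule poly_mapping_eqI) (simp add: lookup_single when_def)

lemma pscale_sum: "pscale c (sum f A) = (\<Sum>x\<in>A. pscale c (f x))"
  by (rule poly_mapping_eqI) (simp add: lookup_sum sum_distrib_left)

lemma pscale_zero [simp]: "pscale c 0 = 0"
  by (rule poly_mapping_eqI) simp

lemma keys_pscale: "Poly_Mapping.keys (pscale c p) \<subseteq> Poly_Mapping.keys p"
  by (auto simp: in_keys_iff)

lemma free_comp_pscale_left: "free_comp i (pscale c p) q = pscale c (free_comp i p q)"
  by (subst (1 2) free_comp_superset[of "Poly_Mapping.keys p" _ "Poly_Mapping.keys q"])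
     (auto simp: keys_pscale pscale_sum pscale_single mult_ac intro!: sum.cong)

lemma free_comp_pscale_right: "free_comp i p (pscale c q) = pscale c (free_comp i p q)"
  by (subst (1 2) free_comp_superset[of "Poly_Mapping.keys p" _ "Poly_Mapping.keys q"])
     (auto simp: keys_pscale pscale_sum pscale_single mult_ac intro!: sum.cong)

text \<open>
  A map \<open>h\<close> from monomials to a set with partial compositions, with \<^const>\<open>None\<close> as an absorbing zero,
  extends linearly to the operad spanned by that set; \<open>class_sum h c p\<close> is the \<open>c\<close>-coordinate of the
  image of \<open>p\<close>.
\<close>

definition class_sum :: "('x bmon \<Rightarrow> 'c option) \<Rightarrow> 'c \<Rightarrow> ('x bmon \<Rightarrow>\<^sub>0 'k::field) \<Rightarrow> 'k" where
  "class_sum h c p = (\<Sum>m\<in>Poly_Mapping.keys p. of_bool (h m = Some c) * Poly_Mapping.lookup p m)"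

lemma class_sum_superset:
  "finite A \<Longrightarrow> Poly_Mapping.keys p \<subseteq> A \<Longrightarrow>
   class_sum h c p = (\<Sum>m\<in>A. of_bool (h m = Some c) * Poly_Mapping.lookup p m)"
  unfolding class_sum_def by (rule sum.mono_neutral_left) (auto simp: in_keys_iff)

lemma class_sum_zero [simp]: "class_sum h c 0 = 0"
  by (simp add: class_sum_def)

lemma class_sum_single [simp]: "class_sum h c (Poly_Mapping.single m v) = of_bool (h m = Some c) * v"
  by (subst class_sum_superset[of "{m}"]) auto

lemma class_sum_add: "class_sum h c (p + q) = class_sum h c p + class_sum h c q"
proof -
  let ?A = "Poly_Mapping.keys p \<union> Poly_Mapping.keys q"
  have "Poly_Mapping.keys (p + q) \<subseteq> ?A" by (rule Poly_Mapping.keys_add)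
  then show ?thesis
    by (subst (1 2 3) class_sum_superset[of ?A]) (auto simp: lookup_add algebra_simps sum.distrib)
qed

lemma class_sum_pscale: "class_sum h c (pscale d p) = d * class_sum h c p"
proof -
  have "class_sum h c (pscale d p) =
      (\<Sum>m\<in>Poly_Mapping.keys p. of_bool (h m = Some c) * Poly_Mapping.lookup (pscale d p) m)"
    by (rule class_sum_superset) (auto simp: keys_pscale)
  also have "\<dots> = d * class_sum h c p"
    unfolding class_sum_def sum_distrib_left by (intro sum.cong refl) simp
  finally show ?thesis .
qed

lemma class_sum_diff: "class_sum h c (p - q) = class_sum h c p - class_sum h c q"
  using class_sum_add[of h c "p - q" q] by simp

lemma class_sum_sum: "class_sum h c (sum f A) = (\<Sum>x\<in>A. class_sum h c (f x))"
  by (induction A rule: infinite_finite_induct) (auto simp: class_sum_add)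

lemma class_sum_regroup:
  assumes "\<And>c. class_sum h c p = 0" "W None = 0"
  shows "(\<Sum>m\<in>Poly_Mapping.keys p. W (h m) * Poly_Mapping.lookup p m) = 0"
proof -
  let ?K = "Poly_Mapping.keys p"
  have "(\<Sum>m\<in>?K. W (h m) * Poly_Mapping.lookup p m)
      = (\<Sum>y\<in>h ` ?K. \<Sum>m\<in>{m \<in> ?K. h m = y}. W (h m) * Poly_Mapping.lookup p m)"
    by (rule sum.image_gen) simp
  also have "\<dots> = (\<Sum>y\<in>h ` ?K. 0)"
  proof (rule sum.cong)
    fix y
    have "(\<Sum>m\<in>{m \<in> ?K. h m = y}. W (h m) * Poly_Mapping.lookup p m)
        = W y * (\<Sum>m\<in>{m \<in> ?K. h m = y}. Poly_Mapping.lookup p m)"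
      by (simp add: sum_distrib_left)
    also have "(\<Sum>m\<in>{m \<in> ?K. h m = y}. Poly_Mapping.lookup p m)
        = (\<Sum>m\<in>?K. of_bool (h m = y) * Poly_Mapping.lookup p m)"
      by (rule sum.mono_neutral_cong_left) auto
    finally show "(\<Sum>m\<in>{m \<in> ?K. h m = y}. W (h m) * Poly_Mapping.lookup p m) = 0"
      using assms by (cases y) (auto simp: class_sum_def)
  qed auto
  finally show ?thesis by simp
qed

lemma class_sum_free_comp:
  "class_sum h e (free_comp i p q) =
     (\<Sum>s\<in>Poly_Mapping.keys p. \<Sum>t\<in>Poly_Mapping.keys q.
        of_bool (1 \<le> i \<and> i \<le> arity s \<and> h (graft i s t) = Some e) *
        (Poly_Mapping.lookup p s * Poly_Mapping.lookup q t))"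
  unfolding free_comp_def class_sum_sum by (intro sum.cong refl) (simp add: of_bool_def)

text \<open>
  If \<open>h\<close> respects compositions, then its linear extension is a morphism of operads.  A morphism killing
  the relators kills the ideal.
\<close>

lemma class_sum_quad_ideal:
  fixes h :: "'x::finite bmon \<Rightarrow> 'c option" and \<Lambda> :: "('x, 'k::field) quad_data"
  assumes comp: "\<And>i s t. 1 \<le> i \<Longrightarrow> i \<le> arity s \<Longrightarrow>
        h (graft i s t) = (case (h s, h t) of (Some c, Some d) \<Rightarrow> C i c d | _ \<Rightarrow> None)"
    and ar: "\<And>s c. h s = Some c \<Longrightarrow> arity s = ar c"
    and rel: "\<And>u v c. (u, v) \<in> \<Lambda> \<Longrightarrow> class_sum h c (quad_relator u v) = 0"
    and p: "p \<in> quad_ideal \<Lambda>"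
  shows "class_sum h c p = 0"
  using p
proof (induction arbitrary: c)
  case (comp_left p i q)
  define W :: "'x bmon \<Rightarrow> 'c option \<Rightarrow> 'k" where
    "W t y = (case y of None \<Rightarrow> 0 | Some d \<Rightarrow>
       of_bool (1 \<le> i \<and> i \<le> ar d \<and> (case h t of None \<Rightarrow> None | Some d' \<Rightarrow> C i d d') = Some c))" for t y
  have "class_sum h c (free_comp i p q) = (\<Sum>t\<in>Poly_Mapping.keys q.
     (\<Sum>s\<in>Poly_Mapping.keys p. W t (h s) * Poly_Mapping.lookup p s) * Poly_Mapping.lookup q t)"
    unfolding class_sum_free_comp sum_distrib_right
    by (subst sum.swap, intro sum.cong refl) (auto simp: W_def comp split: option.splits dest: ar)
  also have "\<dots> = 0"
    using comp_left class_sum_regroup[of h p "W _"] by (simp add: W_def)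
  finally show ?case .
next
  case (comp_right q i p)
  define W :: "'x bmon \<Rightarrow> 'c option \<Rightarrow> 'k" where
    "W s y = (case y of None \<Rightarrow> 0 | Some d \<Rightarrow>
       of_bool (1 \<le> i \<and> i \<le> arity s \<and> (case h s of None \<Rightarrow> None | Some d' \<Rightarrow> C i d' d) = Some c))" for s y
  have "class_sum h c (free_comp i p q) = (\<Sum>s\<in>Poly_Mapping.keys p.
     (\<Sum>t\<in>Poly_Mapping.keys q. W s (h t) * Poly_Mapping.lookup q t) * Poly_Mapping.lookup p s)"
    unfolding class_sum_free_comp sum_distrib_right
    by (intro sum.cong refl) (auto simp: W_def comp split: option.splits)
  also have "\<dots> = 0"
    using comp_right class_sum_regroup[of h q "W _"] by (simp add: W_def)
  finally show ?case .
qed (auto simp: rel class_sum_add class_sum_pscale)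

lemma sum_dop_pairs: "(\<Sum>x\<in>UNIV. f x) = f (Prec, Prec) + f (Prec, Succ) + f (Succ, Prec) + f (Succ, Succ)"
  for f :: "dop \<times> dop \<Rightarrow> 'b::ab_group_add"
proof -
  have "(\<Sum>x\<in>UNIV. f x) = (\<Sum>x\<in>UNIV. \<Sum>y\<in>UNIV. f (x, y))"
    by (simp add: sum.cartesian_product)
  then show ?thesis by (simp add: UNIV_dop add_ac)
qed

lemma class_sum_quad_relator:
  fixes u v :: "dop \<times> dop \<Rightarrow> 'k::field"
  shows "class_sum h c (quad_relator u v) =
    (\<Sum>(a, b)\<in>UNIV. of_bool (h (Op (Op Lf a Lf) b Lf) = Some c) * u (a, b)) -
    (\<Sum>(a, b)\<in>UNIV. of_bool (h (Op Lf a (Op Lf b Lf)) = Some c) * v (a, b))"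
  unfolding quad_relator_def class_sum_diff class_sum_sum by (auto simp: case_prod_beta)

lemma dend_rel_cases:
  assumes "(u, v) \<in> dend_rel"
  obtains "u = (\<lambda>x. of_bool (x = (Prec, Prec)))" "v = (\<lambda>x. of_bool (x = (Prec, Prec) \<or> x = (Prec, Succ)))"
  | "u = (\<lambda>x. of_bool (x = (Succ, Prec)))" "v = (\<lambda>x. of_bool (x = (Succ, Prec)))"
  | "u = (\<lambda>x. of_bool (x = (Prec, Succ) \<or> x = (Succ, Succ)))" "v = (\<lambda>x. of_bool (x = (Succ, Succ)))"
proof -
  have "(of_bool (a = Prec) + of_bool (a = Succ) :: 'a) = 1" for a by (cases a) auto
  moreover have "a = Prec \<or> a = Succ" for a by (cases a) auto
  ultimately show thesis
    using assms that unfolding dend_rel_def Let_def tensor2_def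
    by (auto simp: fun_eq_iff of_bool_def)
qed

lemma quad_perp_dend_rel_iff:
  fixes f g :: "dop \<times> dop \<Rightarrow> 'k::field"
  shows "(f, g) \<in> quad_perp dend_rel \<longleftrightarrow>
    f (Prec, Prec) = g (Prec, Prec) + g (Prec, Succ) \<and> f (Succ, Prec) = g (Succ, Prec) \<and>
    f (Prec, Succ) + f (Succ, Succ) = g (Succ, Succ)"
  unfolding quad_perp_def dend_rel_def Let_def
  by (auto simp: sum_dop_pairs tensor2_def)

section \<open>The operad Dias\<close>

text \<open>
  Lower bound: the position of the distinguished argument gives a morphism, whose coordinates are linear
  forms on Dias.  Upper bound: the relations bring each monomial to a normal form that depends only on the
  arity and this position.
\<close>

primrec cpos :: "dop bmon \<Rightarrow> nat" where
  "cpos Lf = 1"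
| "cpos (Op s a t) = (case a of Prec \<Rightarrow> cpos s | Succ \<Rightarrow> arity s + cpos t)"

lemma arity_pos: "1 \<le> arity m"
  by (induction m) auto

lemma cpos_bounds: "1 \<le> cpos m \<and> cpos m \<le> arity m"
  by (induction m) (auto split: dop.splits)

lemma arity_graft: "1 \<le> i \<Longrightarrow> i \<le> arity s \<Longrightarrow> arity (graft i s t) = arity s + arity t - 1"
proof (induction s arbitrary: i)
  case (Op s1 a s2)
  then show ?case using arity_pos[of s1] arity_pos[of s2] arity_pos[of t] by auto
qed auto

lemma cpos_graft:
  "1 \<le> i \<Longrightarrow> i \<le> arity s \<Longrightarrow> cpos (graft i s t) = snd (pcomp i (arity s, cpos s) (arity t, cpos t))"
proof (induction s arbitrary: i)
  case (Op s1 a s2)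
  note b = arity_pos[of s1] arity_pos[of s2] arity_pos[of t] cpos_bounds[of s1] cpos_bounds[of s2] cpos_bounds[of t]
  show ?case
  proof (cases "i \<le> arity s1")
    case True
    then show ?thesis using Op.IH(1)[of i] Op.prems b arity_graft[of i s1 t] by (cases a) auto
  next
    case False
    then show ?thesis using Op.IH(2)[of "i - arity s1"] Op.prems b by (cases a) auto
  qed
qed auto

definition dias_class :: "dop bmon \<Rightarrow> (nat \<times> nat) option" where
  "dias_class m = Some (arity m, cpos m)"

lemma dias_class_ideal:
  "(p :: dop bmon \<Rightarrow>\<^sub>0 'k::field) \<in> quad_ideal (quad_perp dend_rel) \<Longrightarrow> class_sum dias_class c p = 0"
proof (erule class_sum_quad_ideal[where C = "\<lambda>i c d. Some (pcomp i c d)" and ar = fst, rotated 3])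
  fix i t and s :: "dop bmon" assume "1 \<le> i" "i \<le> arity s"
  then show "dias_class (graft i s t) = (case (dias_class s, dias_class t) of
      (Some c, Some d) \<Rightarrow> Some (pcomp i c d) | _ \<Rightarrow> None)"
    by (simp add: dias_class_def arity_graft cpos_graft)
next
  fix u v :: "dop \<times> dop \<Rightarrow> 'k" and c assume "(u, v) \<in> quad_perp dend_rel"
  then have "u (Prec, Prec) = v (Prec, Prec) + v (Prec, Succ)" "u (Succ, Prec) = v (Succ, Prec)"
    "u (Prec, Succ) + u (Succ, Succ) = v (Succ, Succ)"
    unfolding quad_perp_dend_rel_iff by auto
  then show "class_sum dias_class c (quad_relator u v) = 0"
    unfolding class_sum_quad_relator sum_dop_pairs
    by (auto simp: dias_class_def of_bool_def add_diff_eq split: if_splits)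
qed (auto simp: dias_class_def)

lift_definition dias_coord :: "nat \<times> nat \<Rightarrow> 'k::field dias \<Rightarrow> 'k" is "class_sum dias_class"
  unfolding quad_eq_def using dias_class_ideal class_sum_diff by (metis eq_iff_diff_eq_0)

lemma dias_coord_add: "dias_coord d (x + y) = dias_coord d x + dias_coord d y"
  by transfer (rule class_sum_add)

lemma dias_coord_scale: "dias_coord d (dias_scale c x) = c * dias_coord d x"
  by transfer (rule class_sum_pscale)

global_interpretation dias: vector_space "dias_scale :: 'k::field \<Rightarrow> 'k dias \<Rightarrow> 'k dias"
  by standard (transfer; simp add: pscale_simps quad_eq_def quad_ideal.zero)+

definition dias_mono :: "dop bmon \<Rightarrow> 'k::field dias" where
  "dias_mono m = abs_dias (Poly_Mapping.single m 1)"

lemma dias_coord_mono: "dias_coord d (dias_mono m) = of_bool ((arity m, cpos m) = d)"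
  unfolding dias_mono_def dias_coord.abs_eq by (simp add: dias_class_def)

lemma dias_comp_mono:
  "1 \<le> i \<Longrightarrow> i \<le> arity s \<Longrightarrow> dias_comp i (dias_mono s) (dias_mono t) = dias_mono (graft i s t)"
  unfolding dias_mono_def dias_comp.abs_eq by (simp add: free_comp_single)

lemma dias_mono_Op:
  "dias_mono (Op s a t) = dias_comp 1 (dias_comp 2 (dias_mono (Op Lf a Lf)) (dias_mono t)) (dias_mono s)"
  using arity_pos[of t] by (simp add: dias_comp_mono)

lemma dias_mono_Op_cong:
  "dias_mono s = (dias_mono s' :: 'k::field dias) \<Longrightarrow> dias_mono t = (dias_mono t' :: 'k dias) \<Longrightarrow>
   dias_mono (Op s a t) = (dias_mono (Op s' a t') :: 'k dias)"
  by (metis dias_mono_Op)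

text \<open>
  These are the equalities of monomials in the orthogonal complement of the dendriform relations: the
  axioms of dialgebras.  The bracketing does not matter where both sides point to the same argument, and
  on the side that a product ignores the operation is arbitrary as well.
\<close>

lemma dias_assoc:
  assumes "(a = Prec \<and> b = Prec \<and> a' = Prec) \<or> (a = Succ \<and> b = Prec \<and> a' = Succ \<and> b' = Prec) \<or>
    (b = Succ \<and> a' = Succ \<and> b' = Succ)"
  shows "dias_mono (Op (Op p a q) b r) = (dias_mono (Op p a' (Op q b' r)) :: 'k::field dias)"
proof -
  define u v :: "dop \<times> dop \<Rightarrow> 'k" where "u = (\<lambda>x. of_bool (x = (a, b)))" "v = (\<lambda>x. of_bool (x = (a', b')))"
  have uv: "(u, v) \<in> quad_perp dend_rel"
    unfolding quad_perp_dend_rel_iff u_v_def using assms dop.exhaust[of a] dop.exhaust[of b'] by auto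
  define s :: "dop bmon \<Rightarrow> (dop bmon \<Rightarrow>\<^sub>0 'k)" where "s m = Poly_Mapping.single m 1" for m
  have sum: "(\<Sum>(c, d)\<in>UNIV. Poly_Mapping.single (M c d) (of_bool ((c, d) = (a :: dop, b :: dop)) :: 'k)) = s (M a b)"
    for M a b by (cases a; cases b) (simp_all add: sum_dop_pairs s_def)
  have "quad_relator u v = s (Op (Op Lf a Lf) b Lf) - s (Op Lf a' (Op Lf b' Lf))"
    unfolding quad_relator_def u_v_def sum ..
  then have "s (Op (Op Lf a Lf) b Lf) - s (Op Lf a' (Op Lf b' Lf)) \<in> quad_ideal (quad_perp dend_rel)"
    using quad_ideal.relator[OF uv] by simp
  then have "free_comp 1 (free_comp 2 (free_comp 3 (s (Op (Op Lf a Lf) b Lf) - s (Op Lf a' (Op Lf b' Lf))) (s r)) (s q)) (s p)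
      \<in> quad_ideal (quad_perp dend_rel)"
    by (intro quad_ideal.comp_left)
  also have "free_comp 1 (free_comp 2 (free_comp 3 (s (Op (Op Lf a Lf) b Lf) - s (Op Lf a' (Op Lf b' Lf))) (s r)) (s q)) (s p)
      = s (Op (Op p a q) b r) - s (Op p a' (Op q b' r))"
    by (simp add: free_comp_diff_left free_comp_single s_def)
  finally show ?thesis
    unfolding dias_mono_def s_def dias.abs_eq_iff quad_eq_def .
qed

text \<open>
  The normal forms are \<open>lpad (i - 1) (rpad (l - i) Lf)\<close>: the distinguished leaf is first multiplied
  by the leaves on its right, one after the other, and then by those on its left.
\<close>

primrec lpad :: "nat \<Rightarrow> dop bmon \<Rightarrow> dop bmon" where
  "lpad 0 x = x"
| "lpad (Suc k) x = Op Lf Succ (lpad k x)"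

primrec rpad :: "nat \<Rightarrow> dop bmon \<Rightarrow> dop bmon" where
  "rpad 0 x = x"
| "rpad (Suc k) x = Op (rpad k x) Prec Lf"

lemma rpad_cong: "dias_mono x = (dias_mono y :: 'k::field dias) \<Longrightarrow>
    dias_mono (rpad k x) = (dias_mono (rpad k y) :: 'k dias)"
  by (induction k) (auto intro: dias_mono_Op_cong)

lemma lpad_cong: "dias_mono x = (dias_mono y :: 'k::field dias) \<Longrightarrow>
    dias_mono (lpad k x) = (dias_mono (lpad k y) :: 'k dias)"
  by (induction k) (auto intro: dias_mono_Op_cong)

lemma rpad_rpad: "rpad k (rpad l x) = rpad (k + l) x"
  by (induction k) auto

lemma lpad_lpad: "lpad k (lpad l x) = lpad (k + l) x"
  by (induction k) auto

text \<open>
  The ignored factor of a product only matters through its arity, because it can be split off one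
  leaf at a time.
\<close>

lemma dias_mono_Prec: "dias_mono (Op x Prec u) = (dias_mono (rpad (arity u) x) :: 'k::field dias)"
proof (induction u arbitrary: x)
  case (Op v a w)
  have "dias_mono (Op x Prec (Op v a w)) = (dias_mono (Op (Op x Prec v) Prec w) :: 'k dias)"
    by (rule dias_assoc[symmetric]) simp
  also have "\<dots> = dias_mono (rpad (arity w) (Op x Prec v))" by (rule Op)
  also have "\<dots> = dias_mono (rpad (arity w) (rpad (arity v) x))" by (rule rpad_cong, rule Op)
  finally show ?case by (simp add: rpad_rpad add.commute)
qed auto

lemma dias_mono_Succ: "dias_mono (Op u Succ x) = (dias_mono (lpad (arity u) x) :: 'k::field dias)"
proof (induction u arbitrary: x)
  case (Op v a w)
  have "dias_mono (Op (Op v a w) Succ x) = (dias_mono (Op v Succ (Op w Succ x)) :: 'k dias)"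
    by (rule dias_assoc) simp
  also have "\<dots> = dias_mono (lpad (arity v) (Op w Succ x))" by (rule Op)
  also have "\<dots> = dias_mono (lpad (arity v) (lpad (arity w) x))" by (rule lpad_cong, rule Op)
  finally show ?case by (simp add: lpad_lpad)
qed auto

lemma dias_mono_lpad_Prec: "dias_mono (Op (lpad k x) Prec u) = (dias_mono (lpad k (Op x Prec u)) :: 'k::field dias)"
proof (induction k)
  case (Suc k)
  have "dias_mono (Op (lpad (Suc k) x) Prec u) = (dias_mono (Op Lf Succ (Op (lpad k x) Prec u)) :: 'k dias)"
    unfolding lpad.simps by (rule dias_assoc) simp
  also have "\<dots> = dias_mono (lpad (Suc k) (Op x Prec u))"
    unfolding lpad.simps by (rule dias_mono_Op_cong[OF refl Suc])
  finally show ?case .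
qed auto

definition dias_basis :: "nat \<times> nat \<Rightarrow> 'k::field dias" where
  "dias_basis d = dias_mono (lpad (snd d - 1) (rpad (fst d - snd d) Lf))"

lemma dias_mono_eq_basis: "dias_mono m = (dias_basis (arity m, cpos m) :: 'k::field dias)"
proof (induction m)
  case (Op s a t)
  note b = cpos_bounds[of s] cpos_bounds[of t]
  show ?case
  proof (cases a)
    case Prec
    have "dias_mono (Op s Prec t) =
        (dias_mono (Op (lpad (cpos s - 1) (rpad (arity s - cpos s) Lf)) Prec t) :: 'k dias)"
      by (rule dias_mono_Op_cong) (use Op in \<open>simp_all add: dias_basis_def\<close>)
    also have "\<dots> = dias_mono (lpad (cpos s - 1) (Op (rpad (arity s - cpos s) Lf) Prec t))"
      by (rule dias_mono_lpad_Prec)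
    also have "\<dots> = dias_mono (lpad (cpos s - 1) (rpad (arity t) (rpad (arity s - cpos s) Lf)))"
      by (rule lpad_cong, rule dias_mono_Prec)
    also have "\<dots> = dias_basis (arity (Op s a t), cpos (Op s a t))"
      using b by (simp add: Prec dias_basis_def rpad_rpad add.commute)
    finally show ?thesis using Prec by simp
  next
    case Succ
    have "dias_mono (Op s Succ t) =
        (dias_mono (Op s Succ (lpad (cpos t - 1) (rpad (arity t - cpos t) Lf))) :: 'k dias)"
      by (rule dias_mono_Op_cong) (use Op in \<open>simp_all add: dias_basis_def\<close>)
    also have "\<dots> = dias_mono (lpad (arity s) (lpad (cpos t - 1) (rpad (arity t - cpos t) Lf)))"
      by (rule dias_mono_Succ)
    also have "\<dots> = dias_basis (arity (Op s a t), cpos (Op s a t))"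
      using b by (simp add: Succ dias_basis_def lpad_lpad)
    finally show ?thesis using Succ by simp
  qed
qed (simp add: dias_basis_def)

lemma arity_pad [simp]: "arity (lpad k x) = k + arity x" "arity (rpad k x) = k + arity x"
  by (induction k) auto

lemma cpos_pad [simp]: "cpos (lpad k x) = k + cpos x" "cpos (rpad k x) = cpos x"
  by (induction k) auto

lemma positions_normal_form:
  assumes "d \<in> positions l"
  obtains m where "arity m = l" "cpos m = snd d" "d = (arity m, cpos m)" "dias_basis d = (dias_mono m :: 'k::field dias)"
  by (rule that[of "lpad (snd d - 1) (rpad (fst d - snd d) Lf)"])
     (use assms in \<open>auto simp: positions_def dias_basis_def\<close>)

lemma dias_comp_basis:
  assumes "1 \<le> i" "i \<le> m" "d \<in> positions m" "d' \<in> positions q"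
  shows "dias_comp i (dias_basis d) (dias_basis d') = (dias_basis (pcomp i d d') :: 'k::field dias)"
proof -
  obtain s where s: "arity s = m" "d = (arity s, cpos s)" "dias_basis d = (dias_mono s :: 'k dias)"
    using positions_normal_form[OF assms(3)] by metis
  obtain t where t: "arity t = q" "d' = (arity t, cpos t)" "dias_basis d' = (dias_mono t :: 'k dias)"
    using positions_normal_form[OF assms(4)] by metis
  have "dias_comp i (dias_basis d) (dias_basis d') = (dias_mono (graft i s t) :: 'k dias)"
    unfolding s(3) t(3) using assms s by (intro dias_comp_mono) auto
  also have "\<dots> = dias_basis (arity (graft i s t), cpos (graft i s t))" by (rule dias_mono_eq_basis)
  also have "(arity (graft i s t), cpos (graft i s t)) = pcomp i d d'"
    using assms s t by (simp add: arity_graft cpos_graft)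
  finally show ?thesis .
qed

lemma dias_coord_basis:
  "d \<in> positions l \<Longrightarrow> dias_coord d' (dias_basis d :: 'k::field dias) = of_bool (d = d')"
  by (erule positions_normal_form[where 'k = 'k]) (simp add: dias_coord_mono)

lemma dias_gen_eq: "dias_gen a = (dias_basis (2, if a = Prec then 1 else 2) :: 'k::field dias)"
proof -
  have "dias_gen a = (dias_mono (Op Lf a Lf) :: 'k dias)" by (simp add: dias_gen_def dias_mono_def)
  then show ?thesis using dias_mono_eq_basis[of "Op Lf a Lf", where 'k = 'k] by (cases a) (auto simp: numeral_2_eq_2)
qed

lemma abs_dias_sum: "abs_dias (sum f A) = (\<Sum>x\<in>A. abs_dias (f x))"
  by (induction A rule: infinite_finite_induct) (auto simp: zero_dias.abs_eq plus_dias.abs_eq[symmetric])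

lemma abs_dias_single: "abs_dias (Poly_Mapping.single m c) = dias_scale c (dias_mono m)"
  by (simp add: dias_mono_def dias_scale.abs_eq pscale_single)

lemma free_arity_subspace:
  "0 \<in> free_arity n" "p \<in> free_arity n \<Longrightarrow> q \<in> free_arity n \<Longrightarrow> p + q \<in> free_arity n"
  "p \<in> free_arity n \<Longrightarrow> pscale c p \<in> free_arity n" "arity m = n \<Longrightarrow> Poly_Mapping.single m c \<in> free_arity n"
  using Poly_Mapping.keys_add[of p q] keys_pscale[of c p] by (auto simp: free_arity_def split: if_splits)

lemma Dias_subspace: "dias.subspace (Dias n :: 'k::field dias set)"
  unfolding Dias_def by (rule dias.subspaceI)
    (auto simp: zero_dias.abs_eq plus_dias.abs_eq dias_scale.abs_eq intro!: imageI free_arity_subspace)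

lemma dias_mono_in_Dias: "arity m = n \<Longrightarrow> dias_mono m \<in> Dias n"
  unfolding Dias_def dias_mono_def by (auto intro: free_arity_subspace)

lemma dias_basis_in_Dias: "d \<in> positions l \<Longrightarrow> (dias_basis d :: 'k::field dias) \<in> Dias l"
  by (erule positions_normal_form[where 'k = 'k]) (simp add: dias_mono_in_Dias)

text \<open>
  Each monomial of \<open>x\<close> is a basis element; collecting equal ones gives the coordinates of \<open>x\<close>.
\<close>

lemma Dias_expand:
  fixes x :: "'k::field dias"
  assumes "x \<in> Dias l"
  shows "x = (\<Sum>d\<in>positions l. dias_scale (dias_coord d x) (dias_basis d))"
proof -
  obtain p where p: "p \<in> free_arity l" "x = abs_dias p" using assms by (auto simp: Dias_def)
  let ?K = "Poly_Mapping.keys p" and ?v = "Poly_Mapping.lookup p"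
  let ?d = "\<lambda>m. (arity m, cpos m)"
  have pos: "?d m \<in> positions l" if "m \<in> ?K" for m
    using p that cpos_bounds[of m] by (auto simp: free_arity_def positions_def)
  have x: "x = (\<Sum>m\<in>?K. dias_scale (?v m) (dias_basis (?d m)))"
    unfolding p(2) by (subst keys_sum_single[of p]) (simp add: abs_dias_sum abs_dias_single dias_mono_eq_basis)
  also have "\<dots> = (\<Sum>m\<in>?K. \<Sum>d\<in>positions l. dias_scale (of_bool (?d m = d) * ?v m) (dias_basis d))"
  proof (intro sum.cong refl)
    fix m assume "m \<in> ?K"
    have "(\<Sum>d\<in>positions l. dias_scale (of_bool (?d m = d) * ?v m) (dias_basis d)) =
      (\<Sum>d\<in>positions l. if d = ?d m then dias_scale (?v m) (dias_basis (?d m) :: 'k dias) else 0)"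
      by (intro sum.cong) auto
    also have "\<dots> = dias_scale (?v m) (dias_basis (?d m))"
      using pos[OF \<open>m \<in> ?K\<close>] by (simp add: positions_def)
    finally show "dias_scale (?v m) (dias_basis (?d m)) =
      (\<Sum>d\<in>positions l. dias_scale (of_bool (?d m = d) * ?v m) (dias_basis d))" by simp
  qed
  also have "\<dots> = (\<Sum>d\<in>positions l. dias_scale (\<Sum>m\<in>?K. of_bool (?d m = d) * ?v m) (dias_basis d))"
    by (subst sum.swap) (simp only: dias.scale_sum_left)
  also have "\<dots> = (\<Sum>d\<in>positions l. dias_scale (dias_coord d x) (dias_basis d))"
    unfolding p(2) dias_coord.abs_eq class_sum_def dias_class_def by simp
  finally show ?thesis .
qed

lemma dias_comp_add_left: "dias_comp i (x + x') y = dias_comp i x y + dias_comp i x' y"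
  by transfer (simp add: free_comp_add_left quad_eq_def quad_ideal.zero)

lemma dias_comp_add_right: "dias_comp i x (y + y') = dias_comp i x y + dias_comp i x y'"
  by transfer (simp add: free_comp_add_right quad_eq_def quad_ideal.zero)

lemma dias_comp_scale_left: "dias_comp i (dias_scale c x) y = dias_scale c (dias_comp i x y)"
  by transfer (simp add: free_comp_pscale_left quad_eq_def quad_ideal.zero)

lemma dias_comp_scale_right: "dias_comp i x (dias_scale c y) = dias_scale c (dias_comp i x y)"
  by transfer (simp add: free_comp_pscale_right quad_eq_def quad_ideal.zero)

lemma dias_comp_zero [simp]: "dias_comp i 0 y = 0" "dias_comp i x 0 = 0"
  using dias_comp_add_left[of i 0 0 y] dias_comp_add_right[of i x 0 0] by simp_all

lemma dias_comp_sum_left: "dias_comp i (sum f A) y = (\<Sum>a\<in>A. dias_comp i (f a) y)"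
  by (induction A rule: infinite_finite_induct) (auto simp: dias_comp_add_left)

lemma dias_comp_sum_right: "dias_comp i x (sum f A) = (\<Sum>a\<in>A. dias_comp i x (f a))"
  by (induction A rule: infinite_finite_induct) (auto simp: dias_comp_add_right)

lemma dias_comp_expand:
  fixes x y :: "'k::field dias"
  assumes "x \<in> Dias m" "y \<in> Dias q" "1 \<le> i" "i \<le> m"
  shows "dias_comp i x y = (\<Sum>d\<in>positions m. \<Sum>d'\<in>positions q.
     dias_scale (dias_coord d x * dias_coord d' y) (dias_basis (pcomp i d d')))"
proof -
  have "dias_comp i x y = dias_comp i (\<Sum>d\<in>positions m. dias_scale (dias_coord d x) (dias_basis d))
      (\<Sum>d\<in>positions q. dias_scale (dias_coord d y) (dias_basis d))"
    using Dias_expand[OF assms(1)] Dias_expand[OF assms(2)] by simp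
  also have "\<dots> = (\<Sum>d\<in>positions m. \<Sum>d'\<in>positions q.
      dias_scale (dias_coord d x * dias_coord d' y) (dias_comp i (dias_basis d) (dias_basis d')))"
    unfolding dias_comp_sum_left dias_comp_sum_right dias_comp_scale_left dias_comp_scale_right
      dias.scale_sum_right dias.scale_scale
    by (subst sum.swap) (simp only: mult.commute)
  also have "\<dots> = (\<Sum>d\<in>positions m. \<Sum>d'\<in>positions q.
      dias_scale (dias_coord d x * dias_coord d' y) (dias_basis (pcomp i d d')))"
    using assms(3,4) by (simp add: dias_comp_basis cong: sum.cong)
  finally show ?thesis .
qed

subsection \<open>Linear forms\<close>

text \<open>
  Coordinates are cut off outside \<open>Dias(l)\<close> because that is how \<^const>\<open>dias_dual\<close> represents
  linear forms.
\<close>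

definition dias_form :: "nat \<times> nat \<Rightarrow> 'k::field dias \<Rightarrow> 'k" where
  "dias_form d x = (if x \<in> Dias (fst d) then dias_coord d x else 0)"

lemma dias_form_in_dual: "d \<in> positions l \<Longrightarrow> (dias_form d :: 'k::field dias \<Rightarrow> 'k) \<in> dias_dual l"
  using dias.subspace_add[OF Dias_subspace[of l, where 'k = 'k]]
    dias.subspace_scale[OF Dias_subspace[of l, where 'k = 'k]]
  by (auto simp: dias_dual_def dias_form_def positions_def dias_coord_add dias_coord_scale)

lemma dias_form_basis:
  "d \<in> positions l \<Longrightarrow> d' \<in> positions l \<Longrightarrow> dias_form d (dias_basis d' :: 'k::field dias) = of_bool (d = d')"
  using dias_basis_in_Dias[of d' l, where 'k = 'k] dias_coord_basis[of d' l d]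
  by (auto simp: dias_form_def positions_def)

lemma finite_positions [simp]: "finite (positions l)"
  by (simp add: positions_def)

lemma dias_dual_sum:
  fixes f :: "'k::field dias \<Rightarrow> 'k"
  assumes f: "f \<in> dias_dual l" and "finite A" "\<And>a. a \<in> A \<Longrightarrow> x a \<in> Dias l"
  shows "f (\<Sum>a\<in>A. dias_scale (c a) (x a)) = (\<Sum>a\<in>A. c a * f (x a))"
  using assms(2,3)
proof (induction A rule: finite_induct)
  case empty
  have "f (dias_scale 0 0) = 0 * f 0"
    using f dias.subspace_0[OF Dias_subspace[where 'k = 'k]] unfolding dias_dual_def by blast
  then show ?case by simp
next
  case (insert a A)
  have "(\<Sum>a\<in>A. dias_scale (c a) (x a)) \<in> Dias l"
    using insert by (intro dias.subspace_sum dias.subspace_scale Dias_subspace) auto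
  moreover have "x a \<in> Dias l" "dias_scale (c a) (x a) \<in> Dias l"
    using insert by (auto intro: dias.subspace_scale[OF Dias_subspace])
  ultimately show ?case using insert f by (simp add: dias_dual_def)
qed

lemma dias_dual_expand_at:
  fixes f :: "'k::field dias \<Rightarrow> 'k"
  assumes "f \<in> dias_dual l" "x \<in> Dias l"
  shows "f x = (\<Sum>d\<in>positions l. f (dias_basis d) * dias_form d x)"
proof -
  have "f x = f (\<Sum>d\<in>positions l. dias_scale (dias_coord d x) (dias_basis d))"
    by (subst Dias_expand[OF assms(2)]) simp
  also have "\<dots> = (\<Sum>d\<in>positions l. dias_coord d x * f (dias_basis d))"
    by (rule dias_dual_sum[OF assms(1)]) (auto intro: dias_basis_in_Dias)
  also have "\<dots> = (\<Sum>d\<in>positions l. f (dias_basis d) * dias_form d x)"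
    using assms(2) by (intro sum.cong) (auto simp: dias_form_def positions_def)
  finally show ?thesis .
qed

lemma dias_dual_expand:
  fixes f :: "'k::field dias \<Rightarrow> 'k"
  assumes "f \<in> dias_dual l"
  shows "f = (\<Sum>d\<in>positions l. fscale (f (dias_basis d)) (dias_form d))"
proof
  fix x
  show "f x = (\<Sum>d\<in>positions l. fscale (f (dias_basis d)) (dias_form d)) x"
  proof (cases "x \<in> Dias l")
    case True
    then show ?thesis
      using dias_dual_expand_at[OF assms True] by (simp add: fscale_def sum_fun_apply)
  next
    case False
    then have "f x = 0" "dias_form d x = 0" if "d \<in> positions l" for d
      using assms that by (auto simp: dias_dual_def dias_form_def positions_def)
    then show ?thesis using False assms by (auto simp: fscale_def sum_fun_apply dias_dual_def intro!: sum.neutral)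
  qed
qed

lemma dias_dual_subspace: "fvs.subspace (dias_dual l :: ('k::field dias \<Rightarrow> 'k) set)"
  by (rule fvs.subspaceI) (auto simp: dias_dual_def fscale_def algebra_simps)

lemma dias_dual_eqI:
  fixes f g :: "'k::field dias \<Rightarrow> 'k"
  assumes "f \<in> dias_dual l" "g \<in> dias_dual l" "\<And>d. d \<in> positions l \<Longrightarrow> f (dias_basis d) = g (dias_basis d)"
  shows "f = g"
  by (subst dias_dual_expand[OF assms(1)], subst dias_dual_expand[OF assms(2)]) (simp add: assms(3))

section \<open>The dual bar complex in coordinates\<close>

declare pure_tensor.simps(2) [simp del]

lemma pure_tensor_Leaf2 [simp]: "pure_tensor (Node f ps) Leaf = 0"
  by (simp add: pure_tensor.simps(2))

lemma pure_tensor_Node: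
  "pure_tensor (Node f ps) (Node x xs) =
     (if length xs = length ps then f x * prod_list (map2 pure_tensor ps xs) else 0)"
  by (simp add: pure_tensor.simps(2) prod.list_conv_set_nth lessThan_atLeast0)

text \<open>
  This is the vertex step of \<^const>\<open>pure_tensor\<close> with arbitrary functions in place of the tensors of
  the subtrees.  It is linear in the decoration and in each subtree, which allows one to expand the factors one
  at a time inside a span.
\<close>

definition node_form :: "('d \<Rightarrow> 'k::field) \<Rightarrow> ('d ptree \<Rightarrow> 'k) list \<Rightarrow> 'd ptree \<Rightarrow> 'k" where
  "node_form f gs X = (case X of Leaf \<Rightarrow> 0
     | Node x xs \<Rightarrow> if length xs = length gs then f x * (\<Prod>j<length gs. (gs ! j) (xs ! j)) else 0)"

lemma pure_tensor_node_form: "pure_tensor (Node f ps) = node_form f (map pure_tensor ps)"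
  by (rule ext) (simp add: pure_tensor.simps(2) node_form_def split: ptree.splits)

lemma node_form_update:
  assumes "k < length gs"
  shows "node_form f (gs[k := g]) X = (case X of Leaf \<Rightarrow> 0
     | Node x xs \<Rightarrow> if length xs = length gs
         then f x * (\<Prod>j\<in>{..<length gs} - {k}. (gs ! j) (xs ! j)) * g (xs ! k) else 0)"
proof (cases X)
  case (Node x xs)
  have "(\<Prod>j<length gs. (gs[k := g] ! j) (xs ! j)) = (\<Prod>j\<in>{..<length gs} - {k}. (gs ! j) (xs ! j)) * g (xs ! k)"
    using assms by (subst prod.remove[of _ k]) (auto intro!: prod.cong)
  then show ?thesis by (simp add: node_form_def Node)
qed (simp add: node_form_def)

lemma node_form_span_slot:
  assumes "k < length gs" "g \<in> fvs.span A" "\<And>a. a \<in> A \<Longrightarrow> node_form f (gs[k := a]) \<in> fvs.span C"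
  shows "node_form f (gs[k := g]) \<in> fvs.span C"
proof (rule fvs.span_induct[OF assms(2)])
  show "fvs.subspace {g. node_form f (gs[k := g]) \<in> fvs.span C}"
  proof (rule fvs.subspaceI; clarify)
    have "node_form f (gs[k := 0]) = 0"
      by (rule ext) (simp add: node_form_update[OF assms(1)] split: ptree.splits)
    then show "node_form f (gs[k := 0]) \<in> fvs.span C" by (simp only: fvs.span_zero)
  next
    fix g h assume *: "node_form f (gs[k := g]) \<in> fvs.span C" "node_form f (gs[k := h]) \<in> fvs.span C"
    have "node_form f (gs[k := g + h]) = node_form f (gs[k := g]) + node_form f (gs[k := h])"
      by (rule ext) (simp add: node_form_update[OF assms(1)] algebra_simps split: ptree.splits)
    then show "node_form f (gs[k := g + h]) \<in> fvs.span C" using * by (simp add: fvs.span_add)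
  next
    fix c g assume *: "node_form f (gs[k := g]) \<in> fvs.span C"
    have "node_form f (gs[k := fscale c g]) = fscale c (node_form f (gs[k := g]))"
      by (rule ext) (simp add: node_form_update[OF assms(1)] fscale_def algebra_simps split: ptree.splits)
    then show "node_form f (gs[k := fscale c g]) \<in> fvs.span C" using * by (simp add: fvs.span_scale)
  qed
qed (use assms(3) in auto)

lemma node_form_span_root:
  assumes "f \<in> fvs.span A" "\<And>a. a \<in> A \<Longrightarrow> node_form a gs \<in> fvs.span C"
  shows "node_form f gs \<in> fvs.span C"
proof (rule fvs.span_induct[OF assms(1)])
  show "fvs.subspace {f. node_form f gs \<in> fvs.span C}"
  proof (rule fvs.subspaceI; clarify)
    have "node_form 0 gs = 0"
      by (rule ext) (simp add: node_form_def split: ptree.splits)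
    then show "node_form 0 gs \<in> fvs.span C" by (simp only: fvs.span_zero)
  next
    fix g h assume *: "node_form g gs \<in> fvs.span C" "node_form h gs \<in> fvs.span C"
    have "node_form (g + h) gs = node_form g gs + node_form h gs"
      by (rule ext) (simp add: node_form_def algebra_simps split: ptree.splits)
    then show "node_form (g + h) gs \<in> fvs.span C" using * by (simp add: fvs.span_add)
  next
    fix c g assume *: "node_form g gs \<in> fvs.span C"
    have "node_form (fscale c g) gs = fscale c (node_form g gs)"
      by (rule ext) (simp add: node_form_def fscale_def algebra_simps split: ptree.splits)
    then show "node_form (fscale c g) gs \<in> fvs.span C" using * by (simp add: fvs.span_scale)
  qed
qed (use assms(2) in auto)

text \<open>
  The factors are replaced by generators from left to right: \<open>m\<close> in the induction counts the factors
  that may still be arbitrary elements of the spans.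
\<close>

lemma node_form_span:
  assumes "f \<in> fvs.span A" "\<And>j. j < length gs \<Longrightarrow> gs ! j \<in> fvs.span (S j)"
    and gen: "\<And>a hs. a \<in> A \<Longrightarrow> length hs = length gs \<Longrightarrow> (\<And>j. j < length gs \<Longrightarrow> hs ! j \<in> S j) \<Longrightarrow>
      node_form a hs \<in> fvs.span C"
  shows "node_form f gs \<in> fvs.span C"
proof (rule node_form_span_root[OF assms(1)])
  fix a assume a: "a \<in> A"
  have "\<forall>hs. length hs = length gs \<longrightarrow> (\<forall>j<m. hs ! j \<in> fvs.span (S j)) \<longrightarrow>
      (\<forall>j. m \<le> j \<and> j < length gs \<longrightarrow> hs ! j \<in> S j) \<longrightarrow> node_form a hs \<in> fvs.span C" if "m \<le> length gs" for m
    using that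
  proof (induction m)
    case 0
    then show ?case using gen[OF a] by simp
  next
    case (Suc m)
    show ?case
    proof (intro allI impI)
      fix hs assume hs: "length hs = length gs" "\<forall>j<Suc m. hs ! j \<in> fvs.span (S j)"
        "\<forall>j. Suc m \<le> j \<and> j < length gs \<longrightarrow> hs ! j \<in> S j"
      have "node_form a (hs[m := hs ! m]) \<in> fvs.span C"
      proof (rule node_form_span_slot)
        fix s assume s: "s \<in> S m"
        have "hs[m := s] ! j \<in> S j" if "m \<le> j" "j < length gs" for j
          using that hs s by (cases "j = m") auto
        moreover have "hs[m := s] ! j \<in> fvs.span (S j)" if "j < m" for j
          using that hs by auto
        ultimately show "node_form a (hs[m := s]) \<in> fvs.span C"
          using Suc.IH Suc.prems hs(1) by (metis Suc_leD length_list_update)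
      qed (use hs Suc.prems in auto)
      then show "node_form a hs \<in> fvs.span C" by simp
    qed
  qed
  from this[of "length gs"] show "node_form a gs \<in> fvs.span C" using assms(2) by auto
qed

lemma pure_tensor_support:
  "decorated dias_dual P \<Longrightarrow> pure_tensor P X \<noteq> 0 \<Longrightarrow> decorated Dias X \<and> shape_of X = shape_of P"
proof (induction P arbitrary: X)
  case Leaf
  then show ?case by auto
next
  case (Node f ps)
  then obtain x xs where X: "X = Node x xs" by (cases X) auto
  have len: "length xs = length ps" and ne: "f x \<noteq> 0" "\<forall>j<length ps. pure_tensor (ps ! j) (xs ! j) \<noteq> 0"
    using Node.prems(2) unfolding X by (auto simp: pure_tensor.simps(2) split: if_splits)
  have IH: "decorated Dias (xs ! j) \<and> shape_of (xs ! j) = shape_of (ps ! j)" if "j < length ps" for j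
    using Node.IH[of "ps ! j" "xs ! j"] Node.prems(1) ne that by auto
  have "x \<in> Dias (length xs)" using ne(1) Node.prems(1) len by (auto simp: dias_dual_def)
  moreover have "\<forall>u\<in>set xs. decorated Dias u" using IH len by (auto simp: in_set_conv_nth)
  moreover have "map shape_of xs = map shape_of ps" using IH len by (auto intro: nth_equalityI)
  ultimately show ?case using Node.prems(1) X len by auto
qed

definition tree_basis :: "(nat \<times> nat) ptree \<Rightarrow> 'k::field dias ptree" where
  "tree_basis = map_ptree dias_basis"

definition tree_form :: "(nat \<times> nat) ptree \<Rightarrow> 'k::field bar" where
  "tree_form B = pure_tensor (map_ptree dias_form B)"

lemma decorated_tree_basis: "decorated positions B \<Longrightarrow> decorated Dias (tree_basis B :: 'k::field dias ptree)"
  unfolding tree_basis_def by (erule decorated_map_ptree) (rule dias_basis_in_Dias)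

lemma decorated_tree_form: "decorated positions B \<Longrightarrow> decorated dias_dual (map_ptree (dias_form :: _ \<Rightarrow> 'k::field dias \<Rightarrow> 'k) B)"
  by (erule decorated_map_ptree) (rule dias_form_in_dual)

lemma shape_map_ptree [simp]: "shape_of (map_ptree g B) = shape_of B"
  by (simp add: ptree.map_comp o_def)

lemma shape_tree_basis [simp]: "shape_of (tree_basis B) = shape_of B"
  by (simp add: tree_basis_def)

lemma tree_form_basis:
  "decorated positions B \<Longrightarrow> decorated positions B' \<Longrightarrow> tree_form B (tree_basis B') = (of_bool (B = B') :: 'k::field)"
proof (induction B arbitrary: B')
  case Leaf
  then show ?case by (auto simp: tree_form_def tree_basis_def)
next
  case (Node d ts)
  show ?case
  proof (cases B')
    case (Node d' ts')
    show ?thesis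
    proof (cases "length ts' = length ts")
      case True
      have "tree_form (Node d ts) (tree_basis B') =
          dias_form d (dias_basis d' :: 'k dias) * (\<Prod>j<length ts. tree_form (ts ! j) (tree_basis (ts' ! j)))"
        unfolding tree_form_def tree_basis_def Node using True by (simp add: pure_tensor.simps(2))
      also have "dias_form d (dias_basis d' :: 'k dias) = of_bool (d = d')"
        using Node.prems Node True by (subst dias_form_basis[of d "length ts" d']) auto
      also have "(\<Prod>j<length ts. tree_form (ts ! j) (tree_basis (ts' ! j))) = (\<Prod>j<length ts. of_bool (ts ! j = ts' ! j) :: 'k)"
        using Node.prems Node True by (intro prod.cong Node.IH) auto
      also have "\<dots> = of_bool (\<forall>j<length ts. ts ! j = ts' ! j)"
        by (auto simp: prod_zero_iff)
      also have "(\<forall>j<length ts. ts ! j = ts' ! j) \<longleftrightarrow> ts = ts'"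
        using True by (auto intro: nth_equalityI)
      finally show ?thesis using Node by simp
    next
      case False
      then show ?thesis using Node by (auto simp: tree_form_def tree_basis_def pure_tensor.simps(2))
    qed
  qed (simp add: tree_form_def tree_basis_def)
qed

text \<open>
  The dual bases at the vertices give a basis of the tensor product.
\<close>

lemma pure_tensor_span:
  fixes P :: "('k::field dias \<Rightarrow> 'k) ptree"
  shows "decorated dias_dual P \<Longrightarrow>
   pure_tensor P \<in> fvs.span (tree_form ` {B. decorated positions B \<and> shape_of B = shape_of P} :: 'k bar set)"
proof (induction P)
  case Leaf
  show ?case by (rule fvs.span_base) (auto simp: tree_form_def intro!: image_eqI[of _ _ Leaf])
next
  case (Node f ps)
  let ?l = "length ps"
  let ?S = "\<lambda>j. tree_form ` {B. decorated positions B \<and> shape_of B = shape_of (ps ! j)} :: 'k bar set"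
  show ?case unfolding pure_tensor_node_form
  proof (rule node_form_span[where A = "dias_form ` positions ?l" and S = ?S])
    have "f = (\<Sum>d\<in>positions ?l. fscale (f (dias_basis d)) (dias_form d))"
      using Node.prems by (intro dias_dual_expand) simp
    also have "\<dots> \<in> fvs.span (dias_form ` positions ?l)"
      by (intro fvs.span_sum fvs.span_scale fvs.span_base imageI)
    finally show "f \<in> fvs.span (dias_form ` positions ?l)" .
  next
    fix a :: "'k dias \<Rightarrow> 'k" and hs :: "'k bar list"
    assume a: "a \<in> dias_form ` positions ?l" and "length hs = length (map pure_tensor ps)"
      and "\<And>j. j < length (map pure_tensor ps) \<Longrightarrow> hs ! j \<in> ?S j"
    then have hs: "length hs = ?l" "\<forall>j<?l. \<exists>B. decorated positions B \<and> shape_of B = shape_of (ps ! j) \<and> hs ! j = tree_form B"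
      by auto
    from hs(2) obtain b where b: "\<forall>j<?l. decorated positions (b j) \<and> shape_of (b j) = shape_of (ps ! j) \<and> hs ! j = tree_form (b j)"
      by metis
    obtain d where d: "d \<in> positions ?l" "a = dias_form d" using a by auto
    let ?B = "Node d (map b [0..<?l])"
    have "node_form a hs = tree_form ?B"
      unfolding tree_form_def ptree.map pure_tensor_node_form d(2)
      by (rule arg_cong[of _ _ "node_form _"], rule nth_equalityI) (use hs(1) b in \<open>auto simp: tree_form_def\<close>)
    moreover have "decorated positions ?B" using b d Node.prems by auto
    moreover have "shape_of ?B = shape_of (Node f ps)" using b by (auto intro: nth_equalityI)
    ultimately show "node_form a hs \<in> fvs.span (tree_form ` {B. decorated positions B \<and> shape_of B = shape_of (Node f ps)})"
      by (auto intro!: fvs.span_base)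
  qed (use Node in auto)
qed

subsection \<open>The differential\<close>

lemma contractions_tree_basis:
  "decorated positions B \<Longrightarrow>
   contractions dias_comp (tree_basis B :: 'k::field dias ptree) = map tree_basis (contractions pcomp B)"
  unfolding tree_basis_def by (erule contractions_map_ptree) (rule dias_comp_basis[symmetric])

lemma contractions_not_Leaf: "Leaf \<notin> set (contractions c X)"
  by (cases X) (auto simp: in_contractions_Node)

text \<open>
  Up to sign, this is the component of the differential of a pure tensor at the tree \<open>T\<close>.
\<close>

definition contraction_part :: "shape \<Rightarrow> ('k::field dias \<Rightarrow> 'k) ptree \<Rightarrow> 'k bar" where
  "contraction_part T P X =
     (if decorated Dias X \<and> shape_of X = T then \<Sum>Y\<leftarrow>contractions dias_comp X. pure_tensor P Y else 0)"

lemma sum_list_concat_upt: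
  "(\<Sum>y\<leftarrow>concat (map h [0..<m]). g y) = (\<Sum>j<m. \<Sum>y\<leftarrow>h j. g y :: 'k::field)"
  by (induction m) auto

text \<open>
  The linear form \<open>f\<close> at a vertex, pulled back along a partial composition, is a sum of products of two
  linear forms, by expansion in the dual basis.  So the contraction of a root edge contributes tensors in
  which the root of \<open>P\<close> is split into two vertices, and the contractions inside the \<open>j\<close>-th child
  contribute, by induction, tensors in which this child is replaced.  In both cases the contribution
  vanishes unless the shapes of the remaining children fit.
\<close>

lemma contraction_part_span:
  fixes P :: "('a::field dias \<Rightarrow> 'a) ptree"
  shows "decorated dias_dual P \<Longrightarrow>
   contraction_part T P \<in> fvs.span {pure_tensor Q | Q. decorated dias_dual Q \<and> shape_of Q = T}"
proof (induction P arbitrary: T)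
  case Leaf
  have "contraction_part T Leaf = (0 :: 'a bar)"
  proof
    fix X :: "'a dias ptree"
    have "(\<Sum>Y\<leftarrow>contractions dias_comp X. pure_tensor Leaf Y) = (\<Sum>Y\<leftarrow>contractions dias_comp X. 0 :: 'a)"
      using contractions_not_Leaf[of dias_comp X] by (intro arg_cong[of _ _ sum_list] map_cong) auto
    then show "contraction_part T Leaf X = (0 :: 'a bar) X" by (simp add: contraction_part_def)
  qed
  then show ?case by (simp only: fvs.span_zero)
next
  case (Node f ps)
  let ?C = "\<lambda>T. {pure_tensor Q | Q :: ('a dias \<Rightarrow> 'a) ptree. decorated dias_dual Q \<and> shape_of Q = T}"
  let ?P = "Node f ps"
  have f: "f \<in> dias_dual (length ps)" "2 \<le> length ps" and ps: "\<And>p. p \<in> set ps \<Longrightarrow> decorated dias_dual p"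
    using Node.prems by auto
  show ?case
  proof (cases T)
    case Leaf
    have "contraction_part T ?P = 0" by (rule ext) (auto simp: contraction_part_def Leaf)
    then show ?thesis by (simp only: fvs.span_zero)
  next
    case T: (Node a Ts)
    let ?m = "length Ts"
    let ?ok = "\<lambda>X :: 'a dias ptree. decorated Dias X \<and> shape_of X = T"
    (* R j: the edge from the root to its j-th child; I j: the edges inside this child *)
    define R :: "nat \<Rightarrow> 'a bar" where "R j X = (if ?ok X then (case X of Leaf \<Rightarrow> 0 | Node x xs \<Rightarrow>
        (case xs ! j of Leaf \<Rightarrow> 0
         | Node y ys \<Rightarrow> pure_tensor ?P (Node (dias_comp (Suc j) x y) (take j xs @ ys @ drop (Suc j) xs)))) else 0)" for j X
    define I :: "nat \<Rightarrow> 'a bar" where "I j X = (if ?ok X then (case X of Leaf \<Rightarrow> 0 | Node x xs \<Rightarrow>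
        (\<Sum>s\<leftarrow>contractions dias_comp (xs ! j). pure_tensor ?P (Node x (xs[j := s])))) else 0)" for j X
    have sum: "contraction_part T ?P = (\<Sum>j<?m. R j + I j)"
    proof
      fix X
      show "contraction_part T ?P X = (\<Sum>j<?m. R j + I j) X"
      proof (cases "?ok X")
        case True
        then obtain x xs where X: "X = Node x xs" using T by (cases X) auto
        have m: "?m = length xs" using True X T by auto
        have "contraction_part T ?P X = (\<Sum>j<?m. R j X + I j X)"
          unfolding X contraction_part_def if_P[OF True[unfolded X]] contractions.simps sum_list_concat_upt m
          using True
          by (intro sum.cong refl) (simp add: X R_def I_def o_def split: ptree.splits)
        then show ?thesis by (simp add: sum_fun_apply)
      qed (auto simp: contraction_part_def R_def I_def sum_fun_apply)
    qed
    have I: "I j \<in> fvs.span (?C T)" if j: "j < ?m" for j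
    proof (cases "length ps = ?m \<and> (\<forall>k<?m. k \<noteq> j \<longrightarrow> shape_of (ps ! k) = Ts ! k)")
      case True
      have "I j = node_form f ((map pure_tensor ps)[j := contraction_part (Ts ! j) (ps ! j)])"
      proof
        fix X
        show "I j X = node_form f ((map pure_tensor ps)[j := contraction_part (Ts ! j) (ps ! j)]) X"
        proof (cases "?ok X")
          case ok: True
          then obtain x xs where X: "X = Node x xs" using T by (cases X) auto
          have sh: "map shape_of xs = Ts" using ok X T by auto
          then have m: "?m = length xs" by auto
          have xsj: "decorated Dias (xs ! j)" "shape_of (xs ! j) = Ts ! j" using ok X sh j by auto
          let ?c = "f x * (\<Prod>k\<in>{..<?m} - {j}. pure_tensor (ps ! k) (xs ! k))"
          have "pure_tensor ?P (Node x (xs[j := s])) = ?c * pure_tensor (ps ! j) s" for s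
          proof -
            have "(\<Prod>k<?m. pure_tensor (ps ! k) (xs[j := s] ! k)) =
                (\<Prod>k\<in>{..<?m} - {j}. pure_tensor (ps ! k) (xs ! k)) * pure_tensor (ps ! j) s"
              using j m by (subst prod.remove[of _ j]) (auto intro!: prod.cong)
            then show ?thesis using True m by (simp add: pure_tensor.simps(2))
          qed
          then have "I j X = ?c * contraction_part (Ts ! j) (ps ! j) (xs ! j)"
            using ok xsj by (simp add: I_def X contraction_part_def sum_list_const_mult)
          also have "\<dots> = node_form f ((map pure_tensor ps)[j := contraction_part (Ts ! j) (ps ! j)]) X"
            using True j m by (subst node_form_update) (auto simp: X intro!: prod.cong)
          finally show ?thesis .
        next
          case nok: False
          have "node_form f ((map pure_tensor ps)[j := contraction_part (Ts ! j) (ps ! j)]) X = 0"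
          proof (rule ccontr)
            assume ne: "node_form f ((map pure_tensor ps)[j := contraction_part (Ts ! j) (ps ! j)]) X \<noteq> 0"
            then obtain x xs where X: "X = Node x xs" by (cases X) (auto simp: node_form_def)
            with ne have len: "length xs = ?m" and "f x \<noteq> 0"
              and cp: "contraction_part (Ts ! j) (ps ! j) (xs ! j) \<noteq> 0"
              and nz: "\<forall>k<?m. k \<noteq> j \<longrightarrow> pure_tensor (ps ! k) (xs ! k) \<noteq> 0"
              using True j by (auto simp: node_form_update split: if_splits)
            have *: "decorated Dias (xs ! k) \<and> shape_of (xs ! k) = Ts ! k" if k: "k < ?m" for k
            proof (cases "k = j")
              case True
              then show ?thesis using cp by (auto simp: contraction_part_def split: if_splits)
            next
              case False
              then show ?thesis using nz k True ps[of "ps ! k"] pure_tensor_support[of "ps ! k" "xs ! k"] by auto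
            qed
            then have "map shape_of xs = Ts" using len by (auto intro: nth_equalityI)
            moreover have "\<forall>u\<in>set xs. decorated Dias u" using * len by (auto simp: in_set_conv_nth)
            moreover have "x \<in> Dias (length xs)" using \<open>f x \<noteq> 0\<close> f True len by (auto simp: dias_dual_def)
            ultimately show False using nok X T f True len by auto
          qed
          then show ?thesis using nok by (auto simp: I_def)
        qed
      qed
      also have "\<dots> \<in> fvs.span (?C T)"
      proof (rule node_form_span_slot)
        show "contraction_part (Ts ! j) (ps ! j) \<in> fvs.span (?C (Ts ! j))"
          using Node.IH[of "ps ! j"] ps True j by auto
        fix g assume "g \<in> ?C (Ts ! j)"
        then obtain Q where Q: "g = pure_tensor Q" "decorated dias_dual Q" "shape_of Q = Ts ! j" by auto
        have "node_form f ((map pure_tensor ps)[j := g]) = pure_tensor (Node f (ps[j := Q]))"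
          by (simp add: pure_tensor_node_form map_update Q)
        moreover have "decorated dias_dual (Node f (ps[j := Q]))"
          using f ps Q set_update_subset_insert[of ps j Q] by auto
        moreover have "map shape_of (ps[j := Q]) = Ts"
        proof (rule nth_equalityI)
          fix k assume "k < length (map shape_of (ps[j := Q]))"
          then show "map shape_of (ps[j := Q]) ! k = Ts ! k"
            using True Q by (cases "k = j") auto
        qed (use True in simp)
        then have "shape_of (Node f (ps[j := Q])) = T" by (simp add: T)
        ultimately show "node_form f ((map pure_tensor ps)[j := g]) \<in> fvs.span (?C T)"
          by (auto intro!: fvs.span_base)
      qed (use True j in auto)
      finally show ?thesis .
    next
      case False
      have "I j = 0"
      proof
        fix X
        show "I j X = 0 X"
        proof (cases "?ok X")
          case ok: True
          then obtain x xs where X: "X = Node x xs" using T by (cases X) auto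
          have sh: "map shape_of xs = Ts" using ok X T by auto
          then have m: "?m = length xs" by auto
          have "pure_tensor ?P (Node x (xs[j := s])) = 0" for s
          proof (rule ccontr)
            assume "pure_tensor ?P (Node x (xs[j := s])) \<noteq> 0"
            from pure_tensor_support[OF Node.prems this]
            have *: "map shape_of (xs[j := s]) = map shape_of ps" by (simp del: map_eq_conv)
            then have "length (xs[j := s]) = length ps" by (rule map_eq_imp_length_eq)
            then have "length ps = ?m" using m by simp
            moreover have "shape_of (ps ! k) = Ts ! k" if "k < ?m" "k \<noteq> j" for k
            proof -
              have "map shape_of (xs[j := s]) ! k = map shape_of ps ! k" using * by simp
              then show ?thesis using that \<open>length ps = ?m\<close> m sh by auto
            qed
            ultimately show False using False by auto
          qed
          then show ?thesis by (simp add: I_def X)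
        qed (auto simp: I_def)
      qed
      then show ?thesis by (simp only: fvs.span_zero)
    qed
    have R: "R j \<in> fvs.span (?C T)" if j: "j < ?m" for j
    proof (cases "\<exists>b us. Ts ! j = Node b us \<and> map shape_of ps = take j Ts @ us @ drop (Suc j) Ts \<and> 2 \<le> ?m \<and> 2 \<le> length us")
      case True
      then obtain b us where us: "Ts ! j = Node b us" "map shape_of ps = take j Ts @ us @ drop (Suc j) Ts"
          "2 \<le> ?m" "2 \<le> length us" by blast
      let ?q = "length us"
      (* the children p2 of the root of P move to the new upper vertex *)
      define p1 p2 p3 where p: "p1 = take j ps" "p2 = take ?q (drop j ps)" "p3 = drop ?q (drop j ps)"
      have ps_eq: "ps = p1 @ p2 @ p3" unfolding p by (simp only: append_take_drop_id)
      have lps: "length ps + 1 = ?m + ?q" using arg_cong[OF us(2), of length] j by auto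
      have lp: "length p1 = j" "length p2 = ?q" "length p3 = ?m - Suc j" using lps j by (auto simp: p)
      have shp: "map shape_of p1 = take j Ts" "map shape_of p2 = us" "map shape_of p3 = drop (Suc j) Ts"
        using us(2) lp j unfolding ps_eq by (auto simp: append_eq_append_conv)
      define Q where "Q d d' = Node (dias_form d :: 'a dias \<Rightarrow> 'a) (p1 @ Node (dias_form d') p2 # p3)" for d d'
      have decQ: "decorated dias_dual (Q d d')" if "d \<in> positions ?m" "d' \<in> positions ?q" for d d'
      proof -
        have "Suc (length p1 + length p3) = ?m" using lp j by simp
        moreover have "decorated dias_dual p" if "p \<in> set p1 \<union> set p2 \<union> set p3" for p
          using that ps[of p] unfolding ps_eq by auto
        ultimately show ?thesis
          using that us(3,4) lp(2) by (auto simp: Q_def dias_form_in_dual)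
      qed
      have shQ: "shape_of (Q d d') = T" for d d'
      proof -
        have "take j Ts @ Node () us # drop (Suc j) Ts = Ts" using id_take_nth_drop[OF j] us(1) by simp
        then show ?thesis using shp by (simp add: Q_def T)
      qed
      have "R j = (\<Sum>d\<in>positions ?m. \<Sum>d'\<in>positions ?q.
          fscale (f (dias_basis (pcomp (Suc j) d d'))) (pure_tensor (Q d d')))" (is "_ = ?rhs")
      proof
        fix X
        show "R j X = ?rhs X"
        proof (cases "?ok X")
          case ok: True
          then obtain x xs where X: "X = Node x xs" using T by (cases X) auto
          have sh: "map shape_of xs = Ts" using ok X T by auto
          then have m: "?m = length xs" by auto
          have "shape_of (xs ! j) = Node b us" using sh us j by auto
          then obtain y ys where y: "xs ! j = Node y ys" "map shape_of ys = us" by (cases "xs ! j") auto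
          define x1 x3 where x13: "x1 = take j xs" "x3 = drop (Suc j) xs"
          have xs: "xs = x1 @ Node y ys # x3" using y id_take_nth_drop[of j xs] j m by (simp add: x13)
          have lx: "length x1 = j" "length x3 = ?m - Suc j" "length ys = ?q"
            using j m map_eq_imp_length_eq[of shape_of ys id us] y(2) by (auto simp: x13)
          have "x \<in> Dias (length xs)" "decorated Dias (xs ! j)" using ok X j m by auto
          then have xy: "x \<in> Dias ?m" "y \<in> Dias ?q" unfolding m y(1) using lx(3) by simp_all
          have fz: "f (dias_comp (Suc j) x y) =
             (\<Sum>d\<in>positions ?m. \<Sum>d'\<in>positions ?q. dias_form d x * dias_form d' y * f (dias_basis (pcomp (Suc j) d d')))"
          proof -
            have "f (dias_comp (Suc j) x y) = f (\<Sum>(d, d')\<in>positions ?m \<times> positions ?q.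
               dias_scale (dias_coord d x * dias_coord d' y) (dias_basis (pcomp (Suc j) d d')))"
              using xy j by (subst dias_comp_expand[of x ?m y ?q]) (auto simp: sum.cartesian_product)
            also have "\<dots> = (\<Sum>(d, d')\<in>positions ?m \<times> positions ?q.
               dias_coord d x * dias_coord d' y * f (dias_basis (pcomp (Suc j) d d')))"
              unfolding case_prod_beta
            proof (rule dias_dual_sum[OF f(1)])
              fix z assume z: "z \<in> positions ?m \<times> positions ?q"
              have "pcomp (Suc j) (fst z) (snd z) \<in> positions (?m + ?q - 1)"
                using z us(3,4) j by (intro positions_pcomp) auto
              moreover have "?m + ?q - 1 = length ps" using lps by simp
              ultimately show "dias_basis (pcomp (Suc j) (fst z) (snd z)) \<in> Dias (length ps)"
                by (simp add: dias_basis_in_Dias)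
            qed simp
            also have "\<dots> = (\<Sum>d\<in>positions ?m. \<Sum>d'\<in>positions ?q.
               dias_form d x * dias_form d' y * f (dias_basis (pcomp (Suc j) d d')))"
              unfolding sum.cartesian_product[symmetric]
              using xy by (intro sum.cong refl) (auto simp: dias_form_def positions_def)
            finally show ?thesis .
          qed
          let ?r = "prod_list (map2 pure_tensor p1 x1) * prod_list (map2 pure_tensor p2 ys) * prod_list (map2 pure_tensor p3 x3)"
          have "R j X = pure_tensor ?P (Node (dias_comp (Suc j) x y) (x1 @ ys @ x3))"
            using ok y by (simp add: R_def X x13)
          also have "\<dots> = f (dias_comp (Suc j) x y) * ?r"
            using lx lp by (simp add: pure_tensor_Node ps_eq mult_ac)
          also have "\<dots> = (\<Sum>d\<in>positions ?m. \<Sum>d'\<in>positions ?q.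
              f (dias_basis (pcomp (Suc j) d d')) * pure_tensor (Q d d') X)"
            unfolding fz sum_distrib_right
            using lx lp by (intro sum.cong refl) (simp add: Q_def X xs pure_tensor_Node mult_ac)
          finally show ?thesis by (simp add: sum_fun_apply fscale_def)
        next
          case nok: False
          have "pure_tensor (Q d d') X = 0" if "d \<in> positions ?m" "d' \<in> positions ?q" for d d'
            using pure_tensor_support[OF decQ[OF that], of X] shQ nok by auto
          then show ?thesis using nok by (auto simp: R_def sum_fun_apply fscale_def)
        qed
      qed
      also have "\<dots> \<in> fvs.span (?C T)"
        using decQ shQ by (intro fvs.span_sum fvs.span_scale fvs.span_base) auto
      finally show ?thesis .
    next
      case False
      have "R j = 0"
      proof
        fix X
        show "R j X = 0 X"
        proof (cases "?ok X")
          case ok: True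
          then obtain x xs where X: "X = Node x xs" using T by (cases X) auto
          have sh: "map shape_of xs = Ts" using ok X T by auto
          then have m: "?m = length xs" by auto
          show ?thesis
          proof (cases "xs ! j")
            case (Node y ys)
            have "pure_tensor ?P (Node (dias_comp (Suc j) x y) (take j xs @ ys @ drop (Suc j) xs)) = 0"
            proof (rule ccontr)
              assume "pure_tensor ?P (Node (dias_comp (Suc j) x y) (take j xs @ ys @ drop (Suc j) xs)) \<noteq> 0"
              from pure_tensor_support[OF Node.prems this]
              have "map shape_of ps = map shape_of (take j xs @ ys @ drop (Suc j) xs)"
                by (simp del: map_eq_conv)
              then have "map shape_of ps = take j Ts @ map shape_of ys @ drop (Suc j) Ts"
                by (simp add: take_map drop_map flip: sh)
              moreover have "Ts ! j = Node () (map shape_of ys)" using Node sh j m by auto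
              moreover have "2 \<le> ?m" "2 \<le> length (map shape_of ys)"
              proof -
                have "decorated Dias (xs ! j)" using ok X j m by auto
                then show "2 \<le> length (map shape_of ys)" using Node by simp
              qed (use ok X m in auto)
              ultimately show False using False by blast
            qed
            then show ?thesis by (simp add: R_def X Node)
          qed (simp add: R_def X)
        qed (auto simp: R_def)
      qed
      then show ?thesis by (simp only: fvs.span_zero)
    qed
    show ?thesis unfolding sum by (intro fvs.span_sum fvs.span_add R I) auto
  qed
qed

lemma tree_form_in_bar_cmp:
  assumes "B \<in> pointed_trees n" "int (vertices B) = int n + j - 1"
  shows "(tree_form B :: 'k::field bar) \<in> bar_cmp n j"
  unfolding bar_cmp_def tree_form_def
proof (rule fvs.span_base, rule CollectI, intro exI conjI)
  show "decorated dias_dual (map_ptree dias_form B :: ('k dias \<Rightarrow> 'k) ptree)"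
    using assms(1) by (intro decorated_tree_form) (simp add: pointed_trees_def)
qed (use assms in \<open>auto simp: pointed_trees_def\<close>)

lemma shape_of_leaves: "shape_of B = shape_of P \<Longrightarrow> leaves B = leaves P"
  using leaves_map_ptree[of "\<lambda>_. ()" B] leaves_map_ptree[of "\<lambda>_. ()" P] by simp

lemma shape_of_vertices: "shape_of B = shape_of P \<Longrightarrow> vertices B = vertices P"
  using vertices_map_ptree[of "\<lambda>_. ()" B] vertices_map_ptree[of "\<lambda>_. ()" P] by simp

text \<open>
  The coefficients are values at the dual trees since \<^const>\<open>tree_form\<close> and \<^const>\<open>tree_basis\<close> are
  dual to each other.
\<close>

lemma bar_cmp_expand:
  fixes F :: "'k::field bar"
  assumes "F \<in> bar_cmp n j"
  shows "F = (\<Sum>B\<in>pointed_trees n. fscale (F (tree_basis B)) (tree_form B))"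
    and "B \<in> pointed_trees n \<Longrightarrow> F (tree_basis B) \<noteq> 0 \<Longrightarrow> int (vertices B) = int n + j - 1"
proof -
  let ?G = "tree_form ` {B \<in> pointed_trees n. int (vertices B) = int n + j - 1} :: 'k bar set"
  have "F \<in> fvs.span ?G"
  proof -
    have "pure_tensor P \<in> fvs.span ?G" if "decorated dias_dual P" "leaves P = n" "int (vertices P) = int n + j - 1"
      for P :: "('k dias \<Rightarrow> 'k) ptree"
    proof -
      have "{B. decorated positions B \<and> shape_of B = shape_of P} \<subseteq> {B \<in> pointed_trees n. int (vertices B) = int n + j - 1}"
        using that by (auto simp: pointed_trees_def dest: shape_of_leaves shape_of_vertices)
      then show ?thesis using pure_tensor_span[OF that(1)] fvs.span_mono image_mono by (metis (no_types, lifting) subsetD)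
    qed
    then have "bar_cmp n j \<subseteq> fvs.span ?G"
      unfolding bar_cmp_def by (intro fvs.span_minimal fvs.subspace_span) auto
    then show ?thesis using assms by auto
  qed
  then have "F = (\<Sum>B\<in>pointed_trees n. fscale (F (tree_basis B)) (tree_form B)) \<and>
      (\<forall>B\<in>pointed_trees n. F (tree_basis B) \<noteq> 0 \<longrightarrow> int (vertices B) = int n + j - 1)"
  proof (rule fvs.span_induct)
    show "fvs.subspace {F :: 'k bar. F = (\<Sum>B\<in>pointed_trees n. fscale (F (tree_basis B)) (tree_form B)) \<and>
      (\<forall>B\<in>pointed_trees n. F (tree_basis B) \<noteq> 0 \<longrightarrow> int (vertices B) = int n + j - 1)}" (is "fvs.subspace ?S")
    proof (rule fvs.subspaceI)
      show "0 \<in> ?S" by simp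
    next
      fix F G assume "F \<in> ?S" "G \<in> ?S"
      then have *: "F = (\<Sum>B\<in>pointed_trees n. fscale (F (tree_basis B)) (tree_form B))"
        "G = (\<Sum>B\<in>pointed_trees n. fscale (G (tree_basis B)) (tree_form B))"
        and v: "\<forall>B\<in>pointed_trees n. F (tree_basis B) \<noteq> 0 \<longrightarrow> int (vertices B) = int n + j - 1"
        "\<forall>B\<in>pointed_trees n. G (tree_basis B) \<noteq> 0 \<longrightarrow> int (vertices B) = int n + j - 1" by blast+
      have "F + G = (\<Sum>B\<in>pointed_trees n. fscale ((F + G) (tree_basis B)) (tree_form B))"
        using * by (simp add: fvs.scale_left_distrib sum.distrib)
      moreover have "\<forall>B\<in>pointed_trees n. (F + G) (tree_basis B) \<noteq> 0 \<longrightarrow> int (vertices B) = int n + j - 1"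
        using v by (metis add.right_neutral plus_fun_apply)
      ultimately show "F + G \<in> ?S" by blast
    next
      fix c F assume "F \<in> ?S"
      then have *: "F = (\<Sum>B\<in>pointed_trees n. fscale (F (tree_basis B)) (tree_form B))"
        and v: "\<forall>B\<in>pointed_trees n. F (tree_basis B) \<noteq> 0 \<longrightarrow> int (vertices B) = int n + j - 1"
        by blast+
      have "fscale c F = fscale c (\<Sum>B\<in>pointed_trees n. fscale (F (tree_basis B)) (tree_form B))"
        using * by (rule arg_cong)
      also have "\<dots> = (\<Sum>B\<in>pointed_trees n. fscale (fscale c F (tree_basis B)) (tree_form B))"
        unfolding fvs.scale_sum_right fvs.scale_scale by (simp add: fscale_def)
      finally have "fscale c F = (\<Sum>B\<in>pointed_trees n. fscale (fscale c F (tree_basis B)) (tree_form B))" .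
      moreover have "\<forall>B\<in>pointed_trees n. (fscale c F) (tree_basis B) \<noteq> 0 \<longrightarrow> int (vertices B) = int n + j - 1"
        using v by (simp add: fscale_def)
      ultimately show "fscale c F \<in> ?S" by blast
    qed
  next
    fix G assume "G \<in> ?G"
    then obtain B where B: "G = tree_form B" "B \<in> pointed_trees n" "int (vertices B) = int n + j - 1" by auto
    have e: "G (tree_basis B') = of_bool (B = B')" if "B' \<in> pointed_trees n" for B'
      using that B by (simp add: tree_form_basis pointed_trees_def)
    have "(\<Sum>B'\<in>pointed_trees n. fscale (G (tree_basis B')) (tree_form B')) =
        (\<Sum>B'\<in>pointed_trees n. if B' = B then tree_form B else 0 :: 'k bar)"
      by (intro sum.cong refl) (auto simp: e)
    also have "\<dots> = G" using B by simp
    finally show "G = (\<Sum>B\<in>pointed_trees n. fscale (G (tree_basis B)) (tree_form B)) \<and>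
      (\<forall>B\<in>pointed_trees n. G (tree_basis B) \<noteq> 0 \<longrightarrow> int (vertices B) = int n + j - 1)"
      using B e by auto
  qed
  then show "F = (\<Sum>B\<in>pointed_trees n. fscale (F (tree_basis B)) (tree_form B))"
    and "B \<in> pointed_trees n \<Longrightarrow> F (tree_basis B) \<noteq> 0 \<Longrightarrow> int (vertices B) = int n + j - 1" by blast+
qed

lemma bar_cmp_eqI:
  fixes F G :: "'k::field bar"
  assumes "F \<in> bar_cmp n j" "G \<in> bar_cmp n j'" "\<And>B. B \<in> pointed_trees n \<Longrightarrow> F (tree_basis B) = G (tree_basis B)"
  shows "F = G"
  by (subst bar_cmp_expand(1)[OF assms(1)], subst bar_cmp_expand(1)[OF assms(2)]) (simp add: assms(3))

lemma bar_cmp_subspace: "fvs.subspace (bar_cmp n j)"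
  unfolding bar_cmp_def by (rule fvs.subspace_span)

definition bar_of_coeffs :: "nat \<Rightarrow> ((nat \<times> nat) ptree \<Rightarrow> 'k::field) \<Rightarrow> 'k bar" where
  "bar_of_coeffs n c = (\<Sum>B\<in>pointed_trees n. fscale (c B) (tree_form B))"

lemma bar_of_coeffs_in:
  assumes "\<And>B. B \<in> pointed_trees n \<Longrightarrow> c B \<noteq> 0 \<Longrightarrow> int (vertices B) = int n + j - 1"
  shows "bar_of_coeffs n c \<in> bar_cmp n j"
  unfolding bar_of_coeffs_def
proof (rule fvs.subspace_sum[OF bar_cmp_subspace])
  fix B assume B: "B \<in> pointed_trees n"
  show "fscale (c B) (tree_form B) \<in> bar_cmp n j"
  proof (cases "c B = 0")
    case True
    then show ?thesis using fvs.subspace_0[OF bar_cmp_subspace] by (simp only: fvs.scale_zero_left)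
  next
    case False
    then show ?thesis using assms B by (intro fvs.subspace_scale[OF bar_cmp_subspace] tree_form_in_bar_cmp) auto
  qed
qed

lemma bar_of_coeffs_apply:
  assumes "B \<in> pointed_trees n"
  shows "bar_of_coeffs n c (tree_basis B) = (c B :: 'k::field)"
proof -
  have "bar_of_coeffs n c (tree_basis B) = (\<Sum>B'\<in>pointed_trees n. if B' = B then c B else 0)"
    unfolding bar_of_coeffs_def sum_fun_apply fscale_def
    by (intro sum.cong refl) (use assms in \<open>auto simp: tree_form_basis pointed_trees_def\<close>)
  then show ?thesis using assms by simp
qed

lemma bar_of_coeffs_add: "bar_of_coeffs n (\<lambda>B. c B + d B) = bar_of_coeffs n c + bar_of_coeffs n d"
  unfolding bar_of_coeffs_def by (simp add: fvs.scale_left_distrib sum.distrib)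

lemma bar_of_coeffs_scale: "bar_of_coeffs n (\<lambda>B. a * c B) = fscale a (bar_of_coeffs n c)"
  unfolding bar_of_coeffs_def by (simp add: fvs.scale_sum_right)

lemma bar_dif_add: "bar_dif \<epsilon> (F + G) = bar_dif \<epsilon> F + bar_dif \<epsilon> G"
  by (rule ext) (auto simp: bar_dif_def algebra_simps sum_list_addf)

lemma bar_dif_scale: "bar_dif \<epsilon> (fscale c F) = fscale c (bar_dif \<epsilon> F)"
  by (rule ext) (auto simp: bar_dif_def fscale_def algebra_simps sum_list_const_mult[symmetric])

lemma bar_dif_zero: "bar_dif \<epsilon> 0 = 0"
  by (rule ext) (auto simp: bar_dif_def)

text \<open>
  The sign depends only on the two shapes, so the differential of a pure tensor is a signed sum of
  its components at the finitely many shapes with one more vertex.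
\<close>

lemma bar_dif_in_bar_cmp:
  fixes F :: "'k::field bar"
  assumes "F \<in> bar_cmp n j"
  shows "bar_dif \<epsilon> F \<in> bar_cmp n (j + 1)"
  using assms unfolding bar_cmp_def[of n j]
proof (rule fvs.span_induct)
  show "fvs.subspace {F. bar_dif \<epsilon> F \<in> bar_cmp n (j + 1)}"
    by (rule fvs.subspaceI) (auto simp only: mem_Collect_eq bar_dif_add bar_dif_scale bar_dif_zero
      intro: fvs.subspace_0 fvs.subspace_add fvs.subspace_scale bar_cmp_subspace)
next
  fix F :: "'k bar"
  assume "F \<in> {pure_tensor P |P. decorated dias_dual P \<and> leaves P = n \<and> int (vertices P) = int n + j - 1}"
  then obtain P :: "('k dias \<Rightarrow> 'k) ptree" where P: "F = pure_tensor P" "decorated dias_dual P" "leaves P = n"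
    "int (vertices P) = int n + j - 1" by auto
  let ?S = "{T \<in> shapes n. vertices T = Suc (vertices P)}"
  have fin: "finite ?S" by simp
  have "bar_dif \<epsilon> F = (\<Sum>T\<in>?S. fscale (of_int (\<epsilon> (shape_of P) T)) (contraction_part T P))"
  proof
    fix X
    show "bar_dif \<epsilon> F X = (\<Sum>T\<in>?S. fscale (of_int (\<epsilon> (shape_of P) T)) (contraction_part T P)) X"
    proof (cases "decorated Dias X")
      case True
      have "of_int (\<epsilon> (shape_of Y) (shape_of X)) * pure_tensor P Y = of_int (\<epsilon> (shape_of P) (shape_of X)) * pure_tensor P Y" for Y
        using pure_tensor_support[OF P(2), of Y] by (cases "pure_tensor P Y = 0") auto
      then have eq: "bar_dif \<epsilon> F X = of_int (\<epsilon> (shape_of P) (shape_of X)) * contraction_part (shape_of X) P X"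
        using True by (simp only: bar_dif_def P(1) contraction_part_def if_True simp_thms sum_list_const_mult)
      show ?thesis
      proof (cases "shape_of X \<in> ?S")
        case S: True
        have "(\<Sum>T\<in>?S. fscale (of_int (\<epsilon> (shape_of P) T)) (contraction_part T P)) X =
          (\<Sum>T\<in>?S. if T = shape_of X then of_int (\<epsilon> (shape_of P) (shape_of X)) * contraction_part (shape_of X) P X else 0)"
          unfolding sum_fun_apply fscale_def by (intro sum.cong refl) (auto simp: contraction_part_def)
        then show ?thesis using eq S fin by simp
      next
        case False
        have "pure_tensor P Y = 0" if Y: "Y \<in> set (contractions dias_comp X)" for Y
        proof (rule ccontr)
          assume "pure_tensor P Y \<noteq> 0"
          then have sh: "shape_of Y = shape_of P" using pure_tensor_support[OF P(2)] by auto
          have "leaves X = n" "vertices X = Suc (vertices P)"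
            using contractions_leaves[OF Y] contractions_vertices[OF Y] shape_of_leaves[OF sh] shape_of_vertices[OF sh] P by auto
          then show False using False decorated_shape[OF True] by (auto simp: shapes_def)
        qed
        then have "contraction_part (shape_of X) P X = 0"
          unfolding contraction_part_def by (auto intro!: sum_list_0 simp: sum_list_nonneg_eq_0_iff cong: map_cong)
        moreover have "(\<Sum>T\<in>?S. fscale (of_int (\<epsilon> (shape_of P) T)) (contraction_part T P)) X = 0"
          unfolding sum_fun_apply fscale_def by (intro sum.neutral) (use False in \<open>auto simp: contraction_part_def\<close>)
        ultimately show ?thesis using eq by simp
      qed
    qed (simp add: bar_dif_def sum_fun_apply fscale_def contraction_part_def)
  qed
  also have "\<dots> \<in> bar_cmp n (j + 1)"
  proof (intro fvs.subspace_sum fvs.subspace_scale bar_cmp_subspace)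
    fix T assume T: "T \<in> ?S"
    have "{pure_tensor Q | Q. decorated dias_dual Q \<and> shape_of Q = T} \<subseteq>
      ({pure_tensor P |P. decorated dias_dual P \<and> leaves P = n \<and> int (vertices P) = int n + (j + 1) - 1} :: 'k bar set)"
    proof clarify
      fix Q :: "('k dias \<Rightarrow> 'k) ptree" assume Q: "decorated dias_dual Q" "T = shape_of Q"
      then have "leaves Q = n" "vertices Q = Suc (vertices P)" using T by (auto simp: shapes_def)
      then show "\<exists>P. pure_tensor Q = pure_tensor P \<and> decorated dias_dual P \<and> leaves P = n \<and> int (vertices P) = int n + (j + 1) - 1"
        using Q P(4) by (intro exI[of _ Q]) auto
    qed
    then show "contraction_part T P \<in> bar_cmp n (j + 1)"
      unfolding bar_cmp_def using contraction_part_span[OF P(2), of T] fvs.span_mono by (metis (no_types, lifting) subsetD)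
  qed
  finally show "bar_dif \<epsilon> F \<in> bar_cmp n (j + 1)" .
qed

lemma bar_dif_tree_basis:
  fixes F :: "'k::field bar"
  assumes "decorated positions B"
  shows "bar_dif \<epsilon> F (tree_basis B) =
    (\<Sum>B'\<leftarrow>contractions pcomp B. of_int (\<epsilon> (shape_of B') (shape_of B)) * F (tree_basis B'))"
  unfolding bar_dif_def contractions_tree_basis[OF assms]
  using decorated_tree_basis[OF assms, where 'k = 'k] by (simp add: o_def)

section \<open>The labels\<close>

text \<open>
  The labels are defined recursively as solutions of linear equations.  That the dual basis solves
  them is checked in coordinates: both sides are determined by their values at trees decorated by basis
  elements.
\<close>

lemma redecorate_shape [simp]: "shape_of (redecorate g t) = shape_of t"
  by (induction t) auto

lemma redecorate_leaves [simp]: "leaves (redecorate g t) = leaves t"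
  by (rule shape_of_leaves) simp

lemma redecorate_vertices [simp]: "vertices (redecorate g t) = vertices t"
  by (rule shape_of_vertices) simp

lemma redecorate_cong:
  "decorated A t \<Longrightarrow> (\<And>l a. 2 \<le> l \<Longrightarrow> a \<in> A l \<Longrightarrow> g l a = g' l a) \<Longrightarrow> redecorate g t = redecorate g' t"
  by (induction t) auto

lemma decorated_redecorate:
  "decorated A t \<Longrightarrow> (\<And>l a. 2 \<le> l \<Longrightarrow> a \<in> A l \<Longrightarrow> g l a \<in> A' l) \<Longrightarrow> decorated A' (redecorate g t)"
  by (induction t) auto

lemma map_redecorate: "map_ptree h (redecorate g t) = redecorate (\<lambda>l a. h (g l a)) t"
  by (induction t) auto

text \<open>
  This removes the minimum from the definition: the \<open>i\<close>-th leaf above the child \<open>t\<close> enters the root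
  through the edge after those of \<open>us\<close>.
\<close>

lemma labelling_Node:
  assumes "1 \<le> i" "i \<le> leaves t"
  shows "labelling (sum_list (map leaves us) + i) (Node a (us @ t # ws)) =
    Node (Some (Suc (length us)))
      (map (map_ptree (\<lambda>_. None)) us @ labelling i t # map (map_ptree (\<lambda>_. None)) ws)"
proof -
  let ?i = "sum_list (map leaves us) + i" and ?ts = "us @ t # ws"
  have r: "(LEAST r. ?i \<le> sum_list (map leaves (take r ?ts))) = Suc (length us)"
  proof (rule Least_equality)
    fix y assume y: "?i \<le> sum_list (map leaves (take y ?ts))"
    show "Suc (length us) \<le> y"
    proof (rule ccontr)
      assume "\<not> Suc (length us) \<le> y"
      then have "take y ?ts = take y us" by simp
      moreover have "sum_list (map leaves (take y us)) \<le> sum_list (map leaves us)"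
        by (metis append_take_drop_id le_add1 map_append sum_list_append)
      ultimately show False using y assms by simp
    qed
  qed (use assms in simp)
  have "map (\<lambda>j. if Suc j = Suc (length us) then labelling (?i - sum_list (map leaves (take j ?ts))) (?ts ! j)
                      else map_ptree (\<lambda>_. None) (?ts ! j)) [0..<length ?ts] =
    map (map_ptree (\<lambda>_. None)) us @ labelling i t # map (map_ptree (\<lambda>_. None)) ws" (is "?l = ?r")
  proof (rule nth_equalityI)
    fix k assume "k < length ?l"
    then have "k < length ?ts" by simp
    then consider "k < length us" | "k = length us" | k' where "k = Suc (length us + k')" "k' < length ws"
      using less_imp_Suc_add[of "length us" k] by (auto simp: not_less_iff_gr_or_eq) (metis linorder_neqE_nat)
    then show "?l ! k = ?r ! k"
      using \<open>k < length ?ts\<close> by cases (simp_all add: nth_append del: upt_Suc)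
  qed simp
  then show ?thesis by (simp only: labelling.simps r Let_def)
qed

declare labelling.simps(2) [simp del]

lemma shape_labelling:
  "1 \<le> i \<Longrightarrow> i \<le> leaves T \<Longrightarrow> shape_of (labelling i T) = T"
proof (induction T arbitrary: i)
  case (Node a ts)
  have u: "map_ptree (\<lambda>_. ()) x = x" for x :: shape by (rule ptree.map_ident_strong) auto
  obtain us t ws i' where ts: "ts = us @ t # ws" "i = sum_list (map leaves us) + i'" "1 \<le> i'" "i' \<le> leaves t"
    using locate_leaf[of i ts] Node.prems by (metis leaves.simps(2))
  show ?case unfolding ts(1,2) labelling_Node[OF ts(3,4)]
    using Node.IH[of t i'] ts by (simp add: o_def u)
qed auto

lemma decorated_labelling:
  "\<lbrakk>decorated A (T :: shape); 1 \<le> i; i \<le> leaves T; \<And>w. A w \<noteq> {} \<Longrightarrow> None \<in> A' w \<and> Some ` {1..w} \<subseteq> A' w\<rbrakk>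
   \<Longrightarrow> decorated A' (labelling i T)"
proof (induction T arbitrary: i)
  case (Node a ts)
  obtain us t ws i' where ts: "ts = us @ t # ws" "i = sum_list (map leaves us) + i'" "1 \<le> i'" "i' \<le> leaves t"
    using locate_leaf[of i ts] Node.prems by (metis leaves.simps(2))
  have "decorated A' (map_ptree (\<lambda>_. None) u)" if "u \<in> set ts" for u
    using Node.prems(1,4) that by (intro decorated_map_ptree[of A u]) auto
  moreover have "decorated A' (labelling i' t)"
    using Node.IH[of t i'] Node.prems(1,4) ts by auto
  moreover have "Some (Suc (length us)) \<in> A' (length ts)"
  proof -
    have "Suc (length us) \<in> {1..length ts}" "A (length ts) \<noteq> {}" using Node.prems(1) ts by auto
    then show ?thesis using Node.prems(4) by blast
  qed
  ultimately show ?case unfolding ts(1,2) labelling_Node[OF ts(3,4)]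
    using Node.prems(1) ts by auto
qed auto

abbreviation basis_label :: "nat \<Rightarrow> nat option \<Rightarrow> 'k::field dias \<Rightarrow> 'k" where
  "basis_label \<equiv> interpret_label (\<lambda>l r. dias_form (l, r))"

lemma basis_label_in_dual:
  "s \<in> insert None (Some ` {1..l}) \<Longrightarrow> (basis_label l s :: 'k::field dias \<Rightarrow> 'k) \<in> dias_dual l"
  by (auto simp: interpret_label_def positions_def
      intro!: dias_form_in_dual fvs.subspace_sum[OF dias_dual_subspace])

lemma basis_label_basis:
  assumes "(l, r) \<in> positions l"
  shows "basis_label l None (dias_basis (l, r) :: 'k::field dias) = 1"
    "r' \<in> {1..l} \<Longrightarrow> basis_label l (Some r') (dias_basis (l, r) :: 'k dias) = of_bool (r' = r)"
proof -
  have e: "dias_form (l, r') (dias_basis (l, r) :: 'k dias) = of_bool (r' = r)" if "r' \<in> {1..l}" for r'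
    using that assms by (subst dias_form_basis[of _ l]) (auto simp: positions_def)
  then show "r' \<in> {1..l} \<Longrightarrow> basis_label l (Some r') (dias_basis (l, r) :: 'k dias) = of_bool (r' = r)"
    by (simp add: interpret_label_def)
  have "basis_label l None (dias_basis (l, r) :: 'k dias) = (\<Sum>r'=1..l. of_bool (r' = r))"
    unfolding interpret_label_def by (simp add: sum_fun_apply e del: sum_of_bool_eq)
  also have "\<dots> = 1" using assms by (auto simp: positions_def of_bool_def)
  finally show "basis_label l None (dias_basis (l, r) :: 'k dias) = 1" .
qed

lemma prod_list_of_bool_shapes:
  assumes "length us = length vs" "\<And>u v. u \<in> set us \<Longrightarrow> v \<in> set vs \<Longrightarrow> h u v = (of_bool (k v = u) :: 'k::field)"
  shows "prod_list (map2 h us vs) = of_bool (map k vs = us)"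
  using assms by (induction us vs rule: list_induct2) auto

lemma unlabelled_tree_basis:
  "decorated (\<lambda>_. UNIV) (T :: shape) \<Longrightarrow> decorated positions B \<Longrightarrow>
   pure_tensor (redecorate basis_label (map_ptree (\<lambda>_. None) T)) (tree_basis B :: 'k::field dias ptree) =
     of_bool (shape_of B = T)"
proof (induction T arbitrary: B)
  case Leaf
  then show ?case by (cases B) (auto simp: tree_basis_def)
next
  case (Node a ts)
  show ?case
  proof (cases B)
    case (Node d bs)
    show ?thesis
    proof (cases "length bs = length ts")
      case True
      obtain r where d: "d = (length ts, r)" "(length ts, r) \<in> positions (length ts)"
        using Node.prems(2) Node True by (auto simp: positions_def)
      have "pure_tensor (redecorate basis_label (map_ptree (\<lambda>_. None) (Node a ts))) (tree_basis B :: 'k dias ptree) =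
        basis_label (length ts) None (dias_basis d) *
        prod_list (map2 (\<lambda>t b. pure_tensor (redecorate basis_label (map_ptree (\<lambda>_. None) t)) (tree_basis b)) ts bs)"
        using True by (simp add: Node tree_basis_def pure_tensor_Node zip_map_map o_def case_prod_unfold)
      also have "\<dots> = of_bool (map shape_of bs = ts)"
      proof -
        have "prod_list (map2 (\<lambda>t b. pure_tensor (redecorate basis_label (map_ptree (\<lambda>_. None) t)) (tree_basis b :: 'k dias ptree)) ts bs)
            = of_bool (map shape_of bs = ts)"
        proof (rule prod_list_of_bool_shapes)
          fix u v assume "u \<in> set ts" "v \<in> set bs"
          then show "pure_tensor (redecorate basis_label (map_ptree (\<lambda>_. None) u)) (tree_basis v :: 'k dias ptree) =
              of_bool (shape_of v = u)"
            using Node.prems Node by (intro Node.IH) auto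
        qed (use True in simp)
        then show ?thesis by (simp only: basis_label_basis(1)[OF d(2)] d(1)) simp
      qed
      finally show ?thesis using Node by simp
    next
      case False
      then show ?thesis using Node by (auto simp: tree_basis_def pure_tensor_Node)
    qed
  qed (simp add: tree_basis_def)
qed

text \<open>
  The tensor of the \<open>i\<close>-th labelling is the sum of all labelled trees with the given shape and
  tip \<open>i\<close>: labels on the path force the tip, and a \<open>*\<close> evaluates to \<open>1\<close> on each basis element.
\<close>

lemma labelling_tree_basis:
  "decorated (\<lambda>_. UNIV) (T :: shape) \<Longrightarrow> 1 \<le> i \<Longrightarrow> i \<le> leaves T \<Longrightarrow> decorated positions B \<Longrightarrow>
   pure_tensor (redecorate basis_label (labelling i T)) (tree_basis B :: 'k::field dias ptree) =
     of_bool (shape_of B = T \<and> tip B = i)"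
proof (induction T arbitrary: B i)
  case Leaf
  then show ?case by (cases B) (auto simp: tree_basis_def)
next
  case (Node a ts)
  obtain us t ws i' where ts: "ts = us @ t # ws" "i = sum_list (map leaves us) + i'" "1 \<le> i'" "i' \<le> leaves t"
    using locate_leaf[of i ts] Node.prems by (metis leaves.simps(2))
  show ?case
  proof (cases B)
    case (Node d bs)
    let ?f = "\<lambda>t b. pure_tensor (redecorate basis_label (map_ptree (\<lambda>_. None) t)) (tree_basis b :: 'k dias ptree)"
    let ?lhs = "pure_tensor (redecorate basis_label (labelling i (Node a ts))) (tree_basis B :: 'k dias ptree)"
    from Node.prems(4)[unfolded Node] show ?thesis
    proof (cases rule: pointed_NodeE)
      case (1 us2 t2 ws2)
      note tb = tip_bounds[OF 1(3)]
      (* wrong arity of the root; path through another child; path through the right child *)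
      consider "length bs \<noteq> length ts" | "length bs = length ts" "length us2 \<noteq> length us"
        | "length us2 = length us" "length ws2 = length ws" using ts 1 by fastforce
      then show ?thesis
      proof cases
        case a: 1
        then have "map shape_of bs \<noteq> ts" by auto
        moreover have "?lhs = 0" unfolding ts(1,2) labelling_Node[OF ts(3,4)]
          using a ts 1 by (simp add: Node tree_basis_def pure_tensor_Node)
        ultimately show ?thesis by (simp add: Node)
      next
        case b: 2
        have "\<not> (shape_of B = Node a ts \<and> tip B = i)"
        proof
          assume *: "shape_of B = Node a ts \<and> tip B = i"
          then have "map shape_of bs = ts" using Node by simp
          moreover have "map leaves (map shape_of bs) = map leaves bs" by simp
          ultimately have "map leaves bs = map leaves ts" by simp
          then have "map leaves (us2 @ t2 # ws2) = map leaves (us @ t # ws)" using 1 ts by simp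
          moreover have "sum_list (map leaves us2) + tip t2 = sum_list (map leaves us) + i'"
            using * ts(2) unfolding Node 1(1,2) by simp
          ultimately show False using locate_unique tb ts(3,4) b(2) by blast
        qed
        moreover have "?lhs = 0"
        proof -
          have l: "Suc (length us2 + length ws2) = Suc (length us + length ws)" using b(1) 1 ts by simp
          have "basis_label (Suc (length us + length ws)) (Some (Suc (length us))) (dias_basis d :: 'k dias) = 0"
            unfolding 1(2) l using b(2) l by (subst basis_label_basis(2)) (auto simp: positions_def)
          then show ?thesis unfolding ts(1,2) labelling_Node[OF ts(3,4)]
            by (simp add: Node tree_basis_def pure_tensor_Node)
        qed
        ultimately show ?thesis by simp
      next
        case c: 3
        have bl: "basis_label (Suc (length us + length ws)) (Some (Suc (length us))) (dias_basis d :: 'k dias) = 1"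
          unfolding 1(2) c by (subst basis_label_basis(2)) (auto simp: positions_def)
        have u: "prod_list (map2 ?f us us2) = of_bool (map shape_of us2 = us)"
          using Node.prems(1) ts 1 c by (intro prod_list_of_bool_shapes unlabelled_tree_basis) auto
        have w: "prod_list (map2 ?f ws ws2) = of_bool (map shape_of ws2 = ws)"
          using Node.prems(1) ts 1 c by (intro prod_list_of_bool_shapes unlabelled_tree_basis) auto
        have t: "pure_tensor (redecorate basis_label (labelling i' t)) (tree_basis t2 :: 'k dias ptree) =
            of_bool (shape_of t2 = t \<and> tip t2 = i')"
          using Node.prems(1) ts 1 by (intro Node.IH) auto
        have "?lhs = prod_list (map2 ?f us us2) *
            pure_tensor (redecorate basis_label (labelling i' t)) (tree_basis t2 :: 'k dias ptree) * prod_list (map2 ?f ws ws2)"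
          unfolding ts(1,2) labelling_Node[OF ts(3,4)] Node 1(1)
          using c bl by (simp add: tree_basis_def pure_tensor_Node zip_map_map o_def case_prod_unfold)
        also have "\<dots> = of_bool (map shape_of us2 = us \<and> shape_of t2 = t \<and> map shape_of ws2 = ws \<and> tip t2 = i')"
          unfolding u w t by auto
        also have "(map shape_of us2 = us \<and> shape_of t2 = t \<and> map shape_of ws2 = ws \<and> tip t2 = i') \<longleftrightarrow>
            (shape_of B = Node a ts \<and> tip B = i)"
        proof -
          have "shape_of B = Node a ts \<longleftrightarrow> map shape_of us2 = us \<and> shape_of t2 = t \<and> map shape_of ws2 = ws"
            using c by (simp add: Node 1(1) ts(1))
          moreover have "tip B = i \<longleftrightarrow> tip t2 = i'" if "map shape_of us2 = us"
          proof -
            have "map leaves us2 = map leaves us" using that[symmetric] by simp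
            then show ?thesis unfolding Node 1(1,2) ts(2) by simp
          qed
          ultimately show ?thesis by blast
        qed
        finally show ?thesis .
      qed
    qed
  qed (simp add: ts tree_basis_def labelling_Node[OF ts(3,4)])
qed

text \<open>
  The single contraction is a corolla, and its label is its tip.
\<close>

lemma contraction_two_vertices:
  assumes B: "B \<in> pointed_trees l" "vertices B = 2"
  shows "contractions pcomp B = [corolla l (l, tip B)]"
proof -
  have "length (contractions pcomp B) = 1" using length_contractions[of pcomp B] B by simp
  then obtain B' where B': "contractions pcomp B = [B']" by (auto simp: length_Suc_conv)
  then have in_set: "B' \<in> set (contractions pcomp B)" by simp
  have p: "B' \<in> pointed_trees l" using contractions_pointed[OF B(1) in_set] .
  have v: "vertices B' = 1" using contractions_vertices[OF in_set] B by simp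
  have t: "tip B' = tip B" using tip_contraction[OF _ in_set] B by (simp add: pointed_trees_def)
  obtain d ts where N: "B' = Node d ts" using v by (cases B') auto
  have "t = Leaf" if "t \<in> set ts" for t
    using v that unfolding N by (cases t) (auto simp: sum_list_eq_0_iff)
  then have ts: "ts = replicate (length ts) Leaf" by (simp add: replicate_eqI)
  have "leaves B' = length ts" unfolding N by (subst ts) (simp add: sum_list_replicate)
  then have len: "length ts = l" using p by (simp add: pointed_trees_def)
  obtain us u ws where uw: "ts = us @ u # ws" "d = (Suc (length us + length ws), Suc (length us))"
    using p N pointed_NodeE[of d ts] by (metis (no_types, lifting) mem_Collect_eq pointed_trees_def)
  have "u = Leaf" and "\<forall>t\<in>set us. t = Leaf"
    using \<open>\<And>t. t \<in> set ts \<Longrightarrow> t = Leaf\<close> uw by auto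
  then have "map leaves us = map (\<lambda>_. 1) us" by (intro map_cong refl) fastforce
  then have "sum_list (map leaves us) = length us" by (simp add: map_replicate_const sum_list_replicate)
  then have "tip B' = Suc (length us)" unfolding N uw using \<open>u = Leaf\<close> by simp
  moreover have "Suc (length us + length ws) = l" using len uw by simp
  ultimately have "d = (l, tip B)" using uw t by simp
  then show ?thesis using B' N ts len by simp
qed

lemma bar_dif_corolla:
  fixes f :: "'k::field dias \<Rightarrow> 'k"
  assumes "B \<in> pointed_trees l" "vertices B = 2"
  shows "bar_dif \<epsilon> (pure_tensor (corolla l f)) (tree_basis B) =
    of_int (\<epsilon> (corolla l ()) (shape_of B)) * f (dias_basis (l, tip B))"
proof -
  have "prod_list (map2 pure_tensor (replicate l Leaf) (replicate l Leaf :: 'k dias ptree list)) = (1::'k)"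
    by (simp add: zip_replicate)
  then show ?thesis
    using assms(1) by (subst bar_dif_tree_basis)
      (auto simp: pointed_trees_def contraction_two_vertices[OF assms] tree_basis_def pure_tensor_Node simp del: zip_replicate)
qed

lemma incidence_corolla:
  assumes "incidence_numbers \<epsilon>" "B \<in> pointed_trees l" "vertices B = 2"
  shows "\<epsilon> (corolla l ()) (shape_of B) \<in> {1, -1}"
proof (rule incidence_contraction[OF assms(1) shape_pointed_trees[OF assms(2)]])
  have "map shape_of (contractions pcomp B) = edge_contractions (shape_of B)"
    using assms(2) by (intro contractions_shape[of positions]) (simp add: pointed_trees_def)
  then have "edge_contractions (shape_of B) = [corolla l ()]" by (simp add: contraction_two_vertices[OF assms(2,3)])
  then show "corolla l () \<in> set (edge_contractions (shape_of B))" by simp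
qed

text \<open>
  In trees with two vertices, the definition of \<^const>\<open>label\<close> for \<open>l\<close> leaves only refers to labels
  at vertices of smaller arity.
\<close>

lemma two_vertex_arities:
  assumes "decorated (\<lambda>_. UNIV) T" "2 \<le> vertices T"
  shows "decorated (\<lambda>w. if w < leaves T then UNIV else {}) T"
proof -
  have *: "decorated (\<lambda>w. if w < m then UNIV else {}) T" if "decorated (\<lambda>_. UNIV) T" "leaves T < m" for T :: "'a ptree" and m
    using that
  proof (induction T)
    case (Node a ts)
    have "length ts \<le> (\<Sum>t\<leftarrow>ts. leaves t)"
    proof (rule sum_list_ge_length)
      show "1 \<le> leaves t" if "t \<in> set ts" for t
        using Node.prems(1) that by (intro leaves_pos[of "\<lambda>_. UNIV" t]) auto
    qed
    then have "length ts \<le> leaves (Node a ts)" by simp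
    moreover have "leaves t < m" if "t \<in> set ts" for t
      using child_leaves_less[OF Node.prems(1) that] Node.prems(2) by simp
    ultimately show ?case using Node by auto
  qed auto
  obtain a ts where T: "T = Node a ts" using assms(2) by (cases T) auto
  have "(\<Sum>t\<leftarrow>ts. vertices t) + length ts \<le> (\<Sum>t\<leftarrow>ts. leaves t)"
    using assms(1) T by (intro sum_vertices_add_length vertices_less_leaves[of "\<lambda>_. UNIV"]) simp
  then have "length ts < leaves T" using assms(2) T by simp
  moreover have "decorated (\<lambda>w. if w < leaves T then UNIV else {}) t" if "t \<in> set ts" for t
    using child_leaves_less[of "\<lambda>_. UNIV" a ts t] assms(1) T that by (intro *) auto
  ultimately show ?thesis using assms(1) T by auto
qed

lemma two_vertex_pointed_exists:
  assumes "3 \<le> l" "1 \<le> r" "r \<le> l"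
  obtains B where "B \<in> pointed_trees l" "vertices B = 2" "tip B = r"
proof -
  let ?T = "Node () (Node () [Leaf, Leaf] # replicate (l - 2) Leaf)"
  have "decorated (\<lambda>_. UNIV) ?T" "leaves ?T = l" using assms by (auto simp: sum_list_replicate)
  then obtain B where B: "decorated positions B" "shape_of B = ?T" "tip B = r"
    using special_exists[of ?T r] assms by auto
  have "vertices B = vertices ?T" "leaves B = leaves ?T"
    using arg_cong[OF B(2), of vertices] arg_cong[OF B(2), of leaves] by simp_all
  then show thesis using that[of B] B \<open>leaves ?T = l\<close> by (auto simp: pointed_trees_def sum_list_replicate)
qed

text \<open>
  At a tree with two vertices, decorated by basis elements, contraction gives the basis element of
  \<open>Dias(l)\<close> whose index is the tip.  So the differential of a linear form \<open>f\<close> at the corolla has the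
  value \<open>\<plusminus>f(e\<^sub>t)\<close> for the tip \<open>t\<close>, whereas the prescribed right-hand side has \<open>\<plusminus>1\<close> for \<open>t = i\<close> and
  \<open>0\<close> otherwise, with the same sign.  This means \<open>f = e\<^sub>i\<^sup>*\<close>, since every tip occurs and the
  sign is invertible.
\<close>

lemma label_eq_dias_form:
  assumes eps: "incidence_numbers \<epsilon>"
  shows "2 \<le> l \<Longrightarrow> 1 \<le> i \<Longrightarrow> i \<le> l \<Longrightarrow> label \<epsilon> l i = (dias_form (l, i) :: 'k::field dias \<Rightarrow> 'k)"
proof (induction l arbitrary: i rule: less_induct)
  case (less l)
  have pos: "(l, i) \<in> positions l" using less.prems by (simp add: positions_def)
  show ?case
  proof (cases "l = 2")
    case True
    have gens: "dias_basis (2, Suc 0) = (dias_gen Prec :: 'k dias)" "dias_basis (2, 2) = (dias_gen Succ :: 'k dias)"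
      by (simp_all add: dias_gen_eq)
    have p2: "d = (2, 1) \<or> d = (2, 2)" if "d \<in> positions 2" for d
      using that by (cases d) (auto simp: positions_def)
    have "(THE f. f \<in> dias_dual 2 \<and> (\<forall>a. f (dias_gen a) = of_bool (a = (if i = 1 then Prec else Succ)))) =
        (dias_form (2, i) :: 'k dias \<Rightarrow> 'k)"
    proof (rule the_equality)
      have "dias_form (2, i) (dias_gen a :: 'k dias) = of_bool (a = (if i = 1 then Prec else Succ))" for a
        unfolding dias_gen_eq using pos True less.prems
        by (subst dias_form_basis[of _ 2]) (cases a; auto simp: positions_def)+
      then show "dias_form (2, i) \<in> dias_dual 2 \<and>
          (\<forall>a. dias_form (2, i) (dias_gen a :: 'k dias) = of_bool (a = (if i = 1 then Prec else Succ)))"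
        using dias_form_in_dual[of "(2, i)" 2] pos True by auto
      fix f :: "'k dias \<Rightarrow> 'k"
      assume f: "f \<in> dias_dual 2 \<and> (\<forall>a. f (dias_gen a) = of_bool (a = (if i = 1 then Prec else Succ)))"
      show "f = dias_form (2, i)"
      proof (rule dias_dual_eqI[of _ 2])
        fix d assume "d \<in> positions 2"
        then consider "d = (2, 1)" | "d = (2, 2)" using p2 by blast
        then show "f (dias_basis d) = dias_form (2, i) (dias_basis d)"
          using f \<open>\<And>a. dias_form (2, i) (dias_gen a :: 'k dias) = _\<close> by cases (simp_all add: gens)
      qed (use f dias_form_in_dual[of "(2, i)" 2] pos True in auto)
    qed
    then show ?thesis using True by (simp add: label.simps)
  next
    case False
    then have l3: "3 \<le> l" using less.prems by simp
    let ?S = "{T' \<in> shapes l. vertices T' = 2}"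
    let ?g = "\<lambda>w r. if w < l then label \<epsilon> w r else (0 :: 'k dias \<Rightarrow> 'k)"
    have labels: "redecorate (interpret_label ?g) (labelling i T') = redecorate basis_label (labelling i T')"
      if "T' \<in> ?S" for T'
    proof (rule redecorate_cong)
      have "decorated (\<lambda>w. if w < l then UNIV else {}) T'"
        using two_vertex_arities[of T'] that by (auto simp: shapes_def)
      then show "decorated (\<lambda>w. if w < l then insert None (Some ` {1..w}) else {}) (labelling i T')"
        using that less.prems
        by (rule_tac decorated_labelling) (auto simp: shapes_def split: if_splits)
      fix w a assume "2 \<le> w" "a \<in> (if w < l then insert None (Some ` {1..w}) else {})"
      then have "w < l" "a \<in> insert None (Some ` {1..w})" by (auto split: if_splits)
      moreover have "label \<epsilon> w r = (dias_form (w, r) :: 'k dias \<Rightarrow> 'k)" if "r \<in> {1..w}" for r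
        using less.IH[of w r] that \<open>2 \<le> w\<close> \<open>w < l\<close> by auto
      ultimately show "interpret_label ?g w a = basis_label w a"
        by (auto simp: interpret_label_def intro!: sum.cong)
    qed
    define rhs :: "'k bar" where "rhs = (\<Sum>T' \<in> ?S. fscale (of_int (\<epsilon> (corolla l ()) T'))
        (pure_tensor (redecorate basis_label (labelling i T'))))"
    have rhs_in: "rhs \<in> bar_cmp l (3 - int l)"
      unfolding rhs_def
    proof (intro fvs.subspace_sum fvs.subspace_scale bar_cmp_subspace)
      fix T' assume T': "T' \<in> ?S"
      then have i: "1 \<le> i" "i \<le> leaves T'" using less.prems by (auto simp: shapes_def)
      have "shape_of (redecorate basis_label (labelling i T') :: ('k dias \<Rightarrow> 'k) ptree) = T'"
        using shape_labelling[OF i] by simp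
      from arg_cong[OF this, of leaves] arg_cong[OF this, of vertices]
      have "leaves (redecorate basis_label (labelling i T') :: ('k dias \<Rightarrow> 'k) ptree) = l"
        "vertices (redecorate basis_label (labelling i T') :: ('k dias \<Rightarrow> 'k) ptree) = 2"
        using T' by (simp_all add: shapes_def)
      moreover have "decorated dias_dual (redecorate basis_label (labelling i T') :: ('k dias \<Rightarrow> 'k) ptree)"
      proof (rule decorated_redecorate)
        show "decorated (\<lambda>w. insert None (Some ` {1..w})) (labelling i T')"
          by (rule decorated_labelling[of "\<lambda>_. UNIV"]) (use T' i in \<open>auto simp: shapes_def\<close>)
      qed (rule basis_label_in_dual)
      ultimately show "pure_tensor (redecorate basis_label (labelling i T')) \<in> (bar_cmp l (3 - int l) :: 'k bar set)"
        unfolding bar_cmp_def by (intro fvs.span_base) (fastforce simp del: redecorate_leaves redecorate_vertices)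
    qed
    have rhs_at: "rhs (tree_basis B) = of_int (\<epsilon> (corolla l ()) (shape_of B)) * of_bool (tip B = i)"
      if B: "B \<in> pointed_trees l" "vertices B = 2" for B
    proof -
      have "rhs (tree_basis B) = (\<Sum>T'\<in>?S. if T' = shape_of B
          then of_int (\<epsilon> (corolla l ()) (shape_of B)) * of_bool (tip B = i) else 0)"
        unfolding rhs_def sum_fun_apply fscale_def
      proof (intro sum.cong refl)
        fix T' assume T': "T' \<in> ?S"
        have "pure_tensor (redecorate basis_label (labelling i T')) (tree_basis B :: 'k dias ptree) =
            of_bool (shape_of B = T' \<and> tip B = i)"
          using T' less.prems B by (intro labelling_tree_basis) (auto simp: shapes_def pointed_trees_def)
        then show "of_int (\<epsilon> (corolla l ()) T') * pure_tensor (redecorate basis_label (labelling i T')) (tree_basis B :: 'k dias ptree)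
          = (if T' = shape_of B then of_int (\<epsilon> (corolla l ()) (shape_of B)) * of_bool (tip B = i) else 0)"
          by auto
      qed
      also have "\<dots> = of_int (\<epsilon> (corolla l ()) (shape_of B)) * of_bool (tip B = i)"
        using shape_pointed_trees[OF B(1)] B(2) by simp
      finally show ?thesis .
    qed
    have cor_in: "bar_dif \<epsilon> (pure_tensor (corolla l f)) \<in> bar_cmp l (3 - int l)" if "f \<in> dias_dual l" for f :: "'k dias \<Rightarrow> 'k"
    proof -
      have "pure_tensor (corolla l f) \<in> bar_cmp l (2 - int l)"
        unfolding bar_cmp_def
      proof (rule fvs.span_base, rule CollectI, intro exI conjI)
        show "decorated dias_dual (corolla l f)" using that less.prems by simp
      qed (auto simp: sum_list_replicate)
      from bar_dif_in_bar_cmp[OF this] show ?thesis by (simp add: algebra_simps)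
    qed
    have "label \<epsilon> l i = (THE f. f \<in> dias_dual l \<and> bar_dif \<epsilon> (pure_tensor (corolla l f)) = rhs)"
    proof -
      have "(\<Sum>T' \<in> ?S. fscale (of_int (\<epsilon> (corolla l ()) T'))
          (pure_tensor (redecorate (interpret_label ?g) (labelling i T')))) = rhs"
        unfolding rhs_def by (intro sum.cong refl) (simp only: labels)
      then show ?thesis using False by (subst label.simps) simp
    qed
    also have "\<dots> = dias_form (l, i)"
    proof (rule the_equality)
      have "bar_dif \<epsilon> (pure_tensor (corolla l (dias_form (l, i)))) = rhs"
      proof (rule bar_cmp_eqI[OF cor_in rhs_in])
        show dual: "dias_form (l, i) \<in> dias_dual l" using pos by (rule dias_form_in_dual)
        fix B assume B: "B \<in> pointed_trees l"
        show "bar_dif \<epsilon> (pure_tensor (corolla l (dias_form (l, i)))) (tree_basis B) = (rhs (tree_basis B) :: 'k)"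
        proof (cases "vertices B = 2")
          case True
          have "(l, tip B) \<in> positions l"
            using tip_bounds[of B] B by (auto simp: positions_def pointed_trees_def)
          then have "dias_form (l, i) (dias_basis (l, tip B) :: 'k dias) = of_bool (tip B = i)"
            using pos by (subst dias_form_basis[of _ l]) auto
          then show ?thesis unfolding bar_dif_corolla[OF B True] rhs_at[OF B True] by simp
        next
          case False
          then show ?thesis
            using bar_cmp_expand(2)[OF cor_in[OF dual] B] bar_cmp_expand(2)[OF rhs_in B] by fastforce
        qed
      qed
      then show "dias_form (l, i) \<in> dias_dual l \<and> bar_dif \<epsilon> (pure_tensor (corolla l (dias_form (l, i)))) = rhs"
        using dias_form_in_dual[OF pos] by blast
    next
      fix f :: "'k dias \<Rightarrow> 'k"
      assume f: "f \<in> dias_dual l \<and> bar_dif \<epsilon> (pure_tensor (corolla l f)) = rhs"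
      show "f = dias_form (l, i)"
      proof (rule dias_dual_eqI)
        fix d assume d: "d \<in> positions l"
        then obtain r where r: "d = (l, r)" "1 \<le> r" "r \<le> l" by (auto simp: positions_def)
        obtain B where B: "B \<in> pointed_trees l" "vertices B = 2" "tip B = r"
          using two_vertex_pointed_exists[OF l3 r(2,3)] .
        have "of_int (\<epsilon> (corolla l ()) (shape_of B)) * f (dias_basis (l, r)) =
            of_int (\<epsilon> (corolla l ()) (shape_of B)) * of_bool (r = i)"
        proof -
          have "bar_dif \<epsilon> (pure_tensor (corolla l f)) (tree_basis B) = rhs (tree_basis B)" using f by simp
          then show ?thesis unfolding bar_dif_corolla[OF B(1,2)] rhs_at[OF B(1,2)] B(3) .
        qed
        then have "f (dias_basis (l, r)) = of_bool (r = i)"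
          using incidence_corolla[OF eps B(1,2)] by auto
        then show "f (dias_basis d) = dias_form (l, i) (dias_basis d)"
          using pos d r by (subst dias_form_basis[of _ l]) auto
      qed (use f pos in \<open>auto intro: dias_form_in_dual\<close>)
    qed
    finally show ?thesis .
  qed
qed

subsection \<open>Coefficients\<close>

definition point :: "nat ptree \<Rightarrow> (nat \<times> nat) ptree" where
  "point = redecorate Pair"

lemma point_pointed: "L \<in> labelled_trees n \<Longrightarrow> point L \<in> pointed_trees n"
  by (auto simp: labelled_trees_def pointed_trees_def point_def positions_def intro: decorated_redecorate)

lemma point_surj:
  assumes "B \<in> pointed_trees n"
  shows "B \<in> point ` labelled_trees n"
proof (rule image_eqI)
  have "decorated positions B \<Longrightarrow> B = point (map_ptree snd B)"
    by (induction B) (auto simp: point_def positions_def intro: map_idI[symmetric])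
  then show "B = point (map_ptree snd B)" using assms by (auto simp: pointed_trees_def)
  show "map_ptree snd B \<in> labelled_trees n"
    using assms by (auto simp: labelled_trees_def pointed_trees_def positions_def intro!: decorated_map_ptree)
qed

lemma bar_basis_elem_eq:
  assumes "incidence_numbers \<epsilon>" "L \<in> labelled_trees n"
  shows "bar_basis_elem \<epsilon> L = (tree_form (point L) :: 'k::field bar)"
proof -
  have "redecorate (label \<epsilon>) L = (redecorate (\<lambda>l a. dias_form (l, a)) L :: ('k dias \<Rightarrow> 'k) ptree)"
    by (rule redecorate_cong[where A = "\<lambda>l. {1..l}"])
       (use assms label_eq_dias_form[OF assms(1)] in \<open>auto simp: labelled_trees_def\<close>)
  then show ?thesis by (simp add: bar_basis_elem_def tree_form_def point_def map_redecorate)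
qed

lemma inj_on_tree_form: "inj_on (tree_form :: _ \<Rightarrow> 'k::field bar) (pointed_trees n)"
proof (rule inj_onI)
  fix B B' assume B: "B \<in> pointed_trees n" "B' \<in> pointed_trees n" "tree_form B = (tree_form B' :: 'k bar)"
  have "(of_bool (B = B') :: 'k) = tree_form B (tree_basis B')"
    using B by (subst tree_form_basis) (auto simp: pointed_trees_def)
  also have "\<dots> = tree_form B' (tree_basis B')" by (simp only: B(3))
  also have "\<dots> = 1" using B by (subst tree_form_basis) (auto simp: pointed_trees_def)
  finally show "B = B'" by (cases "B = B'") simp_all
qed

lemma independent_tree_forms: "fvs.independent (tree_form ` pointed_trees n :: 'k::field bar set)"
proof -
  note inj = inj_on_tree_form[of n, where 'k = 'k]
  have "u (tree_form B) = 0" if u: "(\<Sum>v\<in>tree_form ` pointed_trees n. fscale (u v) v) = (0 :: 'k bar)" and B: "B \<in> pointed_trees n" for u B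
  proof -
    have "0 = bar_of_coeffs n (\<lambda>B. u (tree_form B)) (tree_basis B)"
      using u unfolding bar_of_coeffs_def sum.reindex[OF inj] by (simp add: o_def)
    then show ?thesis using bar_of_coeffs_apply[OF B, of "\<lambda>B. u (tree_form B)"] by simp
  qed
  then show ?thesis by (subst fvs.dependent_finite) auto
qed

text \<open>
  The coefficient in the basis of labelled trees is the one in \<^const>\<open>bar_of_coeffs\<close>, because the
  tree forms are linearly independent and distinct.
\<close>

lemma bar_coeff_eq:
  assumes "incidence_numbers \<epsilon>" "L \<in> labelled_trees n"
  shows "bar_coeff \<epsilon> n L (bar_of_coeffs n c, x) = (c (point L) :: 'k::field)"
proof -
  let ?S = "tree_form ` pointed_trees n :: 'k bar set"
  note inj = inj_on_tree_form[of n, where 'k = 'k]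
  have S: "bar_basis_elem \<epsilon> ` labelled_trees n = ?S"
    using bar_basis_elem_eq[OF assms(1), of _ n] point_pointed[of _ n] point_surj[of _ n] by (auto simp: image_iff) metis+
  define f where "f v = (if v \<in> ?S then c (the_inv_into (pointed_trees n) tree_form v) else 0)" for v :: "'k bar"
  have fB: "f (tree_form B) = c B" if "B \<in> pointed_trees n" for B
    using that by (simp add: f_def the_inv_into_f_f[OF inj])
  have fin: "finite ?S" by simp
  have "fvs.representation ?S (bar_of_coeffs n c) = f"
  proof (rule fvs.representation_eqI[OF independent_tree_forms])
    show "bar_of_coeffs n c \<in> fvs.span ?S"
      unfolding bar_of_coeffs_def by (intro fvs.span_sum fvs.span_scale fvs.span_base imageI)
    show "v \<in> ?S" if "f v \<noteq> 0" for v using that by (auto simp: f_def split: if_splits)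
    then have sub: "{v. f v \<noteq> 0} \<subseteq> ?S" by blast
    then show "finite {v. f v \<noteq> 0}" using fin finite_subset by blast
    have "(\<Sum>v | f v \<noteq> 0. fscale (f v) v) = (\<Sum>v\<in>?S. fscale (f v) v)"
      by (rule sum.mono_neutral_left[OF fin sub]) (auto simp: fscale_def zero_fun_def)
    also have "\<dots> = bar_of_coeffs n c"
      unfolding bar_of_coeffs_def sum.reindex[OF inj] o_def by (intro sum.cong refl) (simp add: fB)
    finally show "(\<Sum>v | f v \<noteq> 0. fscale (f v) v) = bar_of_coeffs n c" .
  qed
  then show ?thesis
    unfolding bar_coeff_def S bar_basis_elem_eq[OF assms] by (simp add: fB point_pointed[OF assms(2)])
qed

section \<open>The operad Dend\<close>

global_interpretation dend: vector_space "dend_scale :: 'k::field \<Rightarrow> 'k dend \<Rightarrow> 'k dend"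
  by standard (transfer; simp add: pscale_simps quad_eq_def quad_ideal.zero)+

text \<open>
  The operations of the free dendriform algebra on one generator.  The second argument is inserted first
  so that the number of the other input does not depend on its arity.
\<close>

lift_definition dend_op :: "dop \<Rightarrow> 'k::field dend \<Rightarrow> 'k dend \<Rightarrow> 'k dend"
  is "\<lambda>a p q. free_comp 1 (free_comp 2 (Poly_Mapping.single (Op Lf a Lf) 1) q) p"
  by (intro quad_eq_comp equivp_reflp[OF quad_eq_equivp])

definition dend_mono :: "dop bmon \<Rightarrow> 'k::field dend" where
  "dend_mono m = abs_dend (Poly_Mapping.single m 1)"

lemma dend_op_mono: "dend_op a (dend_mono s) (dend_mono t) = dend_mono (Op s a t)"
  using arity_pos[of t] unfolding dend_mono_def dend_op.abs_eq by (simp add: free_comp_single)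

lemma dend_op_add:
  "dend_op a (x + x') y = dend_op a x y + dend_op a x' y"
  "dend_op a x (y + y') = dend_op a x y + dend_op a x y'"
  by (transfer; simp add: free_comp_add_left free_comp_add_right quad_eq_def quad_ideal.zero)+

lemma dend_op_scale:
  "dend_op a (dend_scale c x) y = dend_scale c (dend_op a x y)"
  "dend_op a x (dend_scale c y) = dend_scale c (dend_op a x y)"
  by (transfer; simp add: free_comp_pscale_left free_comp_pscale_right quad_eq_def quad_ideal.zero)+

lemma dend_op_zero [simp]: "dend_op a 0 y = 0" "dend_op a x 0 = 0"
  using dend_op_add(1)[of a 0 0 y] dend_op_add(2)[of a x 0 0] by simp_all

lemma dend_op_sum:
  "dend_op a (sum f A) y = (\<Sum>x\<in>A. dend_op a (f x) y)"
  "dend_op a x (sum f A) = (\<Sum>y\<in>A. dend_op a x (f y))"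
  by (induction A rule: infinite_finite_induct) (auto simp: dend_op_add)

lemma abs_dend_sum: "abs_dend (sum f A) = (\<Sum>x\<in>A. abs_dend (f x))"
  by (induction A rule: infinite_finite_induct) (auto simp: zero_dend.abs_eq plus_dend.abs_eq[symmetric])

lemma abs_dend_single: "abs_dend (Poly_Mapping.single m c) = dend_scale c (dend_mono m)"
  by (simp add: dend_mono_def dend_scale.abs_eq pscale_single)

lemma dend_linear_eqI:
  fixes f g :: "'k::field dend \<Rightarrow> 'k dend"
  assumes "\<And>x y. f (x + y) = f x + f y" "\<And>c x. f (dend_scale c x) = dend_scale c (f x)"
    "\<And>x y. g (x + y) = g x + g y" "\<And>c x. g (dend_scale c x) = dend_scale c (g x)"
    "\<And>m. f (dend_mono m) = g (dend_mono m)"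
  shows "f x = g x"
proof -
  have "\<exists>p. x = abs_dend p" by (induction x) auto
  then obtain p where x: "x = abs_dend p" by blast
  have x: "x = (\<Sum>m\<in>Poly_Mapping.keys p. dend_scale (Poly_Mapping.lookup p m) (dend_mono m))"
    unfolding x by (subst keys_sum_single[of p]) (simp add: abs_dend_sum abs_dend_single)
  have 0: "f 0 = 0" "g 0 = 0" using assms(1)[of 0 0] assms(3)[of 0 0] by simp_all
  have "f (\<Sum>m\<in>A. dend_scale (c m) (dend_mono m)) = g (\<Sum>m\<in>A. dend_scale (c m) (dend_mono m))" for A c
    by (induction A rule: infinite_finite_induct) (auto simp: 0 assms)
  then show ?thesis by (simp add: x)
qed

text \<open>
  Monomials span Dend, so trilinear identities need only be checked on them.
\<close>

lemma dend_trilinear_eqI: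
  fixes f g :: "'k::field dend \<Rightarrow> 'k dend \<Rightarrow> 'k dend \<Rightarrow> 'k dend"
  assumes f: "\<And>x x' y z. f (x + x') y z = f x y z + f x' y z" "\<And>x y y' z. f x (y + y') z = f x y z + f x y' z"
      "\<And>x y z z'. f x y (z + z') = f x y z + f x y z'" "\<And>c x y z. f (dend_scale c x) y z = dend_scale c (f x y z)"
      "\<And>c x y z. f x (dend_scale c y) z = dend_scale c (f x y z)" "\<And>c x y z. f x y (dend_scale c z) = dend_scale c (f x y z)"
    and g: "\<And>x x' y z. g (x + x') y z = g x y z + g x' y z" "\<And>x y y' z. g x (y + y') z = g x y z + g x y' z"
      "\<And>x y z z'. g x y (z + z') = g x y z + g x y z'" "\<And>c x y z. g (dend_scale c x) y z = dend_scale c (g x y z)"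
      "\<And>c x y z. g x (dend_scale c y) z = dend_scale c (g x y z)" "\<And>c x y z. g x y (dend_scale c z) = dend_scale c (g x y z)"
    and mono: "\<And>p q r. f (dend_mono p) (dend_mono q) (dend_mono r) = g (dend_mono p) (dend_mono q) (dend_mono r)"
  shows "f x y z = g x y z"
proof -
  have 1: "f (dend_mono p) (dend_mono q) z = g (dend_mono p) (dend_mono q) z" for p q z
    by (rule dend_linear_eqI) (simp_all add: f g mono)
  have 2: "f (dend_mono p) y z = g (dend_mono p) y z" for p y z
    by (rule dend_linear_eqI[where f = "\<lambda>y. f (dend_mono p) y z" and g = "\<lambda>y. g (dend_mono p) y z"])
       (simp_all add: f g 1)
  show ?thesis
    by (rule dend_linear_eqI[where f = "\<lambda>x. f x y z" and g = "\<lambda>x. g x y z"]) (simp_all add: f g 2)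
qed

lemma dend_relator_mono:
  assumes "(u, v) \<in> dend_rel"
  shows "(\<Sum>(a, b)\<in>UNIV. dend_scale (u (a, b)) (dend_mono (Op (Op p a q) b r))) =
    (\<Sum>(a, b)\<in>UNIV. dend_scale (v (a, b)) (dend_mono (Op p a (Op q b r)) :: 'k::field dend))"
proof -
  define s :: "dop bmon \<Rightarrow> (dop bmon \<Rightarrow>\<^sub>0 'k)" where "s m = Poly_Mapping.single m 1" for m
  have "free_comp 1 (free_comp 2 (free_comp 3 (quad_relator u v) (s r)) (s q)) (s p) \<in> quad_ideal dend_rel"
    using assms by (intro quad_ideal.comp_left quad_ideal.relator)
  also have "free_comp 1 (free_comp 2 (free_comp 3 (quad_relator u v) (s r)) (s q)) (s p) =
      (\<Sum>(a, b)\<in>UNIV. Poly_Mapping.single (Op (Op p a q) b r) (u (a, b))) -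
      (\<Sum>(a, b)\<in>UNIV. Poly_Mapping.single (Op p a (Op q b r)) (v (a, b)))"
    unfolding quad_relator_def sum_dop_pairs
    by (simp add: free_comp_diff_left free_comp_add_left free_comp_single s_def)
  finally have "abs_dend (\<Sum>(a, b)\<in>UNIV. Poly_Mapping.single (Op (Op p a q) b r) (u (a, b))) =
      abs_dend (\<Sum>(a, b)\<in>UNIV. Poly_Mapping.single (Op p a (Op q b r)) (v (a, b)))"
    by (simp add: dend.abs_eq_iff quad_eq_def)
  then show ?thesis by (simp add: abs_dend_sum abs_dend_single case_prod_beta)
qed

lemma dend_laws_mono:
  fixes p q r :: "dop bmon"
  shows "dend_mono (Op (Op p Prec q) Prec r) = (dend_mono (Op p Prec (Op q Prec r)) + dend_mono (Op p Prec (Op q Succ r)) :: 'k::field dend)"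
    "dend_mono (Op (Op p Succ q) Prec r) = (dend_mono (Op p Succ (Op q Prec r)) :: 'k dend)"
    "dend_mono (Op (Op p Prec q) Succ r) + dend_mono (Op (Op p Succ q) Succ r) = (dend_mono (Op p Succ (Op q Succ r)) :: 'k dend)"
proof -
  define prec succ :: "dop \<Rightarrow> 'k" where "prec = (\<lambda>a. of_bool (a = Prec))" "succ = (\<lambda>a. of_bool (a = Succ))"
  have "(tensor2 prec prec, tensor2 prec (prec + succ)) \<in> dend_rel"
    "(tensor2 succ prec, tensor2 succ prec) \<in> dend_rel"
    "(tensor2 (prec + succ) succ, tensor2 succ succ) \<in> dend_rel"
    by (simp_all add: dend_rel_def Let_def prec_succ_def)
  from this[THEN dend_relator_mono[where p = p and q = q and r = r]]
  show "dend_mono (Op (Op p Prec q) Prec r) = (dend_mono (Op p Prec (Op q Prec r)) + dend_mono (Op p Prec (Op q Succ r)) :: 'k::field dend)"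
    "dend_mono (Op (Op p Succ q) Prec r) = (dend_mono (Op p Succ (Op q Prec r)) :: 'k dend)"
    "dend_mono (Op (Op p Prec q) Succ r) + dend_mono (Op (Op p Succ q) Succ r) = (dend_mono (Op p Succ (Op q Succ r)) :: 'k dend)"
    unfolding sum_dop_pairs tensor2_def prec_succ_def by simp_all
qed

definition dend_star :: "'k::field dend \<Rightarrow> 'k dend \<Rightarrow> 'k dend" where
  "dend_star x y = dend_op Prec x y + dend_op Succ x y"

lemma dend_laws:
  shows "dend_op Prec (dend_op Prec x y) z = dend_op Prec x (dend_star y z)"
    and "dend_op Prec (dend_op Succ x y) z = dend_op Succ x (dend_op Prec y z)"
    and "dend_op Succ (dend_star x y) z = dend_op Succ x (dend_op Succ y z)"
proof -
  note lin = dend_op_add dend_op_scale dend_star_def dend.scale_right_distrib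
  show "dend_op Prec (dend_op Prec x y) z = dend_op Prec x (dend_star y z)"
    by (rule dend_trilinear_eqI[where f = "\<lambda>x y z. dend_op Prec (dend_op Prec x y) z"
          and g = "\<lambda>x y z. dend_op Prec x (dend_star y z)"])
       (simp_all add: lin dend_op_mono dend_laws_mono)
  show "dend_op Prec (dend_op Succ x y) z = dend_op Succ x (dend_op Prec y z)"
    by (rule dend_trilinear_eqI[where f = "\<lambda>x y z. dend_op Prec (dend_op Succ x y) z"
          and g = "\<lambda>x y z. dend_op Succ x (dend_op Prec y z)"])
       (simp_all add: lin dend_op_mono dend_laws_mono)
  show "dend_op Succ (dend_star x y) z = dend_op Succ x (dend_op Succ y z)"
    by (rule dend_trilinear_eqI[where f = "\<lambda>x y z. dend_op Succ (dend_star x y) z"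
          and g = "\<lambda>x y z. dend_op Succ x (dend_op Succ y z)"])
       (simp_all add: lin dend_op_mono dend_laws_mono)
qed

lemma dend_star_assoc: "dend_star (dend_star x y) z = dend_star x (dend_star y z)"
proof -
  have "dend_star (dend_star x y) z = dend_op Prec (dend_star x y) z + dend_op Succ (dend_star x y) z"
    by (rule dend_star_def)
  also have "\<dots> = dend_op Prec x (dend_star y z) + (dend_op Succ x (dend_op Prec y z) + dend_op Succ x (dend_op Succ y z))"
    unfolding dend_laws(3) unfolding dend_star_def[of x y] dend_op_add dend_laws by (simp add: add_ac)
  also have "\<dots> = dend_star x (dend_star y z)" by (simp add: dend_star_def dend_op_add add_ac)
  finally show ?thesis .
qed

text \<open>
  The powers of the generator under the associative product \<open>*\<close>; the value at \<open>0\<close> is a dummy, since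
  there is no unit.
\<close>

fun dend_power :: "nat \<Rightarrow> 'k::field dend" where
  "dend_power 0 = 0"
| "dend_power (Suc 0) = dend_mono Lf"
| "dend_power (Suc (Suc k)) = dend_star (dend_mono Lf) (dend_power (Suc k))"

lemma dend_power_add:
  "dend_star (dend_power (Suc k)) (dend_power (Suc l)) = dend_power (Suc k + Suc l)"
proof (induction k)
  case (Suc k)
  then show ?case by (simp add: dend_star_assoc)
qed simp

abbreviation skeleton :: "dop bmon \<Rightarrow> unit bmon" where
  "skeleton \<equiv> map_bmon (\<lambda>_. ())"

lemma arity_map_bmon [simp]: "arity (map_bmon f m) = arity m"
  by (induction m) auto

text \<open>
  In degree zero the monomials in the operations of Dend are the labelled binary trees.
\<close>

primrec mono_tree :: "dop bmon \<Rightarrow> (nat \<times> nat) ptree" where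
  "mono_tree Lf = Leaf"
| "mono_tree (Op s a t) = Node (2, case a of Prec \<Rightarrow> 1 | Succ \<Rightarrow> 2) [mono_tree s, mono_tree t]"

lemma mono_tree_leaves [simp]: "leaves (mono_tree m) = arity m"
  by (induction m) auto

lemma mono_tree_pointed: "arity m = n \<Longrightarrow> mono_tree m \<in> pointed_trees n"
proof -
  have "decorated positions (mono_tree m)"
    by (induction m) (auto simp: positions_def split: dop.splits)
  then show "arity m = n \<Longrightarrow> mono_tree m \<in> pointed_trees n" by (simp add: pointed_trees_def)
qed

lemma inj_mono_tree: "inj mono_tree"
proof (rule injI)
  fix m m' show "mono_tree m = mono_tree m' \<Longrightarrow> m = m'"
  proof (induction m arbitrary: m')
    case Lf then show ?case by (cases m') auto
  next
    case (Op s a t) then show ?case by (cases m') (auto split: dop.splits)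
  qed
qed

lemma finite_arity: "finite {m :: dop bmon. arity m = n}"
  by (rule inj_on_finite[of mono_tree _ "pointed_trees n"]) (auto intro: mono_tree_pointed inj_on_subset[OF inj_mono_tree])

lemma finite_arity_unit: "finite {b :: unit bmon. arity b = n}"
proof -
  have "b \<in> skeleton ` {m. arity m = n}" if "arity b = n" for b
    using that by (intro image_eqI[of _ _ "map_bmon (\<lambda>_. Prec) b"]) (auto simp: bmon.map_comp o_def intro!: bmon.map_ident_strong[symmetric])
  then show ?thesis using finite_surj[OF finite_arity] by (metis (mono_tags) mem_Collect_eq subsetI)
qed

lemma finite_skeleton: "finite {m. skeleton m = b}"
  by (rule finite_subset[OF _ finite_arity[of "arity b"]]) auto

lemma mono_tree_basis: "tree_basis (mono_tree m) = (gen_tree m :: 'k::field dias ptree)"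
  by (induction m) (auto simp: tree_basis_def dias_gen_eq split: dop.splits)

lemma mono_tree_tip_special:
  "tip (mono_tree Lf) = 1" "special (mono_tree Lf)"
  "tip (mono_tree (Op s Prec t)) = tip (mono_tree s)"
  "tip (mono_tree (Op s Succ t)) = arity s + tip (mono_tree t)"
  "special (mono_tree (Op s Prec t)) \<longleftrightarrow> special (mono_tree s) \<and> first_pointed (mono_tree t)"
  "special (mono_tree (Op s Succ t)) \<longleftrightarrow> first_pointed (mono_tree s) \<and> special (mono_tree t)"
  "first_pointed (mono_tree (Op s a t)) \<longleftrightarrow> a = Prec \<and> first_pointed (mono_tree s) \<and> first_pointed (mono_tree t)"
  using tip_Node_split[of 2 "[mono_tree s]" "mono_tree t" "[]"]
    special_Node_split[of 2 "[mono_tree s]" "mono_tree t" "[]"]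
  by (auto simp: numeral_2_eq_2 split: dop.splits)

lemma tip_mono_tree [simp]: "tip (mono_tree m) = cpos m"
proof (induction m)
  case (Op s a t)
  then show ?case by (cases a) (auto simp: mono_tree_tip_special simp del: mono_tree.simps)
qed auto

lemma first_pointed_iff: "first_pointed (mono_tree m) \<longleftrightarrow> special (mono_tree m) \<and> cpos m = 1"
proof (induction m)
  case (Op s a t)
  then show ?case using arity_pos[of s] cpos_bounds[of t]
    by (cases a) (auto simp: mono_tree_tip_special simp del: mono_tree.simps)
qed auto

lemma first_pointed_graft:
  "1 \<le> i \<Longrightarrow> i \<le> arity s \<Longrightarrow>
   first_pointed (mono_tree (graft i s t)) \<longleftrightarrow> first_pointed (mono_tree s) \<and> first_pointed (mono_tree t)"
proof (induction s arbitrary: i)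
  case (Op s1 a s2)
  then show ?case
    by (cases "i \<le> arity s1") (auto simp: mono_tree_tip_special simp del: mono_tree.simps)
qed auto

text \<open>
  Grafting \<open>t\<close> at the tip of \<open>s\<close> continues the path; anywhere else \<open>t\<close> lies off the path, where it must
  have first labels only, which for a special \<open>t\<close> means that its tip is \<open>1\<close>.
\<close>

lemma special_graft:
  "1 \<le> i \<Longrightarrow> i \<le> arity s \<Longrightarrow>
   special (mono_tree (graft i s t)) \<longleftrightarrow>
     special (mono_tree s) \<and> special (mono_tree t) \<and> (i = cpos s \<or> cpos t = 1)"
proof (induction s arbitrary: i)
  case (Op s1 a s2)
  note b = cpos_bounds[of s1] cpos_bounds[of s2]
  show ?case
  proof (cases "i \<le> arity s1")
    case True
    then show ?thesis using Op.prems Op.IH(1)[of i] first_pointed_graft[of i s1 t] b first_pointed_iff[of t]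
      by (cases a) (auto simp: mono_tree_tip_special simp del: mono_tree.simps)
  next
    case False
    then show ?thesis using Op.prems Op.IH(2)[of "i - arity s1"] first_pointed_graft[of "i - arity s1" s2 t] b first_pointed_iff[of t]
      by (cases a) (auto simp: mono_tree_tip_special simp del: mono_tree.simps)
  qed
qed auto

text \<open>
  The target is an operad with one basis element for each arity and tip, the image of the special
  monomials; all other monomials are sent to zero.
\<close>

definition dend_class :: "dop bmon \<Rightarrow> (nat \<times> nat) option" where
  "dend_class m = (if special (mono_tree m) then Some (arity m, cpos m) else None)"

lemma dend_class_ideal:
  "(p :: dop bmon \<Rightarrow>\<^sub>0 'k::field) \<in> quad_ideal dend_rel \<Longrightarrow> class_sum dend_class c p = 0"
proof (erule class_sum_quad_ideal[where C = "\<lambda>i c d. if i = snd c \<or> snd d = 1 then Some (pcomp i c d) else None" and ar = fst, rotated 3])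
  fix i t and s :: "dop bmon" assume "1 \<le> i" "i \<le> arity s"
  then show "dend_class (graft i s t) = (case (dend_class s, dend_class t) of
      (Some c, Some d) \<Rightarrow> if i = snd c \<or> snd d = 1 then Some (pcomp i c d) else None | _ \<Rightarrow> None)"
    by (auto simp: dend_class_def arity_graft cpos_graft special_graft)
next
  fix u v :: "dop \<times> dop \<Rightarrow> 'k" and c assume "(u, v) \<in> dend_rel"
  then show "class_sum dend_class c (quad_relator u v) = 0"
    unfolding class_sum_quad_relator sum_dop_pairs
    by (cases rule: dend_rel_cases)
      (auto simp: dend_class_def mono_tree_tip_special simp del: mono_tree.simps split: if_splits)
qed (auto simp: dend_class_def split: if_splits)

lift_definition dend_coord :: "nat \<times> nat \<Rightarrow> 'k::field dend \<Rightarrow> 'k" is "class_sum dend_class"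
  unfolding quad_eq_def using dend_class_ideal class_sum_diff by (metis eq_iff_diff_eq_0)

lemma dend_coord_add: "dend_coord d (x + y) = dend_coord d x + dend_coord d y"
  by transfer (rule class_sum_add)

lemma dend_coord_scale: "dend_coord d (dend_scale c x) = c * dend_coord d x"
  by transfer (rule class_sum_pscale)

lemma dend_coord_zero [simp]: "dend_coord d 0 = 0"
  by transfer simp

lemma dend_coord_sum: "dend_coord d (sum f A) = (\<Sum>x\<in>A. dend_coord d (f x))"
  by (induction A rule: infinite_finite_induct) (auto simp: dend_coord_add)

lemma dend_coord_mono: "dend_coord d (dend_mono m) = of_bool (dend_class m = Some d)"
  unfolding dend_mono_def dend_coord.abs_eq by simp

subsection \<open>The sum over all binary trees of one shape\<close>

lemma sum_skeleton_Op:
  "(\<Sum>m | skeleton m = Op b () c. f m) =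
   (\<Sum>s | skeleton s = b. \<Sum>t | skeleton t = c. f (Op s Prec t) + f (Op s Succ t) :: 'b::ab_group_add)"
proof -
  have eq: "{m. skeleton m = Op b () c} =
    (\<lambda>(s, t). Op s Prec t) ` ({s. skeleton s = b} \<times> {t. skeleton t = c}) \<union>
    (\<lambda>(s, t). Op s Succ t) ` ({s. skeleton s = b} \<times> {t. skeleton t = c})" (is "?L = ?R")
  proof
    show "?L \<subseteq> ?R"
    proof
      fix m assume "m \<in> ?L"
      then obtain s a t where "m = Op s a t" "skeleton s = b" "skeleton t = c" by (cases m) auto
      then show "m \<in> ?R" by (cases a) auto
    qed
  qed auto
  have "(\<Sum>m\<in>?R. f m) = (\<Sum>(s, t)\<in>{s. skeleton s = b} \<times> {t. skeleton t = c}. f (Op s Prec t)) +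
    (\<Sum>(s, t)\<in>{s. skeleton s = b} \<times> {t. skeleton t = c}. f (Op s Succ t))"
    by (subst sum.union_disjoint)
      (auto simp: finite_skeleton sum.reindex inj_on_def case_prod_unfold o_def)
  then show ?thesis unfolding eq by (simp add: sum.cartesian_product[symmetric] sum.distrib)
qed

definition all_labellings :: "unit bmon \<Rightarrow> 'k::field dend" where
  "all_labellings b = (\<Sum>m | skeleton m = b. dend_mono m)"

definition path_labellings :: "nat \<Rightarrow> unit bmon \<Rightarrow> 'k::field dend" where
  "path_labellings i b = (\<Sum>m | skeleton m = b \<and> cpos m = i. dend_mono m)"

lemma skeleton_Lf: "{m. skeleton m = Lf} = {Lf}"
proof (intro set_eqI iffI)
  fix m assume "m \<in> {m. skeleton m = Lf}"
  then show "m \<in> {Lf}" by (cases m) auto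
qed auto

text \<open>
  All bracketings agree since \<open>*\<close> is associative.
\<close>

lemma all_labellings_eq: "all_labellings b = (dend_power (arity b) :: 'k::field dend)"
proof (induction b)
  case Lf
  show ?case by (simp add: all_labellings_def skeleton_Lf)
next
  case (Op b x c)
  obtain k l where kl: "arity b = Suc k" "arity c = Suc l"
    using arity_pos[of b] arity_pos[of c] by (metis Suc_le_D One_nat_def)
  have x: "Op b x c = Op b () c" by simp
  have "all_labellings (Op b x c) = (dend_star (all_labellings b) (all_labellings c) :: 'k dend)"
    unfolding x all_labellings_def sum_skeleton_Op dend_star_def dend_op_sum
    by (simp add: dend_op_mono sum.distrib sum.swap[of _ "{t. skeleton t = c}" "{s. skeleton s = b}"])
  also have "\<dots> = dend_power (arity (Op b x c))"
    unfolding Op kl dend_power_add arity.simps ..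
  finally show ?case .
qed

text \<open>
  The common class of the labellings with tip \<open>i\<close> is \<open>x\<^sup>i\<^sup>-\<^sup>1 \<succ> (x \<prec> x\<^sup>n\<^sup>-\<^sup>i)\<close> with \<open>*\<close>-powers of the
  generator \<open>x\<close>, where an empty power is omitted.
\<close>

definition pad_left :: "nat \<Rightarrow> 'k::field dend \<Rightarrow> 'k dend" where
  "pad_left k x = (if k = 0 then x else dend_op Succ (dend_power k) x)"

definition pad_right :: "nat \<Rightarrow> 'k::field dend \<Rightarrow> 'k dend" where
  "pad_right k x = (if k = 0 then x else dend_op Prec x (dend_power k))"

definition spine :: "nat \<Rightarrow> nat \<Rightarrow> 'k::field dend" where
  "spine n i = pad_left (i - 1) (pad_right (n - i) (dend_mono Lf))"

lemma Prec_pad_left: "dend_op Prec (pad_left k x) y = pad_left k (dend_op Prec x y)"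
  by (simp add: pad_left_def dend_laws)

lemma Prec_pad_right: "1 \<le> l \<Longrightarrow> dend_op Prec (pad_right k x) (dend_power l) = pad_right (k + l) (x :: 'k::field dend)"
  using dend_power_add[of "k - 1" "l - 1", where 'a = 'k] by (auto simp: pad_right_def dend_laws)

lemma Succ_pad_left: "1 \<le> k \<Longrightarrow> dend_op Succ (dend_power k) (pad_left l x) = pad_left (k + l) (x :: 'k::field dend)"
  using dend_power_add[of "k - 1" "l - 1", where 'a = 'k] by (auto simp: pad_left_def simp flip: dend_laws)

text \<open>
  If the \<open>i\<close>-th leaf lies in the left subtree, the root has the label \<open>\<prec>\<close>, the right subtree contributes
  a power, and the first two dendriform relations absorb this power on the right of the spine.  If it
  lies in the right subtree, the third relation absorbs the power of the left subtree.
\<close>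

lemma path_labellings_eq:
  "1 \<le> i \<Longrightarrow> i \<le> arity b \<Longrightarrow> path_labellings i b = (spine (arity b) i :: 'k::field dend)"
proof (induction b arbitrary: i)
  case Lf
  then have "i = 1" by simp
  moreover have "{m. skeleton m = Lf \<and> cpos m = 1} = {Lf}"
  proof (intro set_eqI iffI)
    fix m assume "m \<in> {m. skeleton m = Lf \<and> cpos m = 1}"
    then have "m \<in> {m. skeleton m = Lf}" by simp
    then show "m \<in> {Lf}" unfolding skeleton_Lf .
  qed simp
  ultimately show ?case by (simp add: path_labellings_def spine_def pad_left_def pad_right_def)
next
  case (Op b x c)
  have cond: "path_labellings i b' = (\<Sum>m | skeleton m = b'. if cpos m = i then dend_mono m else (0 :: 'k dend))" for i b'
    unfolding path_labellings_def
    using sum.inter_filter[OF finite_skeleton[of b'], of "dend_mono :: _ \<Rightarrow> 'k dend" "\<lambda>m. cpos m = i"]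
    by simp
  have x: "Op b x c = Op b () c" by simp
  have ar: "arity s = arity b" if "skeleton s = b" for s b using that by auto
  have split: "path_labellings i (Op b x c) = (\<Sum>s | skeleton s = b. \<Sum>t | skeleton t = c.
      (if cpos s = i then dend_op Prec (dend_mono s) (dend_mono t) else 0) +
      (if arity b + cpos t = i then dend_op Succ (dend_mono s) (dend_mono t) else (0 :: 'k dend)))"
    unfolding x cond sum_skeleton_Op by (intro sum.cong refl) (auto simp: dend_op_mono dest!: ar)
  show ?case
  proof (cases "i \<le> arity b")
    case True
    have "path_labellings i (Op b x c) = (\<Sum>s | skeleton s = b. \<Sum>t | skeleton t = c.
      (if cpos s = i then dend_op Prec (dend_mono s) (dend_mono t) else (0 :: 'k dend)))"
      unfolding split
    proof (intro sum.cong refl)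
      fix s t :: "dop bmon"
      have "arity b + cpos t \<noteq> i" using True cpos_bounds[of t] by auto
      then show "(if cpos s = i then dend_op Prec (dend_mono s) (dend_mono t) else 0) +
        (if arity b + cpos t = i then dend_op Succ (dend_mono s) (dend_mono t) else 0) =
        (if cpos s = i then dend_op Prec (dend_mono s) (dend_mono t) else (0 :: 'k dend))" by simp
    qed
    also have "\<dots> = dend_op Prec (path_labellings i b) (all_labellings c)"
      unfolding cond all_labellings_def dend_op_sum
      by (subst sum.swap) (intro sum.cong refl, simp)
    also have "\<dots> = dend_op Prec (spine (arity b) i) (dend_power (arity c))"
      using Op.IH(1)[OF Op.prems(1) True] by (simp add: all_labellings_eq)
    also have "\<dots> = spine (arity (Op b x c)) i"
      unfolding spine_def Prec_pad_left Prec_pad_right[OF arity_pos] using True by (simp add: add.commute)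
    finally show ?thesis .
  next
    case False
    let ?i = "i - arity b"
    have "path_labellings i (Op b x c) = (\<Sum>s | skeleton s = b. \<Sum>t | skeleton t = c.
      (if cpos t = ?i then dend_op Succ (dend_mono s) (dend_mono t) else (0 :: 'k dend)))"
      unfolding split
    proof (intro sum.cong refl)
      fix s t assume "s \<in> {s. skeleton s = b}"
      then have "cpos s \<noteq> i" using False cpos_bounds[of s] ar by auto
      moreover have "arity b + cpos t = i \<longleftrightarrow> cpos t = ?i" using False by auto
      ultimately show "(if cpos s = i then dend_op Prec (dend_mono s) (dend_mono t) else 0) +
        (if arity b + cpos t = i then dend_op Succ (dend_mono s) (dend_mono t) else 0) =
        (if cpos t = ?i then dend_op Succ (dend_mono s) (dend_mono t) else (0 :: 'k dend))" by simp
    qed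
    also have "\<dots> = dend_op Succ (all_labellings b) (path_labellings ?i c)"
      unfolding cond all_labellings_def dend_op_sum
      by (subst sum.swap) (intro sum.cong refl, simp)
    also have "\<dots> = dend_op Succ (dend_power (arity b)) (spine (arity c) ?i)"
      using Op.IH(2)[of ?i] Op.prems False by (simp add: all_labellings_eq)
    also have "\<dots> = spine (arity (Op b x c)) i"
      unfolding spine_def Succ_pad_left[OF arity_pos] using False
      by (simp add: Suc_diff_le[symmetric] add.commute)
    finally show ?thesis .
  qed
qed

lemma special_mono_exists:
  "1 \<le> i \<Longrightarrow> i \<le> arity b \<Longrightarrow> \<exists>m. skeleton m = b \<and> cpos m = i \<and> special (mono_tree m)"
proof (induction b arbitrary: i)
  case Lf
  then show ?case by (intro exI[of _ Lf]) auto
next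
  case (Op b x c)
  have fp: "skeleton (map_bmon (\<lambda>_. Prec) d) = d \<and> first_pointed (mono_tree (map_bmon (\<lambda>_. Prec) d))" for d
    by (induction d) (auto simp: mono_tree_tip_special simp del: mono_tree.simps(2))
  show ?case
  proof (cases "i \<le> arity b")
    case True
    then obtain m where "skeleton m = b \<and> cpos m = i \<and> special (mono_tree m)" using Op.IH(1) Op.prems by blast
    then show ?thesis using fp[of c]
      by (intro exI[of _ "Op m Prec (map_bmon (\<lambda>_. Prec) c)"]) (auto simp: mono_tree_tip_special simp del: mono_tree.simps(2))
  next
    case False
    then have "1 \<le> i - arity b" "i - arity b \<le> arity c" using Op.prems by auto
    then obtain m where "skeleton m = c \<and> cpos m = i - arity b \<and> special (mono_tree m)"
      using Op.IH(2) by blast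
    then show ?thesis using fp[of b] False
      by (intro exI[of _ "Op (map_bmon (\<lambda>_. Prec) b) Succ m"]) (auto simp: mono_tree_tip_special simp del: mono_tree.simps(2))
  qed
qed

primrec binary_shape :: "unit bmon \<Rightarrow> shape" where
  "binary_shape Lf = Leaf"
| "binary_shape (Op s a t) = Node () [binary_shape s, binary_shape t]"

lemma shape_mono_tree [simp]: "shape_of (mono_tree m) = binary_shape (skeleton m)"
  by (induction m) auto

lemma unit_bmon_exists: "1 \<le> n \<Longrightarrow> \<exists>b :: unit bmon. arity b = n"
proof (induction n rule: dec_induct)
  case base
  show ?case by (intro exI[of _ Lf]) simp
next
  case (step n)
  then obtain b :: "unit bmon" where "arity b = n" by blast
  then show ?case by (intro exI[of _ "Op Lf () b"]) simp
qed

text \<open>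
  Among the labellings with tip \<open>k\<close> of a fixed binary tree, exactly one is special.
\<close>

lemma spine_coord:
  assumes "1 \<le> i" "i \<le> n" "1 \<le> k" "k \<le> n"
  shows "dend_coord (n, i) (spine n k :: 'k::field dend) = of_bool (i = k)"
proof -
  obtain b :: "unit bmon" where b: "arity b = n" using unit_bmon_exists[of n] assms by auto
  obtain m where m: "skeleton m = b" "cpos m = k" "special (mono_tree m)"
    using special_mono_exists[of k b] assms b by auto
  have fin: "finite {m. skeleton m = b \<and> cpos m = k}" using finite_skeleton[of b] by simp
  have uniq: "m' = m" if "skeleton m' = b" "cpos m' = k" "special (mono_tree m')" for m'
    using special_unique[of "mono_tree m'" "mono_tree m"] that m mono_tree_pointed[of m] mono_tree_pointed[of m']
      inj_mono_tree by (auto simp: pointed_trees_def dest: injD)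
  have "dend_coord (n, i) (spine n k :: 'k dend) = dend_coord (n, i) (path_labellings k b)"
    using path_labellings_eq[of k b, where 'k = 'k] assms b by simp
  also have "\<dots> = (\<Sum>m' | skeleton m' = b \<and> cpos m' = k. of_bool (dend_class m' = Some (n, i)))"
    unfolding path_labellings_def dend_coord_sum dend_coord_mono ..
  also have "\<dots> = (\<Sum>m' | skeleton m' = b \<and> cpos m' = k. if m' = m then of_bool (i = k) else 0)"
  proof (intro sum.cong refl)
    fix m' assume m': "m' \<in> {m'. skeleton m' = b \<and> cpos m' = k}"
    then have "arity m' = n" using b by auto
    then show "(of_bool (dend_class m' = Some (n, i)) :: 'k) = (if m' = m then of_bool (i = k) else 0)"
    proof (cases "m' = m")
      case True
      then show ?thesis using \<open>arity m' = n\<close> m by (auto simp: dend_class_def)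
    next
      case False
      then have "\<not> special (mono_tree m')" using uniq[of m'] m' by blast
      then show ?thesis using False by (simp add: dend_class_def)
    qed
  qed
  also have "\<dots> = of_bool (i = k)" by (subst sum.delta[OF fin]) (use m in simp)
  finally show ?thesis .
qed

lemma Dend_subspace: "dend.subspace (Dend n :: 'k::field dend set)"
  unfolding Dend_def by (rule dend.subspaceI)
    (auto simp: zero_dend.abs_eq plus_dend.abs_eq dend_scale.abs_eq intro!: imageI free_arity_subspace)

lemma dend_mono_in_Dend: "arity m = n \<Longrightarrow> dend_mono m \<in> Dend n"
  unfolding Dend_def dend_mono_def by (auto intro: free_arity_subspace)

lemma spine_in_Dend:
  assumes "1 \<le> i" "i \<le> n"
  shows "(spine n i :: 'k::field dend) \<in> Dend n"
proof -
  obtain b :: "unit bmon" where b: "arity b = n" using unit_bmon_exists[of n] assms by auto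
  have "path_labellings i b \<in> (Dend n :: 'k dend set)"
    unfolding path_labellings_def
    by (intro dend.subspace_sum Dend_subspace dend_mono_in_Dend) (use b in auto)
  then show ?thesis using path_labellings_eq[of i b, where 'k = 'k] assms b by simp
qed

lemma bar_to_dend_expand:
  "bar_to_dend n F = (\<Sum>m | arity m = n. dend_scale (F (tree_basis (mono_tree m))) (dend_mono m))"
  unfolding bar_to_dend_def abs_dend_sum abs_dend_single mono_tree_basis ..

lemma bar_to_dend_in_Dend: "(bar_to_dend n F :: 'k::field dend) \<in> Dend n"
  unfolding bar_to_dend_expand
  by (intro dend.subspace_sum dend.subspace_scale Dend_subspace dend_mono_in_Dend) auto

lemma dend_coord_bar_to_dend:
  assumes "\<And>B. B \<in> pointed_trees n \<Longrightarrow> special B \<Longrightarrow> F (tree_basis B) = 0"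
  shows "dend_coord d (bar_to_dend n F) = 0"
  unfolding bar_to_dend_expand dend_coord_sum dend_coord_scale dend_coord_mono
proof (intro sum.neutral ballI)
  fix m :: "dop bmon" assume "m \<in> {m. arity m = n}"
  then have "mono_tree m \<in> pointed_trees n" by (intro mono_tree_pointed) simp
  then show "F (tree_basis (mono_tree m)) * of_bool (dend_class m = Some d) = 0"
    using assms[of "mono_tree m"] by (cases "special (mono_tree m)") (simp_all add: dend_class_def)
qed

lemma inj_binary_shape: "inj binary_shape"
proof (rule injI)
  fix b c show "binary_shape b = binary_shape c \<Longrightarrow> b = c"
  proof (induction b arbitrary: c)
    case Lf then show ?case by (cases c) auto
  next
    case (Op s a t) then show ?case by (cases c) auto
  qed
qed

text \<open>
  Counting leaves shows that \<open>n - 1\<close> vertices are only possible if every vertex has two children.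
\<close>

lemma binary_shape_surj:
  "decorated (\<lambda>_. UNIV) (T :: shape) \<Longrightarrow> Suc (vertices T) = leaves T \<Longrightarrow> \<exists>b. T = binary_shape b \<and> arity b = leaves T"
proof (induction T)
  case Leaf
  show ?case by (intro exI[of _ Lf]) auto
next
  case (Node a ts)
  have le: "Suc (vertices t) \<le> leaves t" if "t \<in> set ts" for t
    using Node.prems(1) that vertices_less_leaves by auto
  have "(\<Sum>t\<leftarrow>ts. vertices t) + length ts \<le> (\<Sum>t\<leftarrow>ts. leaves t)"
    using le by (rule sum_vertices_add_length)
  then have "length ts = 2" using Node.prems by simp
  then obtain t u where ts: "ts = [t, u]" by (auto simp: numeral_2_eq_2 length_Suc_conv)
  have "Suc (vertices t) = leaves t" "Suc (vertices u) = leaves u"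
    using Node.prems(2) le[of t] le[of u] by (auto simp: ts)
  then obtain b c where "t = binary_shape b" "arity b = leaves t" "u = binary_shape c" "arity c = leaves u"
    using Node.IH[of t] Node.IH[of u] Node.prems(1) ts by auto
  then show ?case by (intro exI[of _ "Op b () c"]) (simp add: ts)
qed

lemma binary_shapes_eq:
  assumes "1 \<le> n"
  shows "binary_shapes n = binary_shape ` {b. arity b = n}"
proof (intro set_eqI iffI)
  fix T assume "T \<in> binary_shapes n"
  then have T: "decorated (\<lambda>_. UNIV) T" "leaves T = n" "Suc (vertices T) = leaves T"
    using assms by (auto simp: binary_shapes_def shapes_def)
  obtain b where "T = binary_shape b" "arity b = leaves T" using binary_shape_surj[OF T(1,3)] by blast
  then show "T \<in> binary_shape ` {b. arity b = n}" using T by auto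
next
  fix T assume "T \<in> binary_shape ` {b. arity b = n}"
  then obtain b where b: "T = binary_shape b" "arity b = n" by auto
  have "decorated (\<lambda>_. UNIV) (binary_shape b) \<and> leaves (binary_shape b) = arity b \<and> Suc (vertices (binary_shape b)) = arity b" for b
  proof (induction b)
    case (Op s x t)
    then show ?case using arity_pos[of s] arity_pos[of t] by auto
  qed auto
  then show "T \<in> binary_shapes n" using b unfolding binary_shapes_def shapes_def
    by (metis (mono_tags, lifting) diff_Suc_1 mem_Collect_eq)
qed

text \<open>
  The monomials are grouped by tip and underlying binary tree; the coefficient is constant on each group,
  and the class of the group depends only on the tip.
\<close>

lemma bar_to_dend_path:
  fixes g :: "nat \<Rightarrow> shape \<Rightarrow> 'k::field"
  assumes "1 \<le> n"
  shows "bar_to_dend n (bar_of_coeffs n (\<lambda>B. g (tip B) (shape_of B))) =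
    (\<Sum>i=1..n. dend_scale (\<Sum>T\<in>binary_shapes n. g i T) (spine n i))"
proof -
  let ?A = "{m :: dop bmon. arity m = n}" and ?T = "{1..n} \<times> {b :: unit bmon. arity b = n}"
  let ?f = "\<lambda>m. dend_scale (g (cpos m) (binary_shape (skeleton m))) (dend_mono m) :: 'k dend"
  have "bar_to_dend n (bar_of_coeffs n (\<lambda>B. g (tip B) (shape_of B))) = (\<Sum>m\<in>?A. ?f m)"
    unfolding bar_to_dend_expand
    by (intro sum.cong refl) (simp add: bar_of_coeffs_apply mono_tree_pointed)
  also have "\<dots> = (\<Sum>y\<in>?T. \<Sum>m\<in>{m \<in> ?A. (cpos m, skeleton m) = y}. ?f m)"
    by (rule sum.group[symmetric]) (use finite_arity finite_arity_unit cpos_bounds in \<open>auto\<close>)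
  also have "\<dots> = (\<Sum>(i, b)\<in>?T. dend_scale (g i (binary_shape b)) (spine n i))"
  proof (rule sum.cong[OF refl])
    fix y assume "y \<in> ?T"
    then obtain i and b :: "unit bmon" where y: "y = (i, b)" and i: "i \<in> {1..n}" and b: "arity b = n" by blast
    have "(\<Sum>m\<in>{m \<in> ?A. (cpos m, skeleton m) = y}. ?f m) =
      (\<Sum>m | skeleton m = b \<and> cpos m = i. dend_scale (g i (binary_shape b)) (dend_mono m))"
    proof (rule sum.cong)
      have "arity m = n" if "skeleton m = b" for m :: "dop bmon"
        using arg_cong[OF that, of arity] b by simp
      then show "{m \<in> ?A. (cpos m, skeleton m) = y} = {m. skeleton m = b \<and> cpos m = i}"
        unfolding y by blast
    qed (simp add: y)
    also have "\<dots> = dend_scale (g i (binary_shape b)) (path_labellings i b)"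
      by (simp only: path_labellings_def dend.scale_sum_right)
    also have "path_labellings i b = (spine n i :: 'k dend)"
      using path_labellings_eq[of i b, where 'k = 'k] i b by simp
    finally show "(\<Sum>m\<in>{m \<in> ?A. (cpos m, skeleton m) = y}. ?f m) =
      (case y of (i, b) \<Rightarrow> dend_scale (g i (binary_shape b)) (spine n i))"
      by (simp only: y prod.case)
  qed
  also have "\<dots> = (\<Sum>i=1..n. dend_scale (\<Sum>b | arity b = n. g i (binary_shape b)) (spine n i))"
    by (simp add: sum.cartesian_product[symmetric] dend.scale_sum_left)
  also have "\<dots> = (\<Sum>i=1..n. dend_scale (\<Sum>T\<in>binary_shapes n. g i T) (spine n i))"
    unfolding binary_shapes_eq[OF assms] by (subst sum.reindex) (auto intro: inj_on_subset[OF inj_binary_shape])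
  finally show ?thesis .
qed

section \<open>The map from the labelled associahedron\<close>

lemma DA_cmp_iff: "G \<in> DA_cmp n j \<longleftrightarrow> (\<forall>i c. G (i, c) \<noteq> 0 \<longrightarrow> i \<in> {1..n} \<and> c \<in> CA_basis n j)"
  unfolding DA_cmp_def CA_cmp_def by blast

lemma DA_cmpD: "G \<in> DA_cmp n j \<Longrightarrow> G (i, c) \<noteq> 0 \<Longrightarrow> i \<in> {1..n} \<and> c \<in> CA_basis n j"
  unfolding DA_cmp_iff by blast

lemma CA_basis_simps:
  "Cell T \<in> CA_basis n j \<longleftrightarrow> T \<in> shapes n \<and> int (vertices T) = int n + j - 1"
  "Empty_Cell \<in> CA_basis n j \<longleftrightarrow> j = 1"
  by (auto simp: CA_basis_def)

lemma shapes_vertices: "T \<in> shapes n \<Longrightarrow> Suc (vertices T) \<le> n"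
  using vertices_less_leaves[of "\<lambda>_. UNIV" T] by (auto simp: shapes_def)

text \<open>
  In degrees at most zero this is the linear extension of the map sending the \<open>i\<close>-th copy of \<open>T\<close> to the
  sum of all labelled trees with shape \<open>T\<close> and tip \<open>i\<close>.
\<close>

definition da_map :: "nat \<Rightarrow> int \<Rightarrow> (nat \<times> cell \<Rightarrow> 'k::field) \<Rightarrow> 'k bar \<times> 'k dend" where
  "da_map n j G =
     (if j \<le> 0 then (bar_of_coeffs n (\<lambda>B. G (tip B, Cell (shape_of B))), 0)
      else if j = 1 then (0, \<Sum>i=1..n. dend_scale (G (i, Empty_Cell)) (spine n i))
      else 0)"

lemma bar_of_coeffs_eqI:
  assumes "F \<in> bar_cmp n j" "\<And>B. B \<in> pointed_trees n \<Longrightarrow> c B = F (tree_basis B)"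
  shows "bar_of_coeffs n c = F"
  using bar_cmp_expand(1)[OF assms(1)] by (simp add: bar_of_coeffs_def assms(2))

lemma pointed_vertices: "B \<in> pointed_trees n \<Longrightarrow> Suc (vertices B) \<le> n"
  using vertices_less_leaves[of positions B] by (auto simp: pointed_trees_def)

lemma da_map_add: "da_map n j (x + y) = da_map n j x + da_map n j y"
  by (simp add: da_map_def bar_of_coeffs_add dend.scale_left_distrib sum.distrib)

lemma da_map_in:
  fixes G :: "nat \<times> cell \<Rightarrow> 'k::field"
  assumes "G \<in> DA_cmp n j"
  shows "da_map n j G \<in> cmp (aug_bar \<epsilon> n) j"
proof -
  have "bar_of_coeffs n (\<lambda>B. G (tip B, Cell (shape_of B))) \<in> bar_cmp n j"
  proof (rule bar_of_coeffs_in)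
    fix B assume "G (tip B, Cell (shape_of B)) \<noteq> 0"
    then have "int (vertices (shape_of B)) = int n + j - 1" by (auto simp: CA_basis_simps dest!: DA_cmpD[OF assms])
    then show "int (vertices B) = int n + j - 1" by simp
  qed
  then show ?thesis
    using spine_in_Dend
    by (auto simp: da_map_def aug_bar_def intro!: dend.subspace_sum dend.subspace_scale Dend_subspace)
qed

lemma da_map_cochain:
  fixes \<epsilon> :: "shape \<Rightarrow> shape \<Rightarrow> int"
  assumes eps: "incidence_numbers \<epsilon>" and n: "2 \<le> n"
  shows "cochain_map (DA \<epsilon> n) (aug_bar \<epsilon> n) (da_map n :: int \<Rightarrow> (nat \<times> cell \<Rightarrow> 'k::field) \<Rightarrow> _)"
  unfolding cochain_map_def
proof (intro allI ballI conjI)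
  fix j and x :: "nat \<times> cell \<Rightarrow> 'k"
  assume "x \<in> cmp (DA \<epsilon> n) j"
  then have x: "x \<in> DA_cmp n j" by (simp add: DA_def)
  show da_in: "da_map n j x \<in> cmp (aug_bar \<epsilon> n) j" using x by (rule da_map_in)
  show "da_map n j (x + y) = da_map n j x + da_map n j y" for y by (rule da_map_add)
  show "da_map n j (scl (DA \<epsilon> n) c x) = scl (aug_bar \<epsilon> n) c (da_map n j x)" for c
    by (simp add: da_map_def DA_def aug_bar_def fscale_def bar_of_coeffs_scale[unfolded fscale_def]
        dend.scale_sum_right zero_prod_def zero_fun_def)
  show "da_map n (j + 1) (dif (DA \<epsilon> n) j x) = dif (aug_bar \<epsilon> n) j (da_map n j x)"
  proof -
    consider "j < 0" | "j = 0" | "1 \<le> j" by linarith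
    then show ?thesis
    proof cases
      case 1
      let ?F = "bar_of_coeffs n (\<lambda>B. x (tip B, Cell (shape_of B)))"
      have in_bar: "?F \<in> bar_cmp n j" using da_in 1 by (simp add: da_map_def aug_bar_def)
      have "bar_of_coeffs n (\<lambda>B. dif (DA \<epsilon> n) j x (tip B, Cell (shape_of B))) = bar_dif \<epsilon> ?F"
      proof (rule bar_of_coeffs_eqI[OF bar_dif_in_bar_cmp[OF in_bar]])
        fix B assume B: "B \<in> pointed_trees n"
        then have d: "decorated positions B" by (simp add: pointed_trees_def)
        have "bar_dif \<epsilon> ?F (tree_basis B) = (\<Sum>B'\<leftarrow>contractions pcomp B.
            of_int (\<epsilon> (shape_of B') (shape_of B)) * x (tip B', Cell (shape_of B')))"
          unfolding bar_dif_tree_basis[OF d]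
          by (intro arg_cong[of _ _ sum_list] map_cong refl)
             (simp add: bar_of_coeffs_apply contractions_pointed[OF B])
        also have "\<dots> = (\<Sum>B'\<leftarrow>contractions pcomp B.
            of_int (\<epsilon> (shape_of B') (shape_of B)) * x (tip B, Cell (shape_of B')))"
          by (intro arg_cong[of _ _ sum_list] map_cong refl) (simp add: tip_contraction[OF d])
        also have "\<dots> = (\<Sum>T\<leftarrow>map shape_of (contractions pcomp B).
            of_int (\<epsilon> T (shape_of B)) * x (tip B, Cell T))"
          by (simp add: o_def)
        also have "\<dots> = (\<Sum>T\<in>shapes n. of_int (\<epsilon> T (shape_of B)) * x (tip B, Cell T))"
          unfolding contractions_shape[OF d] by (rule incidence_sum[OF eps shape_pointed_trees[OF B], symmetric])
        also have "\<dots> = dif (DA \<epsilon> n) j x (tip B, Cell (shape_of B))"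
          using shape_pointed_trees[OF B] by (simp add: DA_def CA_dif_def)
        finally show "dif (DA \<epsilon> n) j x (tip B, Cell (shape_of B)) = bar_dif \<epsilon> ?F (tree_basis B)" by simp
      qed
      then show ?thesis using 1 by (simp add: da_map_def aug_bar_def)
    next
      case 2
      then show ?thesis
        using bar_to_dend_path[of n "\<lambda>i T. x (i, Cell T)"] n
        by (simp add: da_map_def aug_bar_def DA_def CA_dif_def)
    next
      case 3
      then show ?thesis by (simp add: da_map_def aug_bar_def)
    qed
  qed
qed

definition special_tree :: "nat \<Rightarrow> shape \<Rightarrow> (nat \<times> nat) ptree" where
  "special_tree i T = (SOME B. decorated positions B \<and> shape_of B = T \<and> special B \<and> tip B = i)"

lemma special_tree:
  assumes "T \<in> shapes n" "i \<in> {1..n}"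
  shows "special_tree i T \<in> pointed_trees n" "shape_of (special_tree i T) = T"
    "special (special_tree i T)" "tip (special_tree i T) = i"
proof -
  have "\<exists>B. decorated positions B \<and> shape_of B = T \<and> special B \<and> tip B = i"
    using assms by (intro special_exists) (auto simp: shapes_def)
  then have *: "decorated positions (special_tree i T) \<and> shape_of (special_tree i T) = T \<and>
      special (special_tree i T) \<and> tip (special_tree i T) = i"
    unfolding special_tree_def by (rule someI_ex)
  then show "shape_of (special_tree i T) = T" "special (special_tree i T)" "tip (special_tree i T) = i" by auto
  have "leaves (special_tree i T) = leaves T"
    using arg_cong[OF \<open>shape_of (special_tree i T) = T\<close>, of leaves] by simp
  then show "special_tree i T \<in> pointed_trees n" using * assms by (auto simp: pointed_trees_def shapes_def)
qed

lemma special_tree_of_special: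
  assumes "B \<in> pointed_trees n" "special B"
  shows "special_tree (tip B) (shape_of B) = B"
proof -
  have "decorated positions B" using assms by (simp add: pointed_trees_def)
  then have "tip B \<in> {1..n}" using tip_bounds[of B] assms by (auto simp: pointed_trees_def)
  then show ?thesis
    using special_tree[OF shape_pointed_trees[OF assms(1)]] assms
    by (intro special_unique) (auto simp: pointed_trees_def)
qed

definition complement :: "nat \<Rightarrow> int \<Rightarrow> ('k::field bar \<times> 'k dend) set" where
  "complement n j =
     (if j \<le> 0 then {F \<in> bar_cmp n j. \<forall>B\<in>pointed_trees n. special B \<longrightarrow> F (tree_basis B) = 0} \<times> {0}
      else if j = 1 then {0} \<times> {x \<in> Dend n. \<forall>i\<in>{1..n}. dend_coord (n, i) x = 0}
      else {0})"

text \<open>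
  The coefficient at the special tree with shape \<open>T\<close> and tip \<open>i\<close> recovers the coefficient at the
  \<open>i\<close>-th copy of \<open>T\<close>.  This gives injectivity as well as the trivial intersection with the complement.
\<close>

lemma da_map_detect:
  fixes G :: "nat \<times> cell \<Rightarrow> 'k::field"
  assumes G: "G \<in> DA_cmp n j" and K: "da_map n j G \<in> complement n j"
  shows "G = 0"
proof
  fix a show "G a = 0 a"
  proof (cases a)
    case a: (Pair i c)
    show ?thesis
    proof (rule ccontr)
      assume ne: "G a \<noteq> 0 a"
      then have ne: "G (i, c) \<noteq> 0" by (simp add: a)
      from DA_cmpD[OF G ne] have i: "i \<in> {1..n}" and c: "c \<in> CA_basis n j" by blast+
      show False
      proof (cases c)
        case (Cell T)
        with c have T: "T \<in> shapes n" "int (vertices T) = int n + j - 1" by (simp_all add: CA_basis_simps)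
        have j: "j \<le> 0" using T shapes_vertices[of T n] by simp
        note s = special_tree[OF T(1) i]
        have "bar_of_coeffs n (\<lambda>B. G (tip B, Cell (shape_of B))) (tree_basis (special_tree i T)) = (0::'k)"
          using K j s by (auto simp: da_map_def complement_def)
        then show False using ne Cell s by (simp add: bar_of_coeffs_apply)
      next
        case Empty_Cell
        with c have j: "j = 1" by (simp add: CA_basis_simps)
        have "(\<Sum>k=1..n. G (k, Empty_Cell) * dend_coord (n, i) (spine n k)) = 0"
          using K j i by (simp add: da_map_def complement_def dend_coord_sum dend_coord_scale)
        also have "(\<Sum>k=1..n. G (k, Empty_Cell) * dend_coord (n, i) (spine n k)) =
            (\<Sum>k=1..n. if k = i then G (i, Empty_Cell) else 0)"
          using i by (intro sum.cong refl) (auto simp: spine_coord)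
        also have "\<dots> = G (i, Empty_Cell)" using i by simp
        finally show False using ne Empty_Cell by simp
      qed
    qed
  qed
qed

lemma DA_cmp_subspace: "fvs.subspace (DA_cmp n j)"
proof (rule fvs.subspaceI)
  show "x + y \<in> DA_cmp n j" if "x \<in> DA_cmp n j" "y \<in> DA_cmp n j" for x y
    unfolding DA_cmp_iff using DA_cmpD[OF that(1)] DA_cmpD[OF that(2)] by (metis add_0 plus_fun_apply)
qed (auto simp: DA_cmp_iff fscale_def)

lemma module_aug_bar: "module (scl (aug_bar \<epsilon> n) :: 'k::field \<Rightarrow> _)"
  by standard (auto simp: aug_bar_def fvs.scale_right_distrib fvs.scale_left_distrib dend.scale_right_distrib
      dend.scale_left_distrib)

lemma aug_bar_subspace:
  "module.subspace (scl (aug_bar \<epsilon> n)) (cmp (aug_bar \<epsilon> n) j :: ('k::field bar \<times> 'k dend) set)"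
proof (rule module.subspaceI[OF module_aug_bar])
  let ?C = "cmp (aug_bar \<epsilon> n) j :: ('k bar \<times> 'k dend) set"
  note bar = fvs.subspace_0[OF bar_cmp_subspace] fvs.subspace_add[OF bar_cmp_subspace]
    fvs.subspace_scale[OF bar_cmp_subspace]
  note dend = dend.subspace_0[OF Dend_subspace] dend.subspace_add[OF Dend_subspace]
    dend.subspace_scale[OF Dend_subspace]
  have "(0 :: 'k bar) \<in> bar_cmp n j" "(0 :: 'k dend) \<in> Dend n" by (rule bar dend)+
  then show "0 \<in> ?C" by (simp add: aug_bar_def zero_prod_def)
  show "x + y \<in> ?C" if "x \<in> ?C" "y \<in> ?C" for x y
    using that by (auto simp: aug_bar_def split: if_splits intro: bar dend)
  show "scl (aug_bar \<epsilon> n) c x \<in> ?C" if "x \<in> ?C" for c x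
    using that fvs.scale_zero_right[of c, where 'b = "'k dias ptree"]
    by (auto simp: aug_bar_def zero_prod_def split: if_splits intro: bar dend)
qed

text \<open>
  The differential preserves the vanishing at special trees because the contractions of a special tree are
  special; into degree one, because \<^const>\<open>dend_coord\<close> only sees special monomials.
\<close>

lemma complement_closed:
  fixes \<epsilon> :: "shape \<Rightarrow> shape \<Rightarrow> int"
  shows "complement n j \<subseteq> (cmp (aug_bar \<epsilon> n) j :: ('k::field bar \<times> 'k dend) set)"
    and "module.subspace (scl (aug_bar \<epsilon> n)) (complement n j :: ('k bar \<times> 'k dend) set)"
    and "dif (aug_bar \<epsilon> n) j ` complement n j \<subseteq> (complement n (j + 1) :: ('k bar \<times> 'k dend) set)"
proof -
  let ?K = "complement n j :: ('k bar \<times> 'k dend) set"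
  show sub: "?K \<subseteq> cmp (aug_bar \<epsilon> n) j"
    by (auto simp: complement_def aug_bar_def)
  define van :: "'k bar \<times> 'k dend \<Rightarrow> bool" where
    "van y \<longleftrightarrow> (\<forall>B\<in>pointed_trees n. special B \<longrightarrow> fst y (tree_basis B) = 0) \<and>
       (\<forall>i\<in>{1..n}. dend_coord (n, i) (snd y) = 0)" for y
  have K: "?K = {y \<in> cmp (aug_bar \<epsilon> n) j. van y}"
    by (auto simp: complement_def aug_bar_def van_def zero_prod_def)
  note S = aug_bar_subspace[of \<epsilon> n j, where 'k = 'k]
  have van: "van 0" "van x \<Longrightarrow> van y \<Longrightarrow> van (x + y)" "van x \<Longrightarrow> van (scl (aug_bar \<epsilon> n) c x)" for x y c
    by (auto simp: van_def aug_bar_def fscale_def dend_coord_add dend_coord_scale case_prod_unfold)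
  show "module.subspace (scl (aug_bar \<epsilon> n)) ?K"
    unfolding K using van module.subspace_0[OF module_aug_bar S] module.subspace_add[OF module_aug_bar S]
      module.subspace_scale[OF module_aug_bar S]
    by (intro module.subspaceI[OF module_aug_bar]) auto
  show "dif (aug_bar \<epsilon> n) j ` complement n j \<subseteq> (complement n (j + 1) :: ('k bar \<times> 'k dend) set)"
  proof
    fix y :: "'k bar \<times> 'k dend" assume "y \<in> dif (aug_bar \<epsilon> n) j ` complement n j"
    then obtain x where x: "x \<in> complement n j" "y = dif (aug_bar \<epsilon> n) j x" by blast
    consider "j < 0" | "j = 0" | "1 \<le> j" by linarith
    then show "y \<in> complement n (j + 1)"
    proof cases
      case 1
      then obtain F where F: "x = (F, 0)" "F \<in> bar_cmp n j" "\<And>B. B \<in> pointed_trees n \<Longrightarrow> special B \<Longrightarrow> F (tree_basis B) = 0"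
        using x by (auto simp: complement_def)
      have "bar_dif \<epsilon> F (tree_basis B) = 0" if B: "B \<in> pointed_trees n" "special B" for B
      proof -
        have d: "decorated positions B" using B by (simp add: pointed_trees_def)
        have "F (tree_basis B') = 0" if "B' \<in> set (contractions pcomp B)" for B'
          using that contractions_pointed[OF B(1)] tip_special_contraction[OF d] B(2) F(3) by blast
        then have "(\<Sum>B'\<leftarrow>contractions pcomp B. of_int (\<epsilon> (shape_of B') (shape_of B)) * F (tree_basis B')) =
          (\<Sum>B'\<leftarrow>contractions pcomp B. 0)"
          by (intro arg_cong[of _ _ sum_list] map_cong refl) simp
        then show ?thesis unfolding bar_dif_tree_basis[OF d] by simp
      qed
      then show ?thesis
        using 1 F(1) x(2) bar_dif_in_bar_cmp[OF F(2), of \<epsilon>] by (simp add: complement_def aug_bar_def)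
    next
      case 2
      then obtain F where F: "x = (F, 0)" "\<And>B. B \<in> pointed_trees n \<Longrightarrow> special B \<Longrightarrow> F (tree_basis B) = 0"
        using x by (auto simp: complement_def)
      then show ?thesis
        using 2 x(2) dend_coord_bar_to_dend[of n F] bar_to_dend_in_Dend[of n F] by (simp add: complement_def aug_bar_def)
    next
      case 3
      then show ?thesis using x by (simp add: complement_def aug_bar_def)
    qed
  qed
qed

text \<open>
  The element \<open>G\<close> copies the coefficients of \<open>y\<close> at the special trees, and in degree one its
  coordinates.
\<close>

lemma da_map_complement_sum:
  fixes y :: "'k::field bar \<times> 'k dend"
  assumes y: "y \<in> cmp (aug_bar \<epsilon> n) j"
  shows "\<exists>G\<in>DA_cmp n j. y - da_map n j G \<in> complement n j"
proof -
  consider "j \<le> 0" | "j = 1" | "2 \<le> j" by linarith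
  then show ?thesis
  proof cases
    case j: 1
    then obtain F where F: "y = (F, 0)" "F \<in> bar_cmp n j" using y by (auto simp: aug_bar_def)
    define G :: "nat \<times> cell \<Rightarrow> 'k" where "G = (\<lambda>(i, c). case c of
      Cell T \<Rightarrow> if i \<in> {1..n} \<and> T \<in> shapes n then F (tree_basis (special_tree i T)) else 0 | Empty_Cell \<Rightarrow> 0)"
    have "G \<in> DA_cmp n j"
      unfolding DA_cmp_iff
    proof (intro allI impI)
      fix i c assume "G (i, c) \<noteq> 0"
      then obtain T where T: "c = Cell T" "i \<in> {1..n}" "T \<in> shapes n" "F (tree_basis (special_tree i T)) \<noteq> 0"
        by (auto simp: G_def split: cell.splits if_splits)
      have "int (vertices (special_tree i T)) = int n + j - 1"
        using bar_cmp_expand(2)[OF F(2) special_tree(1)[OF T(3,2)] T(4)] .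
      moreover have "vertices (special_tree i T) = vertices T"
        using arg_cong[OF special_tree(2)[OF T(3,2)], of vertices] by simp
      ultimately show "i \<in> {1..n} \<and> c \<in> CA_basis n j" using T by (simp add: CA_basis_simps)
    qed
    moreover have "y - da_map n j G \<in> complement n j"
    proof -
      let ?F' = "bar_of_coeffs n (\<lambda>B. G (tip B, Cell (shape_of B)))"
      have F': "?F' \<in> bar_cmp n j"
        using da_map_in[OF \<open>G \<in> DA_cmp n j\<close>, of \<epsilon>] j by (simp add: da_map_def aug_bar_def)
      have "(F - ?F') (tree_basis B) = 0" if B: "B \<in> pointed_trees n" "special B" for B
      proof -
        have "tip B \<in> {1..n}" using tip_bounds[of B] B by (auto simp: pointed_trees_def)
        then have "G (tip B, Cell (shape_of B)) = F (tree_basis B)"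
          using shape_pointed_trees[OF B(1)] special_tree_of_special[OF B] by (simp add: G_def)
        then show ?thesis using B by (simp add: bar_of_coeffs_apply)
      qed
      moreover have "F - ?F' \<in> bar_cmp n j" using F(2) F' by (rule fvs.subspace_diff[OF bar_cmp_subspace])
      ultimately show ?thesis using j by (simp add: F(1) da_map_def complement_def)
    qed
    ultimately show ?thesis by blast
  next
    case j: 2
    then obtain x where x: "y = (0, x)" "x \<in> Dend n" using y by (auto simp: aug_bar_def)
    define G :: "nat \<times> cell \<Rightarrow> 'k" where "G = (\<lambda>(i, c). case c of
      Cell T \<Rightarrow> 0 | Empty_Cell \<Rightarrow> if i \<in> {1..n} then dend_coord (n, i) x else 0)"
    have G: "G \<in> DA_cmp n j"
      using j by (auto simp: DA_cmp_iff G_def CA_basis_simps split: cell.splits if_splits)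
    let ?x' = "\<Sum>i=1..n. dend_scale (G (i, Empty_Cell)) (spine n i) :: 'k dend"
    have "?x' \<in> Dend n" using da_map_in[OF G, of \<epsilon>] j by (simp add: da_map_def aug_bar_def)
    then have "x - ?x' \<in> Dend n" using x(2) dend.subspace_diff[OF Dend_subspace] by blast
    moreover have "dend_coord (n, k) (x - ?x') = 0" if k: "k \<in> {1..n}" for k
    proof -
      have "dend_coord (n, k) ?x' = (\<Sum>i=1..n. if i = k then dend_coord (n, k) x else 0)"
        unfolding dend_coord_sum dend_coord_scale
        using k by (intro sum.cong refl) (auto simp: spine_coord G_def)
      also have "\<dots> = dend_coord (n, k) x" using k by simp
      finally have "dend_coord (n, k) ?x' = dend_coord (n, k) x" .
      moreover have "dend_coord (n, k) x = dend_coord (n, k) (x - ?x') + dend_coord (n, k) ?x'"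
        by (subst dend_coord_add[symmetric]) simp
      ultimately show ?thesis by simp
    qed
    ultimately have "y - da_map n j G \<in> complement n j" using j by (simp add: x(1) da_map_def complement_def)
    then show ?thesis using G by blast
  next
    case 3
    then have "y = 0" using y by (auto simp: aug_bar_def)
    moreover have "(0 :: nat \<times> cell \<Rightarrow> 'k) \<in> DA_cmp n j" by (rule fvs.subspace_0[OF DA_cmp_subspace])
    ultimately show ?thesis using 3 by (intro bexI[of _ 0]) (auto simp: da_map_def complement_def)
  qed
qed

lemma da_map_onto_direct_summand:
  fixes \<epsilon> :: "shape \<Rightarrow> shape \<Rightarrow> int"
  shows "onto_direct_summand (DA \<epsilon> n) (aug_bar \<epsilon> n) (da_map n :: int \<Rightarrow> (nat \<times> cell \<Rightarrow> 'k::field) \<Rightarrow> _)"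
  unfolding onto_direct_summand_def
proof (intro conjI allI exI)
  fix j
  have cmp_DA: "cmp (DA \<epsilon> n) j = (DA_cmp n j :: (nat \<times> cell \<Rightarrow> 'k) set)" by (simp add: DA_def)
  have zero: "(0 :: 'k bar \<times> 'k dend) \<in> complement n j"
    using module.subspace_0[OF module_aug_bar complement_closed(2)] .
  show "inj_on (da_map n j) (cmp (DA \<epsilon> n) j :: (nat \<times> cell \<Rightarrow> 'k) set)"
    unfolding cmp_DA
  proof (rule inj_onI)
    fix x y :: "nat \<times> cell \<Rightarrow> 'k" assume xy: "x \<in> DA_cmp n j" "y \<in> DA_cmp n j" "da_map n j x = da_map n j y"
    have "x - y \<in> DA_cmp n j" using xy by (intro fvs.subspace_diff[OF DA_cmp_subspace])
    moreover have "da_map n j (x - y) = 0" using da_map_add[of n j "x - y" y] xy(3) by simp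
    ultimately have "x - y = 0" using da_map_detect[of "x - y" n j] zero by simp
    then show "x = y" by simp
  qed
  show "module.subspace (scl (aug_bar \<epsilon> n)) (complement n j :: ('k bar \<times> 'k dend) set)"
    "complement n j \<subseteq> (cmp (aug_bar \<epsilon> n) j :: ('k bar \<times> 'k dend) set)"
    "dif (aug_bar \<epsilon> n) j ` complement n j \<subseteq> (complement n (j + 1) :: ('k bar \<times> 'k dend) set)"
    by (rule complement_closed)+
  show "(cmp (aug_bar \<epsilon> n) j :: ('k bar \<times> 'k dend) set) =
      {x + y | x y. x \<in> da_map n j ` cmp (DA \<epsilon> n) j \<and> y \<in> complement n j}" (is "?L = ?R")
  proof (intro set_eqI iffI)
    fix y :: "'k bar \<times> 'k dend" assume "y \<in> ?L"
    then obtain G where "G \<in> DA_cmp n j" "y - da_map n j G \<in> complement n j"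
      using da_map_complement_sum by blast
    moreover have "y = da_map n j G + (y - da_map n j G)" by simp
    ultimately show "y \<in> ?R" unfolding cmp_DA by blast
  next
    fix y :: "'k bar \<times> 'k dend" assume "y \<in> ?R"
    then obtain G k where *: "y = da_map n j G + k" "G \<in> DA_cmp n j" "k \<in> complement n j" unfolding cmp_DA by blast
    have "module.subspace (scl (aug_bar \<epsilon> n)) (cmp (aug_bar \<epsilon> n) j :: ('k bar \<times> 'k dend) set)"
      by (rule aug_bar_subspace)
    moreover have "da_map n j G \<in> cmp (aug_bar \<epsilon> n) j" "k \<in> cmp (aug_bar \<epsilon> n) j"
      using da_map_in[OF *(2)] complement_closed(1) *(3) by blast+
    ultimately show "y \<in> ?L" unfolding *(1) by (rule module.subspace_add[OF module_aug_bar])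
  qed
  show "da_map n j ` cmp (DA \<epsilon> n) j \<inter> complement n j = ({0} :: ('k bar \<times> 'k dend) set)"
  proof -
    have "da_map n j (0 :: nat \<times> cell \<Rightarrow> 'k) = 0" using da_map_add[of n j 0 "0 :: nat \<times> cell \<Rightarrow> 'k"] by simp
    moreover have "(0 :: nat \<times> cell \<Rightarrow> 'k) \<in> DA_cmp n j" by (rule fvs.subspace_0[OF DA_cmp_subspace])
    ultimately have "0 \<in> da_map n j ` (DA_cmp n j :: (nat \<times> cell \<Rightarrow> 'k) set)" by (metis image_eqI)
    moreover have "da_map n j G = 0" if "G \<in> DA_cmp n j" "da_map n j G \<in> complement n j" for G :: "nat \<times> cell \<Rightarrow> 'k"
      using da_map_detect[OF that] \<open>da_map n j 0 = 0\<close> by simp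
    ultimately show ?thesis unfolding cmp_DA using zero by blast
  qed
qed

lemma bar_coeff_da_map:
  assumes "incidence_numbers \<epsilon>" "L \<in> labelled_trees n"
  shows "bar_coeff \<epsilon> n L (da_map n j G :: 'k::field bar \<times> 'k dend) =
    (if j \<le> 0 then G (tip (point L), Cell (shape_of (point L))) else 0)"
proof -
  have z: "(0 :: 'k bar) = bar_of_coeffs n (\<lambda>_. 0)" by (simp add: bar_of_coeffs_def)
  show ?thesis
  proof (cases "j \<le> 0")
    case True
    then show ?thesis by (simp add: da_map_def bar_coeff_eq[OF assms])
  next
    case False
    then have "fst (da_map n j G) = bar_of_coeffs n (\<lambda>_. 0)"
      unfolding z[symmetric] by (simp add: da_map_def)
    then have "bar_coeff \<epsilon> n L (da_map n j G) = bar_coeff \<epsilon> n L (bar_of_coeffs n (\<lambda>_. 0 :: 'k), snd (da_map n j G))"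
      by (metis prod.collapse)
    then show ?thesis using False by (simp add: bar_coeff_eq[OF assms])
  qed
qed

theorem proposition3p9:
  fixes \<epsilon> :: "shape \<Rightarrow> shape \<Rightarrow> int" and n :: nat
  assumes "incidence_numbers \<epsilon>" and "2 \<le> n"
  shows "\<exists>\<phi> :: int \<Rightarrow> (nat \<times> cell \<Rightarrow> 'k::{alg_closed_field, field_char_0}) \<Rightarrow> 'k bar \<times> 'k dend.
    cochain_map (DA \<epsilon> n) (aug_bar \<epsilon> n) \<phi> \<and>
    onto_direct_summand (DA \<epsilon> n) (aug_bar \<epsilon> n) \<phi> \<and>
    (\<forall>L\<in>labelled_trees n.
       \<exists>j. \<exists>a\<in>DA_basis n j.
         bar_coeff \<epsilon> n L (\<phi> j (unit_fun a)) = 1 \<and>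
         (\<forall>j'. \<forall>a'\<in>DA_basis n j'. a' \<noteq> a \<longrightarrow> bar_coeff \<epsilon> n L (\<phi> j' (unit_fun a')) = 0))"
proof (intro exI[of _ "da_map n"] conjI ballI)
  show "cochain_map (DA \<epsilon> n) (aug_bar \<epsilon> n) (da_map n :: int \<Rightarrow> (nat \<times> cell \<Rightarrow> 'k) \<Rightarrow> _)"
    using assms by (rule da_map_cochain)
  show "onto_direct_summand (DA \<epsilon> n) (aug_bar \<epsilon> n) (da_map n :: int \<Rightarrow> (nat \<times> cell \<Rightarrow> 'k) \<Rightarrow> _)"
    by (rule da_map_onto_direct_summand)
  fix L assume L: "L \<in> labelled_trees n"
  define B where "B = point L"
  have B: "B \<in> pointed_trees n" using point_pointed[OF L] by (simp add: B_def)
  let ?a = "(tip B, Cell (shape_of B))"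
  let ?j = "int (vertices B) - int n + 1"
  have "bar_coeff \<epsilon> n L (da_map n ?j (unit_fun ?a :: _ \<Rightarrow> 'k)) = 1"
    using pointed_vertices[OF B] by (simp add: bar_coeff_da_map[OF assms(1) L] unit_fun_def B_def)
  moreover have "?a \<in> DA_basis n ?j"
    using tip_bounds[of B] B shape_pointed_trees[OF B]
    by (auto simp: DA_basis_def CA_basis_simps pointed_trees_def)
  moreover have "\<forall>j'. \<forall>a'\<in>DA_basis n j'. a' \<noteq> ?a \<longrightarrow> bar_coeff \<epsilon> n L (da_map n j' (unit_fun a' :: _ \<Rightarrow> 'k)) = 0"
    by (auto simp: bar_coeff_da_map[OF assms(1) L] unit_fun_def B_def)
  ultimately show "\<exists>j. \<exists>a\<in>DA_basis n j.
         bar_coeff \<epsilon> n L (da_map n j (unit_fun a) :: 'k bar \<times> 'k dend) = 1 \<and>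
         (\<forall>j'. \<forall>a'\<in>DA_basis n j'. a' \<noteq> a \<longrightarrow>
            bar_coeff \<epsilon> n L (da_map n j' (unit_fun a') :: 'k bar \<times> 'k dend) = 0)"
    by blast
qed

end
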